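(* There is a polynomial time algorithm that, for any $\Delta$-regular graph $G=(V,E)$ with $n$ vertices, any $\delta>0$, any $h^*\leq\Delta(1-\frac{2}{e})$, and any feasible solution $\lambda,\mathbf{x},\mathbf{y}$ of SDP 2 (with parameters $\delta,h^*$), returns a set $S\subseteq V$ of size $|S|\geq 3\delta n/8$ and spectral expansion $$\lambda_2(L_{G[S]})\gtrsim\frac{\lambda^2}{\Delta\log^2\delta\cdot(1+2h^*/\Delta)^{O(\Delta/\lambda)}}.$$
   Context: $G$ is an undirected, unweighted, $\Delta$-regular graph on vertex set $V$, $n=|V|$. For vertices $u,v$ let $\mathbf{1}_{u,v}\in\mathbb{R}^V$ be $1$ at $v$, $-1$ at $u$, $0$ elsewhere, $L_{u,v}=\mathbf{1}_{u,v}\mathbf{1}_{u,v}^\intercal$, and for an edge $e=\{u,v\}$, $L_e=L_{u,v}$. The Laplacian of a graph $H$ is $L_H=\sum_{\{u,v\}\in E(H)}L_{u,v}$, $\lambda_2(L_H)$ its second smallest eigenvalue, and $G[S]$ the induced subgraph on $S$. $A\succeq B$ means $A-B$ is positive semidefinite. SDP 2 (parameters $\delta,h^*$): variables $\lambda$, $\mathbf{x}=(x_e)_{e\in E}$, $\mathbf{y}=(y_{\{u,v\}})_{u,v\in V}$; maximize $\lambda$ subject to (1) $\sum_{e\in E}x_eL_e\succeq\lambda\sum_{u,v\in V}y_{\{u,v\}}L_{u,v}$; (2) $\sum_{v}y_{\{u,v\}}\geq\max_{e\ni u}x_e$ for all $u\in V$; (3) $\delta n\cdot y_{\{u,v\}}\leq\sum_{w}y_{\{u,w\}}$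 for all $u,v\in V$; (4) $\mathbf{x},\mathbf{y}\geq 0$, $\mathbf{x}\neq 0$; (5) $\sum_{e}x_e\geq\frac{\Delta-h^*}{2}\sum_{u\in V}\max_{e\ni u}x_e$. The paper takes feasible solutions with $\lambda>0$. $\log^2\delta=(\log\delta)^2$; $A\gtrsim B$ means $A\geq cB$ for an absolute constant $c>0$, and $O(\cdot)$ hides an absolute constant.
   Formalization: log²δ is replaced by max(1,(ln δ)²), since the literal bound fails for K_n with δ=1−1/n, h*=0; y is indexed by pairs of distinct vertices; the algorithm takes rational inputs, with existence of S shown for all real parameters. *)

theory Defs
  imports
    Complex_Main
    "HOL-Library.Log_Nat"
    "HOL-Library.Multiset"
    "HOL-Computational_Algebra.Polynomial"
    "Jordan_Normal_Form.Char_Poly"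
begin

section \<open>Graphs and Laplacians\<close>

text \<open>Vertices are natural numbers and edges are two-element sets. A matrix with rows and
  columns indexed by a vertex set is written as a function of two vertices.\<close>

definition simple_graph :: "nat set \<Rightarrow> nat set set \<Rightarrow> bool" where
  "simple_graph V E \<longleftrightarrow> finite V \<and> (\<forall>e\<in>E. e \<subseteq> V \<and> card e = 2)"

definition regular_graph :: "nat set \<Rightarrow> nat set set \<Rightarrow> nat \<Rightarrow> bool" where
  "regular_graph V E \<Delta> \<longleftrightarrow> simple_graph V E \<and> (\<forall>u\<in>V. card {e\<in>E. u \<in> e} = \<Delta>)"

definition induced_edges :: "nat set set \<Rightarrow> nat set \<Rightarrow> nat set set" where
  "induced_edges E S = {e\<in>E. e \<subseteq> S}"

definition pair_vec :: "nat \<Rightarrow> nat \<Rightarrow> nat \<Rightarrow> real" where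
  "pair_vec u v a = (if a = v then 1 else if a = u then -1 else 0)"

definition pair_lap :: "nat \<Rightarrow> nat \<Rightarrow> nat \<Rightarrow> nat \<Rightarrow> real" where
  "pair_lap u v a b = pair_vec u v a * pair_vec u v b"

text \<open>The endpoints of an edge are extracted as its minimum and maximum; by the lemma below
  the orientation is immaterial.\<close>

definition edge_lap :: "nat set \<Rightarrow> nat \<Rightarrow> nat \<Rightarrow> real" where
  "edge_lap e = pair_lap (Min e) (Max e)"

lemma edge_lap_pair: "u \<noteq> v \<Longrightarrow> edge_lap {u, v} = pair_lap u v"
  by (intro ext) (auto simp: edge_lap_def pair_lap_def pair_vec_def min_def max_def)

definition laplacian :: "nat set set \<Rightarrow> nat \<Rightarrow> nat \<Rightarrow> real" where
  "laplacian E a b = (\<Sum>e\<in>E. edge_lap e a b)"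

definition mat_on :: "nat set \<Rightarrow> (nat \<Rightarrow> nat \<Rightarrow> real) \<Rightarrow> real mat" where
  "mat_on V M = (let vs = sorted_list_of_set V
     in mat (card V) (card V) (\<lambda>(i, j). M (vs ! i) (vs ! j)))"

text \<open>Second entry of the increasing list of eigenvalues, repeated according to
  multiplicity. For a real symmetric matrix this list has as many entries as the matrix has
  rows, so the value is only meaningful when there are at least two rows.\<close>

definition lambda2 :: "real mat \<Rightarrow> real" where
  "lambda2 A = sorted_list_of_multiset (proots (char_poly A)) ! 1"

definition loewner_ge ::
    "nat set \<Rightarrow> (nat \<Rightarrow> nat \<Rightarrow> real) \<Rightarrow> (nat \<Rightarrow> nat \<Rightarrow> real) \<Rightarrow> bool" where
  "loewner_ge V A B \<longleftrightarrow>
     (\<forall>a\<in>V. \<forall>b\<in>V. A a b - B a b = A b a - B b a) \<and>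
     (\<forall>z :: nat \<Rightarrow> real. 0 \<le> (\<Sum>a\<in>V. \<Sum>b\<in>V. z a * (A a b - B a b) * z b))"

section \<open>The semidefinite program\<close>

text \<open>The variables \<open>y\<close> are indexed by unordered pairs of \<^emph>\<open>distinct\<close> vertices: a diagonal
  variable would contribute to the degree constraints but, as \<open>L\<^bsub>u,u\<^esub>\<close> vanishes, not to the
  spectral constraint, and could make the program unbounded. The sum over \<open>u, v \<in> V\<close> in the
  spectral constraint runs over ordered pairs; summing over unordered pairs only rescales
  \<open>\<lambda>\<close> by a factor 2.

  The maxima below range over nonempty sets whenever the graph is regular of positive degree,
  which \<open>x \<noteq> 0\<close> forces.\<close>

definition sdp2_feasible ::
    "nat set \<Rightarrow> nat set set \<Rightarrow> nat \<Rightarrow> real \<Rightarrow> real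
     \<Rightarrow> real \<Rightarrow> (nat set \<Rightarrow> real) \<Rightarrow> (nat set \<Rightarrow> real) \<Rightarrow> bool" where
  "sdp2_feasible V E \<Delta> \<delta> h lam x y \<longleftrightarrow>
     loewner_ge V
       (\<lambda>a b. \<Sum>e\<in>E. x e * edge_lap e a b)
       (\<lambda>a b. lam * (\<Sum>u\<in>V. \<Sum>v\<in>V - {u}. y {u, v} * pair_lap u v a b)) \<and>
     (\<forall>u\<in>V. (\<Sum>v\<in>V - {u}. y {u, v}) \<ge> (MAX e\<in>{e\<in>E. u \<in> e}. x e)) \<and>
     (\<forall>u\<in>V. \<forall>v\<in>V - {u}.
        \<delta> * real (card V) * y {u, v} \<le> (\<Sum>w\<in>V - {u}. y {u, w})) \<and>
     (\<forall>e\<in>E. 0 \<le> x e) \<and>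
     (\<forall>u\<in>V. \<forall>v\<in>V - {u}. 0 \<le> y {u, v}) \<and>
     (\<exists>e\<in>E. x e \<noteq> 0) \<and>
     (\<Sum>e\<in>E. x e) \<ge> (real \<Delta> - h) / 2 * (\<Sum>u\<in>V. MAX e\<in>{e\<in>E. u \<in> e}. x e)"

definition admissible_input ::
    "nat set \<Rightarrow> nat set set \<Rightarrow> nat \<Rightarrow> real \<Rightarrow> real
     \<Rightarrow> real \<Rightarrow> (nat set \<Rightarrow> real) \<Rightarrow> (nat set \<Rightarrow> real) \<Rightarrow> bool" where
  "admissible_input V E \<Delta> \<delta> h lam x y \<longleftrightarrow>
     regular_graph V E \<Delta> \<and> \<delta> > 0 \<and> h \<le> real \<Delta> * (1 - 2 / exp 1) \<and>
     lam > 0 \<and> sdp2_feasible V E \<Delta> \<delta> h lam x y"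

text \<open>The requirement \<open>card S \<ge> 2\<close> makes the second eigenvalue exist. Here \<open>log\<^sup>2 \<delta>\<close> is
  floored at 1, which changes nothing for \<open>\<delta> \<le> 1/e\<close> and only constants as long as \<open>\<delta>\<close> stays
  bounded away from 1. Without the floor no absolute constant works: for the complete graph
  with \<open>\<delta> = 1 - 1/n\<close>, \<open>h = 0\<close> and uniform \<open>x\<close> and \<open>y\<close>, the factor \<open>1 / log\<^sup>2 \<delta>\<close> is of order
  \<open>n\<^sup>2\<close> and the bound is of order \<open>n\<^sup>3\<close>.\<close>

definition expanding_set ::
    "real \<Rightarrow> real \<Rightarrow> nat set \<Rightarrow> nat set set \<Rightarrow> nat \<Rightarrow> real \<Rightarrow> real \<Rightarrow> real
     \<Rightarrow> nat set \<Rightarrow> bool" where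
  "expanding_set c C V E \<Delta> \<delta> h lam S \<longleftrightarrow>
     S \<subseteq> V \<and> real (card S) \<ge> 3 * \<delta> * real (card V) / 8 \<and> card S \<ge> 2 \<and>
     lambda2 (mat_on S (laplacian (induced_edges E S))) \<ge>
       c * lam\<^sup>2 /
         (real \<Delta> * max 1 ((ln \<delta>)\<^sup>2) * (1 + 2 * h / real \<Delta>) powr (C * real \<Delta> / lam))"

section \<open>Polynomial time\<close>

text \<open>Structured programs for a random access machine over the integers, under the
  logarithmic cost criterion: every evaluation of an expression is charged the bit length of
  the values of all its subexpressions (including addresses), and every store the bit length
  of the address and of the stored value. Up to polynomial overhead this is the Turing
  machine model.\<close>

type_synonym store = "nat \<Rightarrow> int"

datatype expr =
    Const int
  | Load expr
  | Add expr expr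
  | Sub expr expr
  | Mul expr expr
  | Div expr expr

datatype com =
    Skip
  | Store expr expr
  | Seq com com
  | If expr com com
  | While expr com

definition bits :: "int \<Rightarrow> nat" where
  "bits i = 1 + floorlog 2 (nat \<bar>i\<bar>)"

fun val :: "expr \<Rightarrow> store \<Rightarrow> int" where
  "val (Const i) M = i"
| "val (Load a) M = M (nat (val a M))"
| "val (Add a b) M = val a M + val b M"
| "val (Sub a b) M = val a M - val b M"
| "val (Mul a b) M = val a M * val b M"
| "val (Div a b) M = val a M div val b M"

fun cost :: "expr \<Rightarrow> store \<Rightarrow> nat" where
  "cost (Const i) M = bits i"
| "cost (Load a) M = cost a M + bits (val (Load a) M)"
| "cost (Add a b) M = cost a M + cost b M + bits (val (Add a b) M)"
| "cost (Sub a b) M = cost a M + cost b M + bits (val (Sub a b) M)"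
| "cost (Mul a b) M = cost a M + cost b M + bits (val (Mul a b) M)"
| "cost (Div a b) M = cost a M + cost b M + bits (val (Div a b) M)"

text \<open>\<open>run P M M' t\<close>: started in memory \<open>M\<close>, program \<open>P\<close> halts in memory \<open>M'\<close> at cost \<open>t\<close>.
  Tests succeed on positive values.\<close>

inductive run :: "com \<Rightarrow> store \<Rightarrow> store \<Rightarrow> nat \<Rightarrow> bool" where
  run_Skip: "run Skip M M 1"
| run_Store: "run (Store a b) M (M(nat (val a M) := val b M)) (1 + cost a M + cost b M)"
| run_Seq: "run P M M' s \<Longrightarrow> run Q M' M'' t \<Longrightarrow> run (Seq P Q) M M'' (s + t)"
| run_IfTrue: "val b M > 0 \<Longrightarrow> run P M M' t \<Longrightarrow> run (If b P Q) M M' (1 + cost b M + t)"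
| run_IfFalse: "\<not> val b M > 0 \<Longrightarrow> run Q M M' t \<Longrightarrow> run (If b P Q) M M' (1 + cost b M + t)"
| run_WhileFalse: "\<not> val b M > 0 \<Longrightarrow> run (While b P) M M (1 + cost b M)"
| run_WhileTrue: "val b M > 0 \<Longrightarrow> run P M M' s \<Longrightarrow> run (While b P) M' M'' t \<Longrightarrow>
    run (While b P) M M'' (1 + cost b M + s + t)"

definition load_input :: "int list \<Rightarrow> store" where
  "load_input xs i = (if i < length xs then xs ! i else 0)"

definition input_size :: "int list \<Rightarrow> nat" where
  "input_size xs = sum_list (map bits xs)"

definition poly_time_solves ::
    "com \<Rightarrow> ('i \<Rightarrow> int list) \<Rightarrow> ('i \<Rightarrow> bool) \<Rightarrow> ('i \<Rightarrow> store \<Rightarrow> bool) \<Rightarrow> bool" where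
  "poly_time_solves P enc valid correct \<longleftrightarrow>
     (\<exists>p :: nat poly. \<forall>i. valid i \<longrightarrow>
        (\<exists>M t. run P (load_input (enc i)) M t \<and> t \<le> poly p (input_size (enc i)) \<and>
               correct i M))"

section \<open>Encoding of inputs and outputs\<close>

definition enc_rat :: "rat \<Rightarrow> int list" where
  "enc_rat q = [fst (quotient_of q), snd (quotient_of q)]"

definition enc_table :: "nat \<Rightarrow> (nat \<Rightarrow> nat \<Rightarrow> int list) \<Rightarrow> int list" where
  "enc_table n f = concat (map (\<lambda>u. concat (map (f u) [0..<n])) [0..<n])"

type_synonym sdp_input =
  "nat \<times> nat set set \<times> nat \<times> rat \<times> rat \<times> rat \<times> (nat set \<Rightarrow> rat) \<times> (nat set \<Rightarrow> rat)"

text \<open>The graph has vertex set \<open>{..<n}\<close> and is given by its adjacency matrix; \<open>x\<close> and \<open>y\<close> are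
  given by \<open>n\<close> by \<open>n\<close> tables, padded with 0 where they are not indexed.\<close>

fun enc_input :: "sdp_input \<Rightarrow> int list" where
  "enc_input (n, E, \<Delta>, \<delta>, h, lam, x, y) =
     [int n, int \<Delta>] @ enc_rat \<delta> @ enc_rat h @ enc_rat lam
     @ enc_table n (\<lambda>u v. [if {u, v} \<in> E then 1 else 0])
     @ enc_table n (\<lambda>u v. enc_rat (if {u, v} \<in> E then x {u, v} else 0))
     @ enc_table n (\<lambda>u v. enc_rat (if u \<noteq> v then y {u, v} else 0))"

fun valid_input :: "sdp_input \<Rightarrow> bool" where
  "valid_input (n, E, \<Delta>, \<delta>, h, lam, x, y) \<longleftrightarrow>
     admissible_input {..<n} E \<Delta> (of_rat \<delta>) (of_rat h) (of_rat lam)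
       (\<lambda>e. of_rat (x e)) (\<lambda>e. of_rat (y e))"

text \<open>The returned set is read off as a 0/1 vector from the first \<open>n\<close> memory cells.\<close>

fun correct_output :: "real \<Rightarrow> real \<Rightarrow> sdp_input \<Rightarrow> store \<Rightarrow> bool" where
  "correct_output c C (n, E, \<Delta>, \<delta>, h, lam, x, y) M \<longleftrightarrow>
     (\<forall>v<n. M v \<in> {0, 1}) \<and>
     expanding_set c C {..<n} E \<Delta> (of_rat \<delta>) (of_rat h) (of_rat lam) {v. v < n \<and> M v = 1}"

end

theory Submission
  imports Defs "HOL-Computational_Algebra.Fundamental_Theorem_Algebra"
begin

text \<open>
  Write \<open>X\<^sub>u\<close> for the largest \<open>x\<^sub>e\<close> at \<open>u\<close>. Constraint (5) says that on average the edges at \<open>u\<close> carry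
  almost \<open>X\<^sub>u\<close>, so by an entropy estimate \<open>ln X\<close> varies little along heavy edges. Cutting the range of
  \<open>ln X\<close> at a random offset into windows of length \<open>O(\<Delta> / \<lambda> \<sqdot> ln (1 + 2 h / \<Delta>))\<close> therefore yields a
  window whose boundary carries \<open>x\<close>-weight at most \<open>3/4 \<lambda>\<close> times its \<open>X\<close>-mass. Sets with fewer than
  \<open>3 \<delta> n / 8\<close> vertices have boundary at least \<open>5/4 \<lambda>\<close> times their \<open>X\<close>-mass, by the spectral constraint
  tested on an indicator. Splitting the window along sparse cuts increases the boundary by an amount that
  can be charged to the smaller side, \<open>O(log (1 / \<delta>))\<close> times per vertex; so some piece stays
  below \<open>9/8 \<lambda>\<close>, hence large, and admits no sparse cut. Cheeger's inequality then bounds its second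
  eigenvalue.

  The algorithm does not know the right window or the right sparsity. It tries all intervals of values of
  \<open>X\<close> and, in increasing order, all sparsities \<open>n / j\<close> with \<open>j \<le> n\<^sup>2\<close>; the last large piece that resists
  splitting is the best one. Sparse cuts are looked for among the sweep cuts of the vectors \<open>(2 n I - L)\<^sup>t (m e\<^sub>v - 1)\<close> with \<open>t < n\<^sup>8\<close>: if none of these is sparse,
  then Cheeger's inequality makes all these vectors decay quickly, whereas for some \<open>v\<close> the component along
  the second eigenvector decays only at the rate given by the second eigenvalue.
\<close>

text \<open>The threshold 9/8 sits between 3/4 for the window and 5/4 for small sets. The 5/4 is 2 *
  5/8: at most 3/8 of the \<open>y\<close>-mass at a vertex stays inside a small set, and the
  spectral constraint counts ordered pairs. The gap 9/8 - 3/4 = 3/8 is the budget for all later cuts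
  and fixes the sparsity \<open>phi\<close>. As \<open>phi\<close> involves exponentials and
  logarithms of the data, the program cannot simply compare with it, whence the grid n / j.
  Existence and certification are decoupled. A large set without sparse sweep cuts at some level j
  \<le> \<open>jstar\<close> has the required expansion whatever its origin; the potential argument
  only guarantees that such a set is met at j = \<open>jstar\<close>. Every later output has a
  smaller j, so overwriting does no harm, and the program never has to recognise the right moment.
  The unnormalised operator 2 n I - L keeps the walk in the integers, so the program runs on exact
  values; the price is entries of polynomial bit length.\<close>

section \<open>The second eigenvalue of a Laplacian\<close>

text \<open>The matrix of differences is the action on the quotient by the constant vectors.\<close>

lemma zero_rowsum_char_poly:
  fixes A :: "'a :: field mat"
  assumes A: "A \<in> carrier_mat (Suc k) (Suc k)"
    and rows: "\<And>i. i < Suc k \<Longrightarrow> (\<Sum>j<Suc k. A $$ (i, j)) = 0"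
  defines "D \<equiv> mat k k (\<lambda>(i, j). A $$ (Suc i, Suc j) - A $$ (0, Suc j))"
  shows "char_poly A = [:0, 1:] * char_poly D"
proof -
  \<comment> \<open>Change of basis: the all-ones vector, which \<open>A\<close> annihilates,
    followed by the unit vectors other than the zeroth; \<open>Q\<close> is its inverse. In this
    basis the first column vanishes.\<close>
  define P :: "'a mat" where
    "P = mat (Suc k) (Suc k) (\<lambda>(i, j). if j = 0 then 1 else if i = j then 1 else 0)"
  define Q :: "'a mat" where
    "Q = mat (Suc k) (Suc k) (\<lambda>(i, j). if i = j then 1 else if j = 0 then -1 else 0)"
  define r where "r = mat 1 k (\<lambda>(i, j). A $$ (0, Suc j))"
  define B where "B = four_block_mat (0\<^sub>m 1 1) r (0\<^sub>m k 1) D"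
  have P_row: "(\<Sum>l=0..<Suc k. P $$ (i, l) * g l) = (if i = 0 then g 0 else g 0 + g i)"
    if i: "i < Suc k" for i and g :: "nat \<Rightarrow> 'a"
  proof -
    have "(\<Sum>l=0..<Suc k. P $$ (i, l) * g l) = (\<Sum>l=0..<Suc k. (if l = 0 then g 0 else 0) +
        (if i = l then if i = 0 then 0 else g i else 0))"
      using i by (intro sum.cong) (auto simp: P_def)
    also have "\<dots> = (if i = 0 then g 0 else g 0 + g i)"
      unfolding sum.distrib using i by (simp add: sum.delta del: sum.op_ivl_Suc)
    finally show ?thesis .
  qed
  have Q_row: "(\<Sum>l=0..<Suc k. Q $$ (i, l) * g l) = (if i = 0 then g 0 else g i - g 0)"
    if i: "i < Suc k" for i and g :: "nat \<Rightarrow> 'a"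
  proof -
    have "(\<Sum>l=0..<Suc k. Q $$ (i, l) * g l) = (\<Sum>l=0..<Suc k. (if l = 0 then if i = 0 then 0 else - g 0 else 0) +
        (if i = l then g i else 0))"
      using i by (intro sum.cong) (auto simp: Q_def)
    also have "\<dots> = (if i = 0 then g 0 else g i - g 0)"
      unfolding sum.distrib using i by (simp add: sum.delta del: sum.op_ivl_Suc)
    finally show ?thesis .
  qed
  have PQ: "P * Q = 1\<^sub>m (Suc k)"
  proof (rule eq_matI)
    fix i j assume "i < dim_row (1\<^sub>m (Suc k) :: 'a mat)" "j < dim_col (1\<^sub>m (Suc k) :: 'a mat)"
    then have i: "i < Suc k" and j: "j < Suc k" by auto
    have "(P * Q) $$ (i, j) = (\<Sum>l=0..<Suc k. P $$ (i, l) * Q $$ (l, j))"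
      using i j by (simp add: P_def Q_def scalar_prod_def del: sum.op_ivl_Suc)
    also have "\<dots> = 1\<^sub>m (Suc k) $$ (i, j)"
      unfolding P_row[OF i] using i j by (auto simp: Q_def)
    finally show "(P * Q) $$ (i, j) = 1\<^sub>m (Suc k) $$ (i, j)" .
  qed (auto simp: P_def Q_def)
  have QP: "Q * P = 1\<^sub>m (Suc k)"
  proof (rule eq_matI)
    fix i j assume "i < dim_row (1\<^sub>m (Suc k) :: 'a mat)" "j < dim_col (1\<^sub>m (Suc k) :: 'a mat)"
    then have i: "i < Suc k" and j: "j < Suc k" by auto
    have "(Q * P) $$ (i, j) = (\<Sum>l=0..<Suc k. Q $$ (i, l) * P $$ (l, j))"
      using i j by (simp add: P_def Q_def scalar_prod_def del: sum.op_ivl_Suc)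
    also have "\<dots> = 1\<^sub>m (Suc k) $$ (i, j)"
      unfolding Q_row[OF i] using i j by (auto simp: P_def)
    finally show "(Q * P) $$ (i, j) = 1\<^sub>m (Suc k) $$ (i, j)" .
  qed (auto simp: P_def Q_def)
  have cP: "P \<in> carrier_mat (Suc k) (Suc k)" and cQ: "Q \<in> carrier_mat (Suc k) (Suc k)"
    by (auto simp: P_def Q_def)
  have cB: "B \<in> carrier_mat (Suc k) (Suc k)"
    by (auto simp: B_def r_def D_def)
  have "A * P = P * B"
  proof (rule eq_matI)
    fix i j assume "i < dim_row (P * B)" "j < dim_col (P * B)"
    then have i: "i < Suc k" and j: "j < Suc k" using cP cB by auto
    have row: "row A i \<bullet> col P j = (if j = 0 then 0 else A $$ (i, j))"
    proof (cases j)
      case 0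
      then show ?thesis using rows[OF i] A i
        by (simp add: scalar_prod_def P_def row_def lessThan_atLeast0)
    next
      case (Suc j')
      have "(\<Sum>ia = 0..<Suc k. A $$ (i, ia) * (if ia = j then 1 else 0)) = A $$ (i, j)"
        using j by (simp add: if_distrib cong: if_cong)
      then show ?thesis using Suc A i j
        by (simp add: scalar_prod_def P_def row_def)
    qed
    have b: "B $$ (l, j) = (if j = 0 then 0 else if l = 0 then A $$ (0, j) else A $$ (l, j) - A $$ (0, j))"
      if "l < Suc k" for l
      using that j A by (cases l; cases j) (auto simp: B_def r_def D_def)
    have "row P i \<bullet> col B j = (\<Sum>l=0..<Suc k. P $$ (i, l) * B $$ (l, j))"
      using cP cB i j by (simp add: scalar_prod_def del: sum.op_ivl_Suc)
    also have "\<dots> = (if j = 0 then 0 else A $$ (i, j))"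
      unfolding P_row[OF i] using b[of 0] b[OF i] by auto
    finally show "(A * P) $$ (i, j) = (P * B) $$ (i, j)"
      using row A cP cB i j by simp
  qed (use A cP cB in auto)
  then have "A = P * B * Q"
    using A cP cQ PQ by (metis assoc_mult_mat right_mult_one_mat)
  then have "similar_mat_wit A B P Q"
    unfolding similar_mat_wit_def Let_def using A cP cQ cB PQ QP by auto
  then have "char_poly A = char_poly B"
    by (intro char_poly_similar) (auto simp: similar_mat_def)
  also have "\<dots> = char_poly (0\<^sub>m 1 1) * char_poly D"
    unfolding B_def by (rule char_poly_four_block_zeros_col) (auto simp: r_def D_def)
  also have "char_poly (0\<^sub>m 1 1 :: 'a mat) = [:0, 1:]"
    by (subst char_poly_upper_triangular[of _ 1]) (auto simp: diag_mat_def)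
  finally show ?thesis .
qed

text \<open>Padding an eigenvector of the quotient by 0 solves the eigenvalue equation up to a
  constant vector \<open>c\<close>. Summing over all rows, the vanishing column sums give
  \<open>c = - \<mu> * s / n\<close>, so subtracting the mean cancels it; this includes \<mu> = 0.
  The field is general because real and complex vectors are both lifted.\<close>

lemma zero_rowsum_eigen_lift:
  fixes A :: "'a :: field_char_0 mat"
  assumes A: "A \<in> carrier_mat (Suc k) (Suc k)"
    and rows: "\<And>i. i < Suc k \<Longrightarrow> (\<Sum>j<Suc k. A $$ (i, j)) = 0"
    and cols: "\<And>j. j < Suc k \<Longrightarrow> (\<Sum>i<Suc k. A $$ (i, j)) = 0"
    and root: "poly (char_poly (mat k k (\<lambda>(i, j). A $$ (Suc i, Suc j) - A $$ (0, Suc j)))) \<mu> = 0"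
  shows "\<exists>f. (\<forall>i<Suc k. (\<Sum>j<Suc k. A $$ (i, j) * f j) = \<mu> * f i) \<and>
    (\<Sum>i<Suc k. f i) = 0 \<and> (\<exists>i<Suc k. f i \<noteq> 0)"
proof -
  let ?D = "mat k k (\<lambda>(i, j). A $$ (Suc i, Suc j) - A $$ (0, Suc j))"
  have "eigenvalue ?D \<mu>"
    using root eigenvalue_root_char_poly[of ?D k] by auto
  then obtain v where v: "v \<in> carrier_vec k" "v \<noteq> 0\<^sub>v k" "?D *\<^sub>v v = \<mu> \<cdot>\<^sub>v v"
    unfolding eigenvalue_def eigenvector_def by auto
  define w where "w i = (if i = 0 then 0 else v $ (i - 1))" for i
  define c where "c = (\<Sum>j<Suc k. A $$ (0, j) * w j)"
  have Aw: "(\<Sum>j<Suc k. A $$ (i, j) * w j) = \<mu> * w i + c" if i: "i < Suc k" for i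
  proof (cases i)
    case 0 then show ?thesis by (simp add: c_def w_def)
  next
    case (Suc i')
    then have i': "i' < k" using i by simp
    have "(?D *\<^sub>v v) $ i' = \<mu> * v $ i'" using v i' by simp
    moreover have "(?D *\<^sub>v v) $ i' = (\<Sum>j<k. (A $$ (i, Suc j) - A $$ (0, Suc j)) * v $ j)"
      using v(1) i' Suc by (simp add: scalar_prod_def lessThan_atLeast0)
    moreover have "\<dots> = (\<Sum>j<Suc k. A $$ (i, j) * w j) - c"
      unfolding c_def sum.lessThan_Suc_shift
      by (simp add: w_def algebra_simps sum_subtractf)
    ultimately show ?thesis using Suc by (simp add: w_def)
  qed
  define s where "s = (\<Sum>i<Suc k. w i)"
  define n where "n = (of_nat (Suc k) :: 'a)"
  have n0: "n \<noteq> 0" unfolding n_def by (rule of_nat_neq_0)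
  have "0 = (\<Sum>j<Suc k. (\<Sum>i<Suc k. A $$ (i, j)) * w j)"
    by (rule sym, rule sum.neutral) (use cols in auto)
  also have "\<dots> = (\<Sum>i<Suc k. \<Sum>j<Suc k. A $$ (i, j) * w j)"
    by (subst sum.swap) (simp only: sum_distrib_right)
  also have "\<dots> = (\<Sum>i<Suc k. \<mu> * w i + c)" using Aw by (intro sum.cong) auto
  also have "\<dots> = \<mu> * s + n * c"
    by (simp only: sum.distrib sum_distrib_left s_def n_def sum_constant card_lessThan)
  finally have cs: "c = - \<mu> * s / n" using n0 by (simp add: field_simps eq_neg_iff_add_eq_0)
  define f where "f i = w i - s / n" for i
  have "(\<Sum>j<Suc k. A $$ (i, j) * f j) = \<mu> * f i" if i: "i < Suc k" for i
  proof -
    have "(\<Sum>j<Suc k. A $$ (i, j) * f j) = (\<Sum>j<Suc k. A $$ (i, j) * w j) - (\<Sum>j<Suc k. A $$ (i, j)) * (s / n)"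
      unfolding f_def by (simp only: right_diff_distrib sum_subtractf sum_distrib_right)
    also have "\<dots> = \<mu> * f i"
      using Aw[OF i] rows[OF i] cs n0 by (simp add: f_def field_simps)
    finally show ?thesis .
  qed
  moreover have "(\<Sum>i<Suc k. f i) = 0"
    unfolding f_def sum_subtractf s_def[symmetric] sum_constant card_lessThan n_def[symmetric]
    using n0 by simp
  moreover have "\<exists>i<Suc k. f i \<noteq> 0"
  proof (rule ccontr)
    assume "\<not> ?thesis"
    then have eq: "w i = s / n" if "i < Suc k" for i using that by (auto simp: f_def)
    have "s / n = 0" using eq[of 0] by (simp add: w_def)
    then have "w (Suc i) = 0" if "i < k" for i using eq[of "Suc i"] that by simp
    then have "v = 0\<^sub>v k" using v(1) by (intro eq_vecI) (auto simp: w_def)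
    then show False using v by simp
  qed
  ultimately show ?thesis by blast
qed

text \<open>Meant for the quotient matrix, which need not be symmetric: its complex eigenvectors are
  lifted to the symmetric \<open>A\<close>, where the Hermitian form \<open>q\<close> equals its own
  conjugate.\<close>

lemma symmetric_eigenvalue_real:
  fixes A :: "real mat" and f :: "nat \<Rightarrow> complex"
  assumes sym: "\<And>i j. i < m \<Longrightarrow> j < m \<Longrightarrow> A $$ (i, j) = A $$ (j, i)"
    and ev: "\<And>i. i < m \<Longrightarrow> (\<Sum>j<m. of_real (A $$ (i, j)) * f j) = \<mu> * f i"
    and nz: "\<exists>i<m. f i \<noteq> 0"
  shows "\<mu> \<in> \<real>"
proof -
  define q where "q = (\<Sum>i<m. \<Sum>j<m. cnj (f i) * of_real (A $$ (i, j)) * f j)"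
  define s where "s = (\<Sum>i<m. (cmod (f i))\<^sup>2)"
  have s: "s > 0"
  proof -
    obtain i where "i < m" "f i \<noteq> 0" using nz by auto
    then show ?thesis unfolding s_def by (intro sum_pos2[of _ i]) auto
  qed
  have "q = (\<Sum>i<m. cnj (f i) * (\<mu> * f i))"
    unfolding q_def by (intro sum.cong) (auto simp: ev[symmetric] sum_distrib_left mult.assoc)
  also have "\<dots> = \<mu> * of_real s"
    unfolding s_def of_real_sum sum_distrib_left
    by (intro sum.cong refl) (simp only: complex_norm_square mult_ac)
  finally have q1: "q = \<mu> * of_real s" .
  have "cnj q = (\<Sum>i<m. \<Sum>j<m. f i * of_real (A $$ (i, j)) * cnj (f j))"
    unfolding q_def by (simp add: cnj_sum)
  also have "\<dots> = (\<Sum>j<m. \<Sum>i<m. f i * of_real (A $$ (i, j)) * cnj (f j))"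
    by (rule sum.swap)
  also have "\<dots> = q"
    unfolding q_def by (intro sum.cong) (auto simp: sym mult_ac)
  finally have "q \<in> \<real>" by (simp add: Reals_cnj_iff)
  moreover have "\<mu> = q / of_real s" using q1 s by simp
  ultimately show ?thesis by simp
qed

text \<open>\<open>lambda2\<close> is position 1 of a sorted list of real roots. Splitting off the
  factor that belongs to the constants leaves the characteristic polynomial of the quotient
  \<open>D\<close>. Its roots are nonnegative, so the split-off 0 comes first and position 1 is the
  least root of \<open>D\<close>, whatever the multiplicity of 0.\<close>

theorem lambda2_eigenvector:
  fixes A :: "real mat"
  assumes A: "A \<in> carrier_mat m m" and m: "m \<ge> 2"
    and sym: "\<And>i j. i < m \<Longrightarrow> j < m \<Longrightarrow> A $$ (i, j) = A $$ (j, i)"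
    and rows: "\<And>i. i < m \<Longrightarrow> (\<Sum>j<m. A $$ (i, j)) = 0"
    and psd: "\<And>f. 0 \<le> (\<Sum>i<m. \<Sum>j<m. f i * A $$ (i, j) * f j)"
  shows "\<exists>f. (\<forall>i<m. (\<Sum>j<m. A $$ (i, j) * f j) = lambda2 A * f i) \<and>
    (\<Sum>i<m. f i) = 0 \<and> (\<exists>i<m. f i \<noteq> 0)"
proof -
  obtain k where k: "m = Suc k" "k \<ge> 1" using m by (cases m) auto
  define D where "D = mat k k (\<lambda>(i, j). A $$ (Suc i, Suc j) - A $$ (0, Suc j))"
  have cols: "(\<Sum>i<m. A $$ (i, j)) = 0" if "j < m" for j
  proof -
    have "(\<Sum>i<m. A $$ (i, j)) = (\<Sum>i<m. A $$ (j, i))"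
      by (intro sum.cong refl sym) (use that in simp_all)
    then show ?thesis using rows[OF that] by simp
  qed
  have cD: "D \<in> carrier_mat k k" by (simp add: D_def)
  have cp: "char_poly A = [:0, 1:] * char_poly D"
    unfolding D_def using A rows unfolding k by (rule zero_rowsum_char_poly)
  have D0: "char_poly D \<noteq> 0"
    using degree_monic_char_poly[OF cD] by (metis coeff_0 zero_neq_one)
  have lift: "\<exists>f. (\<forall>i<m. (\<Sum>j<m. A $$ (i, j) * f j) = \<mu> * f i) \<and> (\<Sum>i<m. f i) = 0 \<and> (\<exists>i<m. f i \<noteq> 0)"
    if root: "poly (char_poly D) \<mu> = 0" for \<mu>
    using zero_rowsum_eigen_lift[OF A[unfolded k(1)] rows[unfolded k(1)] cols[unfolded k(1)]
        root[unfolded D_def]] unfolding k(1) .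
  have nonneg: "\<mu> \<ge> 0" if root: "poly (char_poly D) \<mu> = 0" for \<mu>
  proof -
    obtain f where f: "\<forall>i<m. (\<Sum>j<m. A $$ (i, j) * f j) = \<mu> * f i" "\<exists>i<m. f i \<noteq> 0"
      using lift[OF root] by auto
    have "(\<Sum>i<m. \<Sum>j<m. f i * A $$ (i, j) * f j) = (\<Sum>i<m. f i * (\<mu> * f i))"
      using f by (intro sum.cong) (auto simp: sum_distrib_left[symmetric] mult.assoc)
    also have "\<dots> = \<mu> * (\<Sum>i<m. (f i)\<^sup>2)"
      by (simp add: sum_distrib_left power2_eq_square mult_ac)
    finally have "0 \<le> \<mu> * (\<Sum>i<m. (f i)\<^sup>2)" using psd[of f] by simp
    moreover have "(\<Sum>i<m. (f i)\<^sup>2) > 0"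
    proof -
      obtain i where "i < m" "f i \<noteq> 0" using f by auto
      then show ?thesis by (intro sum_pos2[of _ i]) auto
    qed
    ultimately show ?thesis by (simp add: zero_le_mult_iff)
  qed
  \<comment> \<open>Without a real root of \<open>char_poly D\<close> the list would have no
    position 1. A complex root exists, and lifting its eigenvector to \<open>A\<close> shows that it
    is real.\<close>
  have ex: "\<exists>\<mu>. poly (char_poly D) \<mu> = 0"
  proof -
    let ?h = "of_real :: real \<Rightarrow> complex"
    have cpD: "char_poly (map_mat ?h D) = map_poly ?h (char_poly D)"
      by (rule of_real_hom.char_poly_hom[OF cD])
    have "degree (char_poly (map_mat ?h D)) = k"
      using degree_monic_char_poly[of "map_mat ?h D" k] cD by auto
    then have "\<not> constant (poly (char_poly (map_mat ?h D)))"
      using k by (simp add: constant_degree)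
    then obtain z where z: "poly (char_poly (map_mat ?h D)) z = 0"
      using fundamental_theorem_of_algebra by blast
    define CA where "CA = map_mat ?h A"
    have mD: "map_mat ?h D = mat k k (\<lambda>(i, j). CA $$ (Suc i, Suc j) - CA $$ (0, Suc j))"
      using A k by (intro eq_matI) (auto simp: D_def CA_def)
    have el: "CA $$ (i, j) = of_real (A $$ (i, j))" if "i < m" "j < m" for i j
      using A that by (simp add: CA_def)
    have r: "(\<Sum>j<Suc k. CA $$ (i, j)) = 0" if "i < Suc k" for i
    proof -
      have "(\<Sum>j<Suc k. CA $$ (i, j)) = of_real (\<Sum>j<m. A $$ (i, j))"
        unfolding of_real_sum using that k el by (intro sum.cong) auto
      also have "\<dots> = 0" using rows[of i] that k(1) by (simp only: of_real_0)
      finally show ?thesis .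
    qed
    have c: "(\<Sum>i<Suc k. CA $$ (i, j)) = 0" if "j < Suc k" for j
    proof -
      have "(\<Sum>i<Suc k. CA $$ (i, j)) = of_real (\<Sum>i<m. A $$ (i, j))"
        unfolding of_real_sum using that k el by (intro sum.cong) auto
      also have "\<dots> = 0" using cols[of j] that k(1) by (simp only: of_real_0)
      finally show ?thesis .
    qed
    have cCA: "CA \<in> carrier_mat (Suc k) (Suc k)" using A k by (simp add: CA_def)
    obtain f where f: "\<forall>i<Suc k. (\<Sum>j<Suc k. CA $$ (i, j) * f j) = z * f i"
      "\<exists>i<Suc k. f i \<noteq> 0"
      using zero_rowsum_eigen_lift[OF cCA r c z[unfolded mD]] by blast
    have "z \<in> \<real>"
    proof (rule symmetric_eigenvalue_real[of m A f])
      show "(\<Sum>j<m. of_real (A $$ (i, j)) * f j) = z * f i" if "i < m" for i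
      proof -
        have "(\<Sum>j<m. of_real (A $$ (i, j)) * f j) = (\<Sum>j<m. CA $$ (i, j) * f j)"
          using el that by (intro sum.cong) auto
        also have "\<dots> = z * f i" using f(1) that unfolding k(1) by blast
        finally show ?thesis .
      qed
    qed (use sym f k in auto)
    then obtain x where x: "z = of_real x" by (auto elim: Reals_cases)
    have "poly (map_poly ?h (char_poly D)) (?h x) = 0" using z cpD x by simp
    then have "poly (char_poly D) x = 0" by simp
    then show ?thesis by blast
  qed
  define xs where "xs = sorted_list_of_multiset (proots (char_poly D))"
  have setxs: "set xs = {x. poly (char_poly D) x = 0}"
    unfolding xs_def by (simp add: set_count_proots[OF D0])
  obtain \<mu> where "poly (char_poly D) \<mu> = 0" using ex ..
  then have "\<mu> \<in> set xs" unfolding setxs by simp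
  then have xs: "xs \<noteq> []" by auto
  have "proots (char_poly A) = {#0#} + proots (char_poly D)"
    unfolding cp using proots_linear_factor[of "0::real"] by (subst proots_mult[OF _ D0]) auto
  then have "sorted_list_of_multiset (proots (char_poly A)) = insort 0 xs"
    unfolding xs_def by simp
  moreover have "insort 0 xs = 0 # xs"
  proof (cases xs)
    case (Cons x xs')
    then have "0 \<le> x" using setxs nonneg[of x] by auto
    then show ?thesis using Cons by simp
  qed simp
  ultimately have "lambda2 A = hd xs"
    unfolding lambda2_def by (simp add: hd_conv_nth[OF xs])
  then have "lambda2 A \<in> set xs" using xs by simp
  then have "poly (char_poly D) (lambda2 A) = 0"
    unfolding setxs by simp
  from lift[OF this] show ?thesis .
qed

section \<open>Sweep cuts and Cheeger's inequality\<close>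

definition cutw :: "(nat \<Rightarrow> nat \<Rightarrow> real) \<Rightarrow> nat set \<Rightarrow> nat set \<Rightarrow> real" where
  "cutw w A B = (\<Sum>u\<in>A. \<Sum>v\<in>B. w u v)"

lemma cutw_sym:
  assumes "\<And>u v. w u v = w v u"
  shows "cutw w A B = cutw w B A"
  unfolding cutw_def by (subst sum.swap) (simp add: assms)

lemma cutw_nonneg: "(\<And>u v. 0 \<le> w u v) \<Longrightarrow> 0 \<le> cutw w A B"
  unfolding cutw_def by (intro sum_nonneg)

lemma cutw_union_left:
  assumes "finite A" "finite B" "A \<inter> B = {}"
  shows "cutw w (A \<union> B) C = cutw w A C + cutw w B C"
  unfolding cutw_def using assms by (simp add: sum.union_disjoint)

lemma cutw_union_right:
  assumes "finite A" "finite B" "A \<inter> B = {}"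
  shows "cutw w C (A \<union> B) = cutw w C A + cutw w C B"
  unfolding cutw_def using assms by (simp add: sum.union_disjoint sum.distrib)

lemma double_sum_diff_level:
  fixes a :: "nat \<Rightarrow> nat \<Rightarrow> real"
  assumes S: "finite S" and A: "A \<subseteq> S" and sym: "\<And>u v. a u v = a v u"
  shows "(\<Sum>u\<in>S. \<Sum>v\<in>S. a u v * \<bar>(if u \<in> A then t else 0) - (if v \<in> A then t else 0)\<bar>)
    = 2 * \<bar>t\<bar> * cutw a A (S - A)"
proof -
  let ?f = "\<lambda>u v. a u v * \<bar>(if u \<in> A then t else 0) - (if v \<in> A then t else 0)\<bar>"
  have split: "(\<Sum>u\<in>S. g u) = (\<Sum>u\<in>A. g u) + (\<Sum>u\<in>S - A. g u)" for g :: "nat \<Rightarrow> real"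
    using S A by (metis add.commute sum.subset_diff)
  have in_A: "(\<Sum>v\<in>S. ?f u v) = (\<Sum>v\<in>S - A. ?f u v)" if "u \<in> A" for u
    using S that by (intro sum.mono_neutral_right) auto
  have out_A: "(\<Sum>v\<in>S. ?f u v) = (\<Sum>v\<in>A. ?f u v)" if "u \<in> S - A" for u
    using S A that by (intro sum.mono_neutral_right) auto
  have "(\<Sum>u\<in>S. \<Sum>v\<in>S. ?f u v) = (\<Sum>u\<in>A. \<Sum>v\<in>S-A. ?f u v) + (\<Sum>u\<in>S-A. \<Sum>v\<in>A. ?f u v)"
    unfolding split[of "\<lambda>u. \<Sum>v\<in>S. ?f u v"]
    by (intro arg_cong2[of _ _ _ _ "(+)"] sum.cong refl in_A out_A)
  also have "(\<Sum>u\<in>A. \<Sum>v\<in>S-A. ?f u v) = \<bar>t\<bar> * cutw a A (S - A)"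
    unfolding cutw_def sum_distrib_left by (intro sum.cong) auto
  also have "(\<Sum>u\<in>S-A. \<Sum>v\<in>A. ?f u v) = \<bar>t\<bar> * cutw a (S - A) A"
    unfolding cutw_def sum_distrib_left by (intro sum.cong) auto
  also have "cutw a (S - A) A = cutw a A (S - A)" by (rule cutw_sym) (rule sym)
  finally show ?thesis by simp
qed

text \<open>Discrete coarea formula, by induction on the support of \<open>g\<close>: subtracting
  the least positive value on the support peels off one level set, to which the hypothesis applies,
  and leaves a function whose level sets are among those of \<open>g\<close>. Only level sets at
  attained values are assumed to expand, since these are what a sweep inspects.\<close>

lemma coarea:
  fixes a :: "nat \<Rightarrow> nat \<Rightarrow> real" and g :: "nat \<Rightarrow> real"
  assumes "finite S" "\<And>u v. a u v = a v u" "\<And>u v. 0 \<le> a u v" "\<And>u. u \<in> S \<Longrightarrow> 0 \<le> g u"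
    and "\<And>w. w \<in> S \<Longrightarrow> g w > 0 \<Longrightarrow>
      \<phi> * real (card {u\<in>S. g u \<ge> g w}) \<le> cutw a {u\<in>S. g u \<ge> g w} (S - {u\<in>S. g u \<ge> g w})"
  shows "2 * \<phi> * (\<Sum>u\<in>S. g u) \<le> (\<Sum>u\<in>S. \<Sum>v\<in>S. a u v * \<bar>g u - g v\<bar>)"
  using assms(4,5)
proof (induction "card {u\<in>S. g u > 0}" arbitrary: g rule: less_induct)
  case less
  let ?A = "{u\<in>S. g u > 0}"
  show ?case
  proof (cases "?A = {}")
    case True
    then have "g u = 0" if "u \<in> S" for u using that less.prems(1) by force
    then show ?thesis using assms(3) by (simp add: sum_nonneg)
  next
    case False
    have fin: "finite ?A" using assms(1) by simp
    define t where "t = Min (g ` ?A)"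
    have "t \<in> g ` ?A" unfolding t_def using False fin by (intro Min_in) auto
    then obtain w where w: "w \<in> S" "g w > 0" "t = g w" by auto
    have tmin: "t \<le> g u" if "u \<in> ?A" for u unfolding t_def using fin that by (intro Min_le) auto
    have t: "t > 0" using w by simp
    define k where "k u = (if u \<in> ?A then t else 0)" for u
    define h where "h u = g u - k u" for u
    have Aw: "{u\<in>S. g u \<ge> g w} = ?A" using w tmin t by fastforce
    have h0: "0 \<le> h u" if "u \<in> S" for u
      using that tmin[of u] less.prems(1)[OF that] by (auto simp: h_def k_def)
    have sub: "{u\<in>S. h u > 0} \<subseteq> ?A - {w}"
    proof
      fix u assume u: "u \<in> {u\<in>S. h u > 0}"
      have "u \<in> ?A" using u less.prems(1)[of u] by (auto simp: h_def k_def split: if_splits)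
      moreover have "u \<noteq> w" using u w by (auto simp: h_def k_def)
      ultimately show "u \<in> ?A - {w}" by simp
    qed
    have "w \<in> ?A" using w by simp
    then have "card {u\<in>S. h u > 0} < card ?A"
      using sub fin by (intro psubset_card_mono) auto
    moreover have "\<phi> * real (card {u\<in>S. h u \<ge> h w'}) \<le> cutw a {u\<in>S. h u \<ge> h w'} (S - {u\<in>S. h u \<ge> h w'})"
      if "w' \<in> S" "h w' > 0" for w'
    proof -
      have w': "w' \<in> ?A" using that sub by auto
      have "{u\<in>S. h u \<ge> h w'} = {u\<in>S. g u \<ge> g w'}"
      proof (intro Collect_cong conj_cong refl)
        fix u assume "u \<in> S"
        show "(h w' \<le> h u) = (g w' \<le> g u)"
        proof (cases "u \<in> ?A")
          case False
          then have "g u = 0" "h u = 0" using \<open>u \<in> S\<close> less.prems(1)[OF \<open>u \<in> S\<close>] by (auto simp: h_def k_def)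
          then show ?thesis using that w' by simp
        qed (use w' in \<open>auto simp: h_def k_def\<close>)
      qed
      then show ?thesis using less.prems(2)[of w'] w' by simp
    qed
    ultimately have IH: "2 * \<phi> * (\<Sum>u\<in>S. h u) \<le> (\<Sum>u\<in>S. \<Sum>v\<in>S. a u v * \<bar>h u - h v\<bar>)"
      using less.hyps[of h] h0 by blast
    \<comment> \<open>No cancellation, because \<open>h\<close> and \<open>k\<close> are both
      nondecreasing functions of the value of \<open>g\<close>.\<close>
    have "\<bar>g u - g v\<bar> = \<bar>h u - h v\<bar> + \<bar>k u - k v\<bar>" if "u \<in> S" "v \<in> S" for u v
      using that tmin[of u] tmin[of v] less.prems(1)[of u] less.prems(1)[of v] t
      by (auto simp: h_def k_def split: if_splits)
    then have "(\<Sum>u\<in>S. \<Sum>v\<in>S. a u v * \<bar>g u - g v\<bar>)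
        = (\<Sum>u\<in>S. \<Sum>v\<in>S. a u v * \<bar>h u - h v\<bar> + a u v * \<bar>k u - k v\<bar>)"
      by (intro sum.cong refl) (simp add: distrib_left)
    also have "\<dots> = (\<Sum>u\<in>S. \<Sum>v\<in>S. a u v * \<bar>h u - h v\<bar>) + (\<Sum>u\<in>S. \<Sum>v\<in>S. a u v * \<bar>k u - k v\<bar>)"
      by (simp add: sum.distrib)
    also have "(\<Sum>u\<in>S. \<Sum>v\<in>S. a u v * \<bar>k u - k v\<bar>) = 2 * \<bar>t\<bar> * cutw a ?A (S - ?A)"
      unfolding k_def by (rule double_sum_diff_level) (use assms in auto)
    finally have eq: "(\<Sum>u\<in>S. \<Sum>v\<in>S. a u v * \<bar>g u - g v\<bar>)
      = (\<Sum>u\<in>S. \<Sum>v\<in>S. a u v * \<bar>h u - h v\<bar>) + 2 * t * cutw a ?A (S - ?A)" using t by simp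
    have "(\<Sum>u\<in>S. g u) = (\<Sum>u\<in>S. h u) + (\<Sum>u\<in>S. k u)"
      by (simp add: h_def sum_subtractf)
    also have "(\<Sum>u\<in>S. k u) = (\<Sum>u\<in>?A. t)"
      unfolding k_def using assms(1) by (subst sum.inter_filter) auto
    finally have "(\<Sum>u\<in>S. g u) = (\<Sum>u\<in>S. h u) + real (card ?A) * t" by simp
    then have "2 * \<phi> * (\<Sum>u\<in>S. g u) = 2 * \<phi> * (\<Sum>u\<in>S. h u) + 2 * t * (\<phi> * real (card ?A))"
      by (simp add: algebra_simps)
    moreover have "\<phi> * real (card ?A) \<le> cutw a ?A (S - ?A)"
      using less.prems(2)[OF w(1,2)] unfolding Aw .
    ultimately show ?thesis unfolding eq using IH t by (simp add: add_mono)
  qed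
qed

text \<open>The quadratic form of the Laplacian with weights \<open>a\<close>, halved because every
  pair occurs in both orders.\<close>

definition energy :: "(nat \<Rightarrow> nat \<Rightarrow> real) \<Rightarrow> nat set \<Rightarrow> (nat \<Rightarrow> real) \<Rightarrow> real" where
  "energy a S z = (\<Sum>u\<in>S. \<Sum>v\<in>S. a u v * (z u - z v)\<^sup>2) / 2"

text \<open>Coarea for the square of \<open>g\<close>, which has the same level sets. The difference
  of squares is factored and the product bounded by a weighted AM-GM inequality, in place of
  Cauchy-Schwarz.\<close>

lemma energy_ge_one_sided:
  fixes a :: "nat \<Rightarrow> nat \<Rightarrow> real" and g :: "nat \<Rightarrow> real"
  assumes S: "finite S" and sym: "\<And>u v. a u v = a v u" and a0: "\<And>u v. 0 \<le> a u v"
    and deg: "\<And>u. u \<in> S \<Longrightarrow> (\<Sum>v\<in>S. a u v) \<le> d" and d: "d > 0" and phi: "\<phi> > 0"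
    and g0: "\<And>u. u \<in> S \<Longrightarrow> 0 \<le> g u"
    and cuts: "\<And>w. w \<in> S \<Longrightarrow> g w > 0 \<Longrightarrow>
      \<phi> * real (card {u\<in>S. g u \<ge> g w}) \<le> cutw a {u\<in>S. g u \<ge> g w} (S - {u\<in>S. g u \<ge> g w})"
  shows "\<phi>\<^sup>2 / (2 * d) * (\<Sum>u\<in>S. (g u)\<^sup>2) \<le> energy a S g"
proof -
  \<comment> \<open>With this weight the terms \<open>s * ((g u)\<^sup>2 + (g v)\<^sup>2)\<close>
    sum to at most \<open>\<phi> * ?N\<close>, half of the lower bound from coarea.\<close>
  define s where "s = \<phi> / (2 * d)"
  have s: "s > 0" using phi d by (simp add: s_def)
  let ?N = "\<Sum>u\<in>S. (g u)\<^sup>2"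
  have lev: "{u\<in>S. (g u)\<^sup>2 \<ge> (g w)\<^sup>2} = {u\<in>S. g u \<ge> g w}" if "w \<in> S" for w
    using g0 that by (auto intro: power_mono power2_le_imp_le)
  have "2 * \<phi> * ?N \<le> (\<Sum>u\<in>S. \<Sum>v\<in>S. a u v * \<bar>(g u)\<^sup>2 - (g v)\<^sup>2\<bar>)"
  proof (rule coarea[OF S sym a0])
    fix w assume w: "w \<in> S" "(g w)\<^sup>2 > 0"
    then have "g w > 0" using g0[OF w(1)] by (cases "g w = 0") auto
    then show "\<phi> * real (card {u\<in>S. (g u)\<^sup>2 \<ge> (g w)\<^sup>2})
      \<le> cutw a {u\<in>S. (g u)\<^sup>2 \<ge> (g w)\<^sup>2} (S - {u\<in>S. (g u)\<^sup>2 \<ge> (g w)\<^sup>2})"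
      unfolding lev[OF w(1)] using cuts[OF w(1)] by simp
  qed auto
  also have "\<dots> \<le> (\<Sum>u\<in>S. \<Sum>v\<in>S. a u v * ((g u - g v)\<^sup>2 / (2 * s) + s * ((g u)\<^sup>2 + (g v)\<^sup>2)))"
  proof (intro sum_mono mult_left_mono a0)
    fix u v
    have "0 \<le> (\<bar>g u - g v\<bar> - s * \<bar>g u + g v\<bar>)\<^sup>2" by simp
    then have "2 * s * (\<bar>g u - g v\<bar> * \<bar>g u + g v\<bar>) \<le> (g u - g v)\<^sup>2 + s\<^sup>2 * (g u + g v)\<^sup>2"
      by (simp add: power2_diff power_mult_distrib algebra_simps)
    then have "\<bar>g u - g v\<bar> * \<bar>g u + g v\<bar> \<le> (g u - g v)\<^sup>2 / (2 * s) + s / 2 * (g u + g v)\<^sup>2"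
      using s by (simp add: field_simps power2_eq_square)
    moreover have "(g u + g v)\<^sup>2 \<le> 2 * ((g u)\<^sup>2 + (g v)\<^sup>2)"
      by (smt (verit) power2_sum power2_diff zero_le_power2)
    then have "s / 2 * (g u + g v)\<^sup>2 \<le> s * ((g u)\<^sup>2 + (g v)\<^sup>2)"
      using s by simp
    moreover have "\<bar>(g u)\<^sup>2 - (g v)\<^sup>2\<bar> = \<bar>g u - g v\<bar> * \<bar>g u + g v\<bar>"
      by (simp add: abs_mult[symmetric] power2_eq_square algebra_simps)
    ultimately show "\<bar>(g u)\<^sup>2 - (g v)\<^sup>2\<bar> \<le> (g u - g v)\<^sup>2 / (2 * s) + s * ((g u)\<^sup>2 + (g v)\<^sup>2)" by linarith
  qed
  also have "\<dots> = energy a S g / s + s * ((\<Sum>u\<in>S. \<Sum>v\<in>S. a u v * (g u)\<^sup>2) + (\<Sum>u\<in>S. \<Sum>v\<in>S. a u v * (g v)\<^sup>2))"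
    using s by (simp add: energy_def sum.distrib sum_distrib_left sum_divide_distrib algebra_simps)
  also have "(\<Sum>u\<in>S. \<Sum>v\<in>S. a u v * (g v)\<^sup>2) = (\<Sum>u\<in>S. \<Sum>v\<in>S. a u v * (g u)\<^sup>2)"
    by (subst sum.swap) (simp add: sym)
  also have "(\<Sum>u\<in>S. \<Sum>v\<in>S. a u v * (g u)\<^sup>2) \<le> d * ?N"
    unfolding sum_distrib_left sum_distrib_right[symmetric]
    by (intro sum_mono mult_right_mono deg) auto
  finally have "2 * \<phi> * ?N \<le> energy a S g / s + s * (d * ?N + d * ?N)"
    using s by (simp add: mult_left_mono)
  then have "\<phi> * ?N \<le> energy a S g * (2 * d / \<phi>)"
    using d phi by (simp add: s_def field_simps)
  then show ?thesis using d phi by (simp add: field_simps power2_eq_square)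
qed

lemma median_exists:
  fixes z :: "nat \<Rightarrow> real"
  assumes S: "finite S"
  obtains c where "2 * card {u\<in>S. z u > c} \<le> card S" "2 * card {u\<in>S. z u < c} \<le> card S"
proof (cases "S = {}")
  case True
  then show ?thesis using that[of 0] by simp
next
  case False
  let ?T = "{t \<in> z ` S. card S \<le> 2 * card {u\<in>S. z u \<ge> t}}"
  have "Min (z ` S) \<in> ?T"
  proof -
    have "{u\<in>S. z u \<ge> Min (z ` S)} = S" using S by auto
    then show ?thesis using S False by (auto intro: Min_in)
  qed
  moreover have fT: "finite ?T" using S by simp
  ultimately have cT: "Max ?T \<in> ?T" by (intro Max_in) auto
  define c where "c = Max ?T"
  have "2 * card {u\<in>S. z u > c} \<le> card S"
  proof (cases "{u\<in>S. z u > c} = {}")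
    case False
    define t where "t = Min (z ` {u\<in>S. z u > c})"
    have t: "t \<in> z ` {u\<in>S. z u > c}" unfolding t_def using False S by (intro Min_in) auto
    have "t \<le> z u" if "u \<in> S" "z u > c" for u
      unfolding t_def using S that by (intro Min_le) auto
    then have eq: "{u\<in>S. z u > c} = {u\<in>S. z u \<ge> t}" using t by force
    have "t \<notin> ?T"
    proof
      assume "t \<in> ?T"
      then have "t \<le> c" unfolding c_def using fT by (rule Max_ge[rotated])
      then show False using t by auto
    qed
    then show ?thesis using t unfolding eq by auto
  next
    case True
    show ?thesis unfolding True by simp
  qed
  moreover have "2 * card {u\<in>S. z u < c} \<le> card S"
  proof -
    have "card S \<le> 2 * card {u\<in>S. z u \<ge> c}" using cT unfolding c_def by blast
    moreover have "card S = card {u\<in>S. z u \<ge> c} + card {u\<in>S. z u < c}"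
      using S by (subst card_Un_disjoint[symmetric]) (auto intro: arg_cong[of _ _ card])
    ultimately show ?thesis by linarith
  qed
  ultimately show ?thesis by (rule that)
qed

text \<open>Median argument, for any \<open>z\<close> of mean zero since it is applied to vectors of
  the walk as well as to eigenfunctions. The parts of \<open>z\<close> above and below a median live
  on at most half of \<open>S\<close>, so for their level sets the minimum in the hypothesis is the
  smaller side; and their energies add up to at most that of \<open>z\<close>.\<close>

theorem cheeger_sweep:
  fixes a :: "nat \<Rightarrow> nat \<Rightarrow> real" and z :: "nat \<Rightarrow> real"
  assumes S: "finite S" and sym: "\<And>u v. a u v = a v u" and a0: "\<And>u v. 0 \<le> a u v"
    and deg: "\<And>u. u \<in> S \<Longrightarrow> (\<Sum>v\<in>S. a u v) \<le> d" and d: "d > 0" and phi: "\<phi> > 0"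
    and z0: "(\<Sum>u\<in>S. z u) = 0"
    and cuts: "\<And>w A. w \<in> S \<Longrightarrow> A = {u\<in>S. z u \<ge> z w} \<Longrightarrow>
      \<phi> * min (real (card A)) (real (card (S - A))) \<le> cutw a A (S - A)"
  shows "\<phi>\<^sup>2 / (2 * d) * (\<Sum>u\<in>S. (z u)\<^sup>2) \<le> energy a S z"
proof -
  obtain c where c: "2 * card {u\<in>S. z u > c} \<le> card S" "2 * card {u\<in>S. z u < c} \<le> card S"
    using median_exists[OF S] by blast
  define p where "p u = max 0 (z u - c)" for u
  define q where "q u = max 0 (c - z u)" for u
  have small: "\<phi> * real (card A) \<le> cutw a A (S - A)"
    if "w \<in> S" "A = {u\<in>S. z u \<ge> z w}" "2 * card A \<le> card S" for w A
  proof -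
    have "card (S - A) = card S - card A" using S that(2) by (intro card_Diff_subset) auto
    then have "min (real (card A)) (real (card (S - A))) = real (card A)"
      using that(3) by (intro min_absorb1) simp
    then show ?thesis using cuts[OF that(1,2)] by simp
  qed
  have small': "\<phi> * real (card B) \<le> cutw a B (S - B)"
    if "B \<subseteq> S" "w \<in> S" "S - B = {u\<in>S. z u \<ge> z w}" "2 * card B \<le> card S" for w B
  proof -
    have "card (S - B) = card S - card B" using S that(1) by (intro card_Diff_subset) (auto intro: finite_subset)
    then have "min (real (card (S - B))) (real (card B)) = real (card B)"
      using that(4) by (intro min_absorb2) simp
    moreover have "S - (S - B) = B" using that(1) by auto
    ultimately show ?thesis using cuts[OF that(2,3)] cutw_sym[of a "S - B" B, OF sym] by simp
  qed
  have P: "\<phi>\<^sup>2 / (2 * d) * (\<Sum>u\<in>S. (p u)\<^sup>2) \<le> energy a S p"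
  proof (rule energy_ge_one_sided[OF S sym a0 deg d phi])
    fix w assume w: "w \<in> S" "p w > 0"
    have eq: "{u\<in>S. p u \<ge> p w} = {u\<in>S. z u \<ge> z w}" using w by (auto simp: p_def max_def split: if_splits)
    have "card {u\<in>S. z u \<ge> z w} \<le> card {u\<in>S. z u > c}"
      using S w by (intro card_mono) (auto simp: p_def max_def split: if_splits)
    then show "\<phi> * real (card {u\<in>S. p u \<ge> p w}) \<le> cutw a {u\<in>S. p u \<ge> p w} (S - {u\<in>S. p u \<ge> p w})"
      unfolding eq using c(1) by (intro small[OF w(1) refl]) linarith
  qed (auto simp: p_def)
  have Q: "\<phi>\<^sup>2 / (2 * d) * (\<Sum>u\<in>S. (q u)\<^sup>2) \<le> energy a S q"
  proof (rule energy_ge_one_sided[OF S sym a0 deg d phi])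
    fix w assume w: "w \<in> S" "q w > 0"
    let ?B = "{u\<in>S. z u \<le> z w}"
    have eq: "{u\<in>S. q u \<ge> q w} = ?B" using w by (auto simp: q_def max_def split: if_splits)
    have cardB: "card ?B \<le> card {u\<in>S. z u < c}"
      using S w by (intro card_mono) (auto simp: q_def max_def split: if_splits)
    \<comment> \<open>The lower level set \<open>?B\<close> is tested through its complement, which
      has to be the level set of an attained value: the least value above \<open>z w\<close>. It
      exists by the median property.\<close>
    have "S - ?B \<noteq> {}"
    proof
      assume "S - ?B = {}"
      then have "?B = S" by auto
      then have "card S \<le> card {u\<in>S. z u < c}" using cardB by simp
      moreover have "card S > 0" using S w(1) by (auto simp: card_gt_0_iff)
      ultimately show False using c(2) by linarith
    qed
    define t where "t = Min (z ` (S - ?B))"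
    have "t \<in> z ` (S - ?B)" unfolding t_def using S \<open>S - ?B \<noteq> {}\<close> by (intro Min_in) auto
    then obtain w' where "w' \<in> S - ?B" and tw': "t = z w'" by blast
    then have w': "w' \<in> S" "z w' > z w" "t = z w'" by auto
    have "t \<le> z u" if "u \<in> S" "z u > z w" for u
      unfolding t_def using S that by (intro Min_le) auto
    then have "S - ?B = {u\<in>S. z u \<ge> z w'}" using w' by force
    then show "\<phi> * real (card {u\<in>S. q u \<ge> q w}) \<le> cutw a {u\<in>S. q u \<ge> q w} (S - {u\<in>S. q u \<ge> q w})"
      unfolding eq using c(2) cardB by (intro small'[OF _ w'(1)]) auto
  qed (auto simp: q_def)
  have "(p u - p v)\<^sup>2 + (q u - q v)\<^sup>2 \<le> (z u - z v)\<^sup>2" for u v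
  proof -
    have "z u - z v = (p u - p v) - (q u - q v)" by (auto simp: p_def q_def max_def)
    moreover have "(p u - p v) * (q u - q v) \<le> 0"
      by (auto simp: p_def q_def max_def mult_le_0_iff split: if_splits)
    moreover have "(z u - z v)\<^sup>2 = (p u - p v)\<^sup>2 + (q u - q v)\<^sup>2 - 2 * ((p u - p v) * (q u - q v))"
      unfolding calculation(1) by (simp add: power2_eq_square algebra_simps)
    ultimately show ?thesis by linarith
  qed
  then have "energy a S p + energy a S q \<le> energy a S z"
    unfolding energy_def add_divide_distrib[symmetric] sum.distrib[symmetric] distrib_left[symmetric]
    by (intro divide_right_mono sum_mono mult_left_mono a0) auto
  \<comment> \<open>Shifting \<open>z\<close> by the median only increases the norm, because
    \<open>z\<close> has mean zero.\<close>
  moreover have "(\<Sum>u\<in>S. (z u)\<^sup>2) \<le> (\<Sum>u\<in>S. (p u)\<^sup>2) + (\<Sum>u\<in>S. (q u)\<^sup>2)"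
  proof -
    have "(p u)\<^sup>2 + (q u)\<^sup>2 = (z u)\<^sup>2 - 2 * c * z u + c\<^sup>2" for u
      by (auto simp: p_def q_def max_def power2_diff algebra_simps)
    then have "(\<Sum>u\<in>S. (p u)\<^sup>2) + (\<Sum>u\<in>S. (q u)\<^sup>2) = (\<Sum>u\<in>S. (z u)\<^sup>2) - 2 * c * (\<Sum>u\<in>S. z u) + (\<Sum>u\<in>S. c\<^sup>2)"
      by (simp add: sum.distrib[symmetric] sum_subtractf[symmetric] sum_distrib_left del: sum_constant)
    then show ?thesis using z0 by (simp add: sum_nonneg)
  qed
  then have "\<phi>\<^sup>2 / (2 * d) * (\<Sum>u\<in>S. (z u)\<^sup>2) \<le> \<phi>\<^sup>2 / (2 * d) * ((\<Sum>u\<in>S. (p u)\<^sup>2) + (\<Sum>u\<in>S. (q u)\<^sup>2))"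
    using d by (intro mult_left_mono) auto
  ultimately show ?thesis using P Q by (simp add: distrib_left)
qed

section \<open>Rounding the semidefinite program\<close>

lemma card_two_Min_Max:
  fixes e :: "nat set"
  assumes "card e = 2"
  shows "e = {Min e, Max e}" "Min e \<noteq> Max e"
proof -
  obtain u v where e: "e = {u, v}" "u \<noteq> v" using assms by (meson card_2_iff)
  then show "e = {Min e, Max e}" "Min e \<noteq> Max e" by (auto simp: min_def max_def)
qed

lemma simple_graph_edge:
  assumes "simple_graph V E" "{u, v} \<in> E"
  shows "u \<in> V" "v \<in> V" "u \<noteq> v"
  using assms by (auto simp: simple_graph_def dest!: bspec[of E _ "{u, v}"])

lemma simple_graph_finite: "simple_graph V E \<Longrightarrow> finite V" "simple_graph V E \<Longrightarrow> finite E"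
proof -
  show "finite V" if "simple_graph V E" using that by (simp add: simple_graph_def)
  show "finite E" if "simple_graph V E"
    by (rule finite_subset[of _ "Pow V"]) (use that in \<open>auto simp: simple_graph_def\<close>)
qed

lemma sum_edges_ordered:
  fixes g :: "nat \<Rightarrow> nat \<Rightarrow> real"
  assumes G: "simple_graph V E" and sym: "\<And>u v. g u v = g v u"
  shows "(\<Sum>u\<in>V. \<Sum>v\<in>V. if {u, v} \<in> E then g u v else 0) = 2 * (\<Sum>e\<in>E. g (Min e) (Max e))"
proof -
  note fin = simple_graph_finite[OF G]
  let ?P = "{(u, v). {u, v} \<in> E}"
  let ?P1 = "(\<lambda>e. (Min e, Max e)) ` E" and ?P2 = "(\<lambda>e. (Max e, Min e)) ` E"
  have mm: "e = {Min e, Max e}" "Min e \<noteq> Max e" if "e \<in> E" for e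
    using card_two_Min_Max[of e] that G by (auto simp: simple_graph_def)
  have mmle: "Min {u, v} = min u v" "Max {u, v} = max u v" for u v :: nat by auto
  have P: "?P = ?P1 \<union> ?P2"
  proof (intro subset_antisym subrelI)
    fix u v assume "(u, v) \<in> ?P"
    then have uv: "{u, v} \<in> E" by simp
    show "(u, v) \<in> ?P1 \<union> ?P2"
    proof (cases "u \<le> v")
      case True
      then have "(u, v) = (Min {u, v}, Max {u, v})" by (simp add: mmle)
      then show ?thesis using uv by blast
    next
      case False
      then have "(u, v) = (Max {u, v}, Min {u, v})" by (simp add: mmle)
      then show ?thesis using uv by blast
    qed
  next
    fix u v assume "(u, v) \<in> ?P1 \<union> ?P2"
    then show "(u, v) \<in> ?P" using mm(1) by (auto simp: insert_commute)
  qed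
  have disj: "?P1 \<inter> ?P2 = {}"
  proof -
    have lt: "Min e < Max e" if "e \<in> E" for e
    proof -
      have "finite e" "e \<noteq> {}" using mm(1)[OF that] by (metis finite.simps insert_not_empty)+
      then have "Min e \<le> Max e" by simp
      then show ?thesis using mm(2)[OF that] by simp
    qed
    have "fst p < snd p" if "p \<in> ?P1" for p using that lt by auto
    moreover have "snd p < fst p" if "p \<in> ?P2" for p using that lt by auto
    ultimately show ?thesis by (meson disjoint_iff less_asym)
  qed
  have inj1: "inj_on (\<lambda>e. (Min e, Max e)) E" and inj2: "inj_on (\<lambda>e. (Max e, Min e)) E"
    by (intro inj_onI; metis mm(1) prod.inject)+
  have "(\<Sum>u\<in>V. \<Sum>v\<in>V. if {u, v} \<in> E then g u v else 0) = (\<Sum>(u, v)\<in>V \<times> V. if {u, v} \<in> E then g u v else 0)"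
    by (simp add: sum.cartesian_product)
  also have "\<dots> = (\<Sum>(u, v)\<in>?P. g u v)"
    using fin simple_graph_edge[OF G]
    by (intro sum.mono_neutral_cong_right) (auto split: if_splits)
  also have "\<dots> = (\<Sum>(u, v)\<in>?P1. g u v) + (\<Sum>(u, v)\<in>?P2. g u v)"
    unfolding P using fin disj by (intro sum.union_disjoint) auto
  also have "\<dots> = 2 * (\<Sum>e\<in>E. g (Min e) (Max e))"
    unfolding sum.reindex[OF inj1] sum.reindex[OF inj2] using sym[of "Max _" "Min _"] by simp
  finally show ?thesis .
qed

lemma sum_incident_edges:
  fixes f :: "nat set \<Rightarrow> 'a::comm_monoid_add"
  assumes G: "simple_graph V E"
  shows "(\<Sum>e | e \<in> E \<and> u \<in> e. f e) = (\<Sum>v\<in>V. if {u, v} \<in> E then f {u, v} else 0)"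
proof -
  note fin = simple_graph_finite[OF G]
  have img: "{e\<in>E. u \<in> e} = (\<lambda>v. {u, v}) ` {v. {u, v} \<in> E}"
  proof (intro subset_antisym subsetI)
    fix e assume e: "e \<in> {e\<in>E. u \<in> e}"
    then obtain p q where "e = {p, q}" using G by (auto simp: simple_graph_def card_2_iff)
    then show "e \<in> (\<lambda>v. {u, v}) ` {v. {u, v} \<in> E}" using e by (auto simp: insert_commute)
  qed auto
  have inj: "inj_on (\<lambda>v. {u, v}) {v. {u, v} \<in> E}" by (rule inj_onI) (auto simp: doubleton_eq_iff)
  have "(\<Sum>e | e \<in> E \<and> u \<in> e. f e) = (\<Sum>v | {u, v} \<in> E. f {u, v})"
    unfolding img by (subst sum.reindex[OF inj]) simp
  also have "\<dots> = (\<Sum>v\<in>V. if {u, v} \<in> E then f {u, v} else 0)"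
    using fin simple_graph_edge[OF G] by (intro sum.mono_neutral_cong_left) auto
  finally show ?thesis .
qed

lemma pair_lap_quadratic:
  assumes V: "finite V" "u \<in> V" "v \<in> V" "u \<noteq> v"
  shows "(\<Sum>a\<in>V. \<Sum>b\<in>V. z a * pair_lap u v a b * z b) = (z u - z v)\<^sup>2"
proof -
  have lin: "(\<Sum>a\<in>V. z a * pair_vec u v a) = z v - z u"
  proof -
    have "(\<Sum>a\<in>V. z a * pair_vec u v a) = (\<Sum>a\<in>V. (if a = v then z v else 0) - (if a = u then z u else 0))"
      using V by (intro sum.cong) (auto simp: pair_vec_def)
    then show ?thesis using V by (simp add: sum_subtractf)
  qed
  have "(\<Sum>a\<in>V. \<Sum>b\<in>V. z a * pair_lap u v a b * z b)
    = (\<Sum>a\<in>V. z a * pair_vec u v a) * (\<Sum>b\<in>V. z b * pair_vec u v b)"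
    unfolding pair_lap_def sum_product by (simp add: mult_ac)
  then show ?thesis unfolding lin by (simp add: power2_eq_square algebra_simps)
qed

section \<open>A feasible solution as weights on pairs of vertices\<close>

locale sdp_solution =
  fixes V :: "nat set" and E :: "nat set set" and \<Delta> :: nat and \<delta> h lam :: real
    and x y :: "nat set \<Rightarrow> real"
  assumes adm: "admissible_input V E \<Delta> \<delta> h lam x y"
begin

definition adj :: "nat \<Rightarrow> nat \<Rightarrow> real" where "adj u v = (if {u, v} \<in> E then 1 else 0)"
text \<open>\<open>wt\<close> and \<open>yw\<close> extend \<open>x\<close> and \<open>y\<close> by
  0 to all ordered pairs, so that the constraints become statements about double sums over
  \<open>V\<close>.\<close>

definition wt :: "nat \<Rightarrow> nat \<Rightarrow> real" where "wt u v = (if {u, v} \<in> E then x {u, v} else 0)"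
definition yw :: "nat \<Rightarrow> nat \<Rightarrow> real" where
  "yw u v = (if u \<in> V \<and> v \<in> V - {u} then y {u, v} else 0)"
definition X :: "nat \<Rightarrow> real" where "X u = (MAX e\<in>{e\<in>E. u \<in> e}. x e)"

definition n :: nat where "n = card V"

lemma graph: "simple_graph V E" and reg: "\<And>u. u \<in> V \<Longrightarrow> card {e\<in>E. u \<in> e} = \<Delta>"
  and \<delta>_pos: "\<delta> > 0" and lam_pos: "lam > 0" and h_le: "h \<le> real \<Delta> * (1 - 2 / exp 1)"
  and feas: "sdp2_feasible V E \<Delta> \<delta> h lam x y"
  using adm by (auto simp: admissible_input_def regular_graph_def)

lemma finV: "finite V" and finE: "finite E"
  using simple_graph_finite[OF graph] by auto

lemma edge: "{u, v} \<in> E \<Longrightarrow> u \<in> V \<and> v \<in> V \<and> u \<noteq> v"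
  using simple_graph_edge[OF graph] by blast

lemma x_nonneg: "e \<in> E \<Longrightarrow> 0 \<le> x e"
  using feas by (auto simp: sdp2_feasible_def)

lemma adj_sym: "adj u v = adj v u" and wt_sym: "wt u v = wt v u" and yw_sym: "yw u v = yw v u"
  by (auto simp: adj_def wt_def yw_def insert_commute)

lemma adj_nonneg: "0 \<le> adj u v" and wt_nonneg: "0 \<le> wt u v" and yw_nonneg: "0 \<le> yw u v"
  using feas x_nonneg by (auto simp: adj_def wt_def yw_def sdp2_feasible_def)

lemma degree: "u \<in> V \<Longrightarrow> (\<Sum>v\<in>V. adj u v) = \<Delta>"
  using sum_incident_edges[OF graph, of "\<lambda>_. 1::real" u] reg[of u] by (simp add: adj_def)

lemma edge_exists: "\<exists>u v. {u, v} \<in> E \<and> x {u, v} > 0"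
proof -
  obtain e where e: "e \<in> E" "x e \<noteq> 0" using feas by (auto simp: sdp2_feasible_def)
  then have "e = {Min e, Max e}" using graph by (intro card_two_Min_Max) (auto simp: simple_graph_def)
  then show ?thesis using e x_nonneg[OF e(1)] by (metis order_le_less)
qed

lemma \<Delta>_pos: "\<Delta> \<ge> 1"
proof -
  obtain u v where uv: "{u, v} \<in> E" using edge_exists by auto
  then have "card {e\<in>E. u \<in> e} > 0" using finE by (auto simp: card_gt_0_iff)
  then show ?thesis using reg[of u] edge[OF uv] by simp
qed

lemma star_nonempty: "u \<in> V \<Longrightarrow> {e\<in>E. u \<in> e} \<noteq> {}"
  using reg[of u] \<Delta>_pos by (metis card.empty not_one_le_zero)

lemma wt_le_X: "wt u v \<le> X u" if "u \<in> V"
proof (cases "{u, v} \<in> E")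
  case True
  then show ?thesis unfolding wt_def X_def using finE by (auto intro!: Max_ge)
next
  case False
  have "X u \<in> x ` {e\<in>E. u \<in> e}"
    unfolding X_def using finE star_nonempty[OF that] by (intro Max_in) auto
  then show ?thesis using False x_nonneg by (auto simp: wt_def)
qed

lemma X_nonneg: "u \<in> V \<Longrightarrow> 0 \<le> X u"
  using wt_le_X[of u] wt_nonneg[of u u] by (metis order_trans)

lemma X_attained: "u \<in> V \<Longrightarrow> \<exists>v\<in>V. {u, v} \<in> E \<and> X u = x {u, v}"
proof -
  assume u: "u \<in> V"
  have "X u \<in> x ` {e\<in>E. u \<in> e}"
    unfolding X_def using finE star_nonempty[OF u] by (intro Max_in) auto
  then obtain e where e: "e \<in> E" "u \<in> e" "X u = x e" by auto
  then obtain p q where "e = {p, q}" using graph by (auto simp: simple_graph_def card_2_iff)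
  then obtain v where "e = {u, v}" using e(2) by auto
  then show "\<exists>v\<in>V. {u, v} \<in> E \<and> X u = x {u, v}" using e edge by auto
qed

lemma n_ge2: "n \<ge> 2"
proof -
  obtain u v where "{u, v} \<in> E" using edge_exists by auto
  from edge[OF this] have "{u, v} \<subseteq> V" "card {u, v} = 2" by auto
  then show ?thesis unfolding n_def using card_mono[OF finV] by metis
qed

lemma \<Delta>_less: "\<Delta> < n"
proof -
  obtain u v where uv: "{u, v} \<in> E" using edge_exists by auto
  then have u: "u \<in> V" using edge by auto
  have "(\<Sum>v\<in>V. adj u v) = (\<Sum>v\<in>V - {u}. adj u v)"
    using finV edge[of u u] by (intro sum.mono_neutral_right) (auto simp: adj_def)
  also have "\<dots> \<le> (\<Sum>v\<in>V - {u}. 1)" by (intro sum_mono) (auto simp: adj_def)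
  also have "\<dots> = real (n - 1)" using u finV by (simp add: n_def)
  finally have "real \<Delta> \<le> real (n - 1)" using degree[OF u] by simp
  then show ?thesis using n_ge2 by simp
qed

text \<open>The factor 2 arises because the program sums \<open>y\<close> over ordered pairs while
  \<open>energy\<close> counts every pair once.\<close>

lemma sdp_quadratic: "2 * lam * energy yw V z \<le> energy wt V z"
proof -
  have "0 \<le> (\<Sum>a\<in>V. \<Sum>b\<in>V. z a * ((\<Sum>e\<in>E. x e * edge_lap e a b)
      - lam * (\<Sum>u\<in>V. \<Sum>v\<in>V - {u}. y {u, v} * pair_lap u v a b)) * z b)"
    using feas unfolding sdp2_feasible_def loewner_ge_def by blast
  also have "\<dots> = (\<Sum>a\<in>V. \<Sum>b\<in>V. \<Sum>e\<in>E. x e * (z a * edge_lap e a b * z b))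
      - lam * (\<Sum>a\<in>V. \<Sum>b\<in>V. \<Sum>u\<in>V. \<Sum>v\<in>V - {u}. y {u, v} * (z a * pair_lap u v a b * z b))"
    by (simp add: algebra_simps sum_subtractf sum_distrib_left sum_distrib_right)
  also have "(\<Sum>a\<in>V. \<Sum>b\<in>V. \<Sum>e\<in>E. x e * (z a * edge_lap e a b * z b))
      = (\<Sum>e\<in>E. x e * (\<Sum>a\<in>V. \<Sum>b\<in>V. z a * edge_lap e a b * z b))"
    by (subst sum.swap[of _ E V], subst sum.swap[of _ E V]) (simp add: sum_distrib_left)
  also have "\<dots> = (\<Sum>e\<in>E. x {Min e, Max e} * (z (Min e) - z (Max e))\<^sup>2)"
  proof (intro sum.cong refl)
    fix e assume e: "e \<in> E"
    have mm: "e = {Min e, Max e}" "Min e \<noteq> Max e"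
      using card_two_Min_Max[of e] e graph by (auto simp: simple_graph_def)
    then have "Min e \<in> V" "Max e \<in> V" using e edge by metis+
    then show "x e * (\<Sum>a\<in>V. \<Sum>b\<in>V. z a * edge_lap e a b * z b) = x {Min e, Max e} * (z (Min e) - z (Max e))\<^sup>2"
      unfolding edge_lap_def using pair_lap_quadratic[OF finV _ _ mm(2)] mm(1) by simp
  qed
  also have "\<dots> = energy wt V z"
    using sum_edges_ordered[OF graph, of "\<lambda>u v. x {u, v} * (z u - z v)\<^sup>2"]
    by (simp add: energy_def wt_def insert_commute power2_commute if_distrib if_distribR cong: if_cong)
  also have "(\<Sum>a\<in>V. \<Sum>b\<in>V. \<Sum>u\<in>V. \<Sum>v\<in>V - {u}. y {u, v} * (z a * pair_lap u v a b * z b))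
     = (\<Sum>u\<in>V. \<Sum>v\<in>V - {u}. y {u, v} * (\<Sum>a\<in>V. \<Sum>b\<in>V. z a * pair_lap u v a b * z b))"
  proof -
    let ?T = "\<lambda>a b u v. y {u, v} * (z a * pair_lap u v a b * z b)"
    have "(\<Sum>a\<in>V. \<Sum>b\<in>V. \<Sum>u\<in>V. \<Sum>v\<in>V - {u}. ?T a b u v) = (\<Sum>a\<in>V. \<Sum>u\<in>V. \<Sum>b\<in>V. \<Sum>v\<in>V - {u}. ?T a b u v)"
      by (intro sum.cong refl sum.swap)
    also have "\<dots> = (\<Sum>u\<in>V. \<Sum>a\<in>V. \<Sum>b\<in>V. \<Sum>v\<in>V - {u}. ?T a b u v)"
      by (rule sum.swap)
    also have "\<dots> = (\<Sum>u\<in>V. \<Sum>a\<in>V. \<Sum>v\<in>V - {u}. \<Sum>b\<in>V. ?T a b u v)"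
      by (intro sum.cong refl sum.swap)
    also have "\<dots> = (\<Sum>u\<in>V. \<Sum>v\<in>V - {u}. \<Sum>a\<in>V. \<Sum>b\<in>V. ?T a b u v)"
      by (intro sum.cong refl sum.swap)
    finally show ?thesis by (simp add: sum_distrib_left)
  qed
  also have "\<dots> = (\<Sum>u\<in>V. \<Sum>v\<in>V - {u}. y {u, v} * (z u - z v)\<^sup>2)"
    using finV by (intro sum.cong refl arg_cong2[of _ _ _ _ "(*)"] pair_lap_quadratic) auto
  also have "\<dots> = (\<Sum>u\<in>V. \<Sum>v\<in>V. yw u v * (z u - z v)\<^sup>2)"
    using finV by (intro sum.cong refl sum.mono_neutral_cong_left) (auto simp: yw_def)
  also have "\<dots> = 2 * energy yw V z" by (simp add: energy_def)
  finally show ?thesis by simp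
qed

lemma energy_indicator:
  fixes k :: "nat \<Rightarrow> nat \<Rightarrow> real"
  assumes "finite U" "S \<subseteq> U" "\<And>u v. k u v = k v u"
  shows "energy k U (\<lambda>u. if u \<in> S then 1 else 0) = cutw k S (U - S)"
proof -
  have "energy k U (\<lambda>u. if u \<in> S then 1 else 0)
    = (\<Sum>u\<in>U. \<Sum>v\<in>U. k u v * \<bar>(if u \<in> S then 1 else 0) - (if v \<in> S then 1 else 0)\<bar>) / 2"
    unfolding energy_def by (intro arg_cong2[of _ _ _ _ "(/)"] sum.cong refl) auto
  then show ?thesis using double_sum_diff_level[OF assms, where t = 1] by simp
qed

lemma cut_wt_ge: "S \<subseteq> V \<Longrightarrow> 2 * lam * cutw yw S (V - S) \<le> cutw wt S (V - S)"
  using sdp_quadratic[of "\<lambda>u. if u \<in> S then 1 else 0"]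
  by (simp add: energy_indicator[OF finV] yw_sym wt_sym)

lemma X_le_yw: "u \<in> V \<Longrightarrow> X u \<le> (\<Sum>v\<in>V. yw u v)"
proof -
  assume u: "u \<in> V"
  have "X u \<le> (\<Sum>v\<in>V - {u}. y {u, v})"
    using feas u unfolding sdp2_feasible_def X_def by blast
  also have "\<dots> = (\<Sum>v\<in>V. yw u v)"
    using finV u by (intro sum.mono_neutral_cong_left) (auto simp: yw_def)
  finally show ?thesis .
qed

lemma yw_le: "u \<in> V \<Longrightarrow> \<delta> * n * yw u v \<le> (\<Sum>v\<in>V. yw u v)"
proof -
  assume u: "u \<in> V"
  have eq: "(\<Sum>v\<in>V - {u}. y {u, v}) = (\<Sum>v\<in>V. yw u v)"
    using finV u by (intro sum.mono_neutral_cong_left) (auto simp: yw_def)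
  show ?thesis
  proof (cases "v \<in> V - {u}")
    case True
    then have "\<delta> * real (card V) * y {u, v} \<le> (\<Sum>v\<in>V - {u}. y {u, v})"
      using feas u unfolding sdp2_feasible_def by blast
    then show ?thesis using True u by (simp add: eq yw_def n_def)
  next
    case False
    then have "yw u v = 0" by (auto simp: yw_def)
    then show ?thesis using yw_nonneg by (simp add: sum_nonneg)
  qed
qed

lemma X_pos_exists: "\<exists>u\<in>V. X u > 0"
proof -
  obtain u v where uv: "{u, v} \<in> E" "x {u, v} > 0" using edge_exists by auto
  have u: "u \<in> V" using edge[OF uv(1)] by auto
  have "wt u v > 0" using uv by (simp add: wt_def)
  then show ?thesis using wt_le_X[OF u, of v] u by force
qed

text \<open>Constraint (3) caps each single \<open>y\<close>-value at \<open>u\<close>, so fewer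
  than 3 \<delta> n / 8 vertices hold at most 3/8 of the \<open>y\<close>-mass \<open>Y\<close> at
  \<open>u\<close>. The remaining 5/8 leaves \<open>S\<close>, and the factor 2 of
  \<open>cut_wt_ge\<close> turns it into 5/4. A set with at most one vertex retains nothing, as
  there is no diagonal \<open>y\<close>.\<close>

lemma small_set_boundary:
  assumes S: "S \<subseteq> V" and small: "card S < 2 \<or> real (card S) < 3 * \<delta> * n / 8"
  shows "5 / 4 * lam * (\<Sum>u\<in>S. X u) \<le> cutw wt S (V - S)"
proof -
  have finS: "finite S" using S finV finite_subset by blast
  have dn: "\<delta> * n > 0" using \<delta>_pos n_ge2 by simp
  have out: "5 / 8 * X u \<le> (\<Sum>v\<in>V - S. yw u v)" if u: "u \<in> S" for u
  proof -
    have uV: "u \<in> V" using S u by auto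
    define Y where "Y = (\<Sum>v\<in>V. yw u v)"
    have Y0: "0 \<le> Y" unfolding Y_def by (intro sum_nonneg yw_nonneg)
    have ins: "(\<Sum>v\<in>S. yw u v) = (\<Sum>v\<in>S - {u}. yw u v)"
      using finS by (intro sum.mono_neutral_right) (auto simp: yw_def)
    have "\<delta> * n * (\<Sum>v\<in>S. yw u v) = (\<Sum>v\<in>S - {u}. \<delta> * n * yw u v)" unfolding ins by (simp add: sum_distrib_left)
    also have "\<dots> \<le> (\<Sum>v\<in>S - {u}. Y)" unfolding Y_def by (intro sum_mono yw_le uV)
    \<comment> \<open>Leaving out \<open>u\<close> makes the factor 0 for a singleton, where no
      bound in terms of \<delta> is available.\<close>
    also have "\<dots> = real (card S - 1) * Y" using u finS by simp
    also have "\<dots> \<le> (3 * \<delta> * n / 8) * Y"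
      using small \<delta>_pos Y0 by (intro mult_right_mono) auto
    finally have "(\<delta> * n) * (\<Sum>v\<in>S. yw u v) \<le> (\<delta> * n) * (3 / 8 * Y)" by (simp add: algebra_simps)
    then have "(\<Sum>v\<in>S. yw u v) \<le> 3 / 8 * Y" using dn by (simp only: mult_le_cancel_left_pos)
    moreover have "Y = (\<Sum>v\<in>S. yw u v) + (\<Sum>v\<in>V - S. yw u v)"
      unfolding Y_def using finV S by (metis add.commute sum.subset_diff)
    ultimately show ?thesis using X_le_yw[OF uV] by (simp add: Y_def[symmetric])
  qed
  have "5 / 8 * (\<Sum>u\<in>S. X u) \<le> cutw yw S (V - S)"
    unfolding cutw_def sum_distrib_left by (intro sum_mono out)
  then have "2 * lam * (5 / 8 * (\<Sum>u\<in>S. X u)) \<le> 2 * lam * cutw yw S (V - S)"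
    using lam_pos by (intro mult_left_mono) auto
  then show ?thesis using cut_wt_ge[OF S] by simp
qed

end

text \<open>Hermite's identity. It lets a sum over finitely many offsets replace the average over a random
  real offset.\<close>

lemma sum_shifted_div:
  fixes q :: int
  assumes N: "N > 0"
  shows "(\<Sum>i<N. (q + int i) div int N) = q"
proof -
  define r where "r = nat (q mod int N)"
  have r: "int r = q mod int N" "r < N"
    using N by (auto simp: r_def nat_less_iff)
  have "(q + int i) div int N = q div int N + (if N - r \<le> i then 1 else 0)" if "i < N" for i
  proof -
    have "q + int i = (int r + int i) + int N * (q div int N)" using r by simp
    then have "(q + int i) div int N = (int r + int i) div int N + q div int N"
      using N by (metis add.commute div_mult_self2 of_nat_0_less_iff order_less_irrefl)
    moreover have "(int r + int i) div int N = (if N - r \<le> i then 1 else 0)"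
    proof (cases "N - r \<le> i")
      case True
      then have "(int r + int i) div int N = 1" using that r(2) by (intro int_div_pos_eq[of _ _ _ "int r + int i - int N"]) auto
      then show ?thesis using True by simp
    next
      case False
      then show ?thesis using r(2) by (simp add: div_pos_pos_trivial)
    qed
    ultimately show ?thesis by simp
  qed
  then have "(\<Sum>i<N. (q + int i) div int N) = (\<Sum>i<N. q div int N + (if N - r \<le> i then 1 else 0))"
    by (intro sum.cong) auto
  also have "\<dots> = int N * (q div int N) + (\<Sum>i<N. if N - r \<le> i then 1 else 0)"
    by (simp add: sum.distrib)
  also have "(\<Sum>i<N. if N - r \<le> i then 1 else (0::int)) = (\<Sum>i\<in>{N - r..<N}. 1)"
    by (intro sum.mono_neutral_cong_right) auto
  also have "\<dots> = int r" using r(2) by simp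
  finally show ?thesis using r(1) by simp
qed

text \<open>For \<open>q' \<le> q\<close> each summand is at most the difference of the two
  quotients, and by Hermite's identity these differences add up to \<open>q - q'\<close>. Divided by
  \<open>N\<close>, this is the probability that a random offset separates two points.\<close>

lemma separating_offsets:
  fixes q q' :: int
  assumes N: "N > 0"
  shows "(\<Sum>i<N. if (q + int i) div int N \<noteq> (q' + int i) div int N then 1 else 0) \<le> real_of_int \<bar>q - q'\<bar>"
proof -
  have main: "(\<Sum>i<N. if (q + int i) div int N \<noteq> (q' + int i) div int N then 1 else 0) \<le> real_of_int (q - q')"
    if "q' \<le> q" for q q' :: int
  proof -
    have "(\<Sum>i<N. if (q + int i) div int N \<noteq> (q' + int i) div int N then 1 else 0)
      \<le> (\<Sum>i<N. real_of_int ((q + int i) div int N - (q' + int i) div int N))"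
    proof (intro sum_mono)
      fix i
      have "(q' + int i) div int N \<le> (q + int i) div int N"
        using that N by (intro zdiv_mono1) auto
      then show "(if (q + int i) div int N \<noteq> (q' + int i) div int N then 1 else 0)
        \<le> real_of_int ((q + int i) div int N - (q' + int i) div int N)" by auto
    qed
    also have "\<dots> = real_of_int (q - q')"
      unfolding of_int_sum[symmetric] sum_subtractf sum_shifted_div[OF N] ..
    finally show ?thesis .
  qed
  show ?thesis
  proof (cases "q' \<le> q")
    case True
    then show ?thesis using main[OF True] by simp
  next
    case False
    then show ?thesis using main[of q q'] by (simp add: eq_commute)
  qed
qed

section \<open>The entropy estimate and the choice of a window\<close>

context sdp_solution begin

text \<open>Length of a window on the scale of \<open>ln X\<close>. The factor 4 leaves the pairs
  separated by a random offset a weight of at most lam / 2 times the mass of \<open>X\<close>; the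
  summand 1 keeps the length positive for \<open>h = 0\<close> and costs only a factor e in
  \<open>R\<close>, the largest ratio of \<open>X\<close>-values in a window.\<close>

definition K :: real where "K = 1 + 4 * \<Delta> / lam * ln (1 + 2 * h / \<Delta>)"
definition R :: real where "R = exp K"

lemma sum_X_pos: "(\<Sum>u\<in>V. X u) > 0"
proof -
  obtain u where "u \<in> V" "X u > 0" using X_pos_exists by auto
  then show ?thesis using X_nonneg finV by (intro sum_pos2[of _ u]) auto
qed

lemma sum_wt_eq: "(\<Sum>u\<in>V. \<Sum>v\<in>V. wt u v) = 2 * (\<Sum>e\<in>E. x e)"
proof -
  have "(\<Sum>u\<in>V. \<Sum>v\<in>V. wt u v) = 2 * (\<Sum>e\<in>E. x {Min e, Max e})"
    using sum_edges_ordered[OF graph, of "\<lambda>u v. x {u, v}"] by (simp add: wt_def insert_commute)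
  also have "(\<Sum>e\<in>E. x {Min e, Max e}) = (\<Sum>e\<in>E. x e)"
    using card_two_Min_Max(1) graph by (intro sum.cong refl) (metis simple_graph_def)
  finally show ?thesis .
qed

lemma sum_wt_ge: "(real \<Delta> - h) * (\<Sum>u\<in>V. X u) \<le> (\<Sum>u\<in>V. \<Sum>v\<in>V. wt u v)"
  using feas unfolding sum_wt_eq sdp2_feasible_def X_def by (simp add: field_simps)

lemma wt_le_adj_X: "u \<in> V \<Longrightarrow> wt u v \<le> adj u v * X u"
  using wt_le_X[of u v] by (auto simp: adj_def wt_def)

lemma sum_wt_le: "(\<Sum>u\<in>V. \<Sum>v\<in>V. wt u v) \<le> \<Delta> * (\<Sum>u\<in>V. X u)"
proof -
  have "(\<Sum>u\<in>V. \<Sum>v\<in>V. wt u v) \<le> (\<Sum>u\<in>V. \<Sum>v\<in>V. adj u v * X u)"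
    by (intro sum_mono wt_le_adj_X)
  also have "\<dots> = (\<Sum>u\<in>V. \<Delta> * X u)"
    unfolding sum_distrib_right[symmetric] by (intro sum.cong refl) (simp add: degree)
  finally show ?thesis by (simp add: sum_distrib_left)
qed

text \<open>No lower bound on \<open>h\<close> is part of the input. Since all edges at
  \<open>u\<close> weigh at most \<open>X u\<close>, constraint (5) would be violated by a negative
  \<open>h\<close>.\<close>

lemma h_nonneg: "h \<ge> 0"
proof -
  have "(real \<Delta> - h) * (\<Sum>u\<in>V. X u) \<le> \<Delta> * (\<Sum>u\<in>V. X u)"
    using sum_wt_ge sum_wt_le by simp
  then show ?thesis using sum_X_pos by (simp add: mult_le_cancel_right_pos)
qed

definition \<tau> :: real where "\<tau> = 1 - h / \<Delta>"

text \<open>The place where the upper bound on \<open>h\<close> enters: it gives \<tau> \<ge> 2/e,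
  which exceeds both 1/e and 1/2. The former bounds \<open>- ln \<tau>\<close> by 1; the latter
  means s \<le> 1/2 for s = h / \<Delta>, and then 1 / (1 - s) \<le> 1 + 2 s.\<close>

lemma tau: "0 < \<tau>" "\<tau> \<le> 1" "- ln \<tau> \<le> 1" "- ln \<tau> \<le> ln (1 + 2 * h / \<Delta>)"
proof -
  have D: "real \<Delta> > 0" using \<Delta>_pos by simp
  have s: "h / \<Delta> \<le> 1 - 2 / exp 1" using h_le D by (simp add: field_simps)
  then have t2: "2 / exp 1 \<le> \<tau>" by (simp add: \<tau>_def)
  moreover have "0 < 2 / exp (1::real)" by simp
  ultimately show t0: "0 < \<tau>" by linarith
  show "\<tau> \<le> 1" using h_nonneg D by (simp add: \<tau>_def)
  have "exp (-1) \<le> 2 / exp (1::real)" by (simp add: exp_minus divide_inverse)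
  then have "exp (-1) \<le> \<tau>" using t2 by linarith
  then have "-1 \<le> ln \<tau>" using t0 by (simp add: ln_ge_iff)
  then show "- ln \<tau> \<le> 1" by simp
  define s where "s = h / \<Delta>"
  have "2 / exp 1 \<ge> (1/2::real)" using exp_le by (simp add: field_simps)
  then have s1: "s \<le> 1/2" using s unfolding s_def by linarith
  have s': "0 \<le> s" "s \<le> 1/2" using s1 h_nonneg by (auto simp: s_def)
  have "s * (1 - 2 * s) \<ge> 0" using s' by simp
  then have "1 \<le> (1 - s) * (1 + 2 * s)" by (simp add: algebra_simps)
  then have "1 / \<tau> \<le> 1 + 2 * s" using t0 by (simp add: \<tau>_def s_def[symmetric] field_simps)
  then have "ln (1 / \<tau>) \<le> ln (1 + 2 * s)" using t0 s' by (subst ln_le_cancel_iff) auto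
  then show "- ln \<tau> \<le> ln (1 + 2 * h / \<Delta>)" using t0 by (simp add: ln_div s_def)
qed

lemma ln_factor_nonneg: "0 \<le> ln (1 + 2 * h / \<Delta>)"
  using h_nonneg by simp

lemma K_ge1: "K \<ge> 1"
  unfolding K_def using ln_factor_nonneg lam_pos by simp

text \<open>The tangent bound ln t \<le> t - 1 at t = \<tau> X / x, so that equality holds when
  every edge weighs \<tau> times the maximum. This leaves the total weight with coefficient
  \<open>L - 1\<close>, which is nonpositive, so the lower bound of constraint (5) can be
  inserted.\<close>

lemma entropy_bound:
  "(\<Sum>u\<in>V. \<Sum>v\<in>V. wt u v * ln (X u / wt u v)) \<le> \<Delta> * ln (1 + 2 * h / \<Delta>) * (\<Sum>u\<in>V. X u)"
proof -
  define L where "L = - ln \<tau>"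
  let ?X = "\<Sum>u\<in>V. X u" and ?W = "\<Sum>u\<in>V. \<Sum>v\<in>V. wt u v"
  have pt: "wt u v * ln (X u / wt u v) \<le> adj u v * (\<tau> * X u) + (L - 1) * wt u v" if u: "u \<in> V" for u v
  proof (cases "wt u v = 0")
    case True
    then show ?thesis using adj_nonneg X_nonneg[OF u] tau(1) by simp
  next
    case False
    then have w: "wt u v > 0" using wt_nonneg[of u v] by simp
    then have X: "X u > 0" using wt_le_X[OF u, of v] by linarith
    have adj: "adj u v = 1" using False by (auto simp: adj_def wt_def split: if_splits)
    have "ln (\<tau> * X u / wt u v) \<le> \<tau> * X u / wt u v - 1"
      using w X tau(1) by (intro ln_le_minus_one) simp
    then have "wt u v * ln (\<tau> * X u / wt u v) \<le> wt u v * (\<tau> * X u / wt u v - 1)"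
      using w by (intro mult_left_mono) auto
    also have "\<dots> = \<tau> * X u - wt u v" using w by (simp add: field_simps)
    finally have "wt u v * (ln \<tau> + ln (X u / wt u v)) \<le> \<tau> * X u - wt u v"
      using w X tau(1) by (simp add: ln_mult ln_div algebra_simps)
    then show ?thesis using adj by (simp add: L_def algebra_simps)
  qed
  have "(\<Sum>u\<in>V. \<Sum>v\<in>V. wt u v * ln (X u / wt u v))
    \<le> (\<Sum>u\<in>V. \<Sum>v\<in>V. adj u v * (\<tau> * X u) + (L - 1) * wt u v)"
    by (intro sum_mono pt)
  also have "\<dots> = (\<Sum>u\<in>V. (\<Sum>v\<in>V. adj u v) * (\<tau> * X u)) + (L - 1) * ?W"
    by (simp add: sum.distrib sum_distrib_left sum_distrib_right)
  also have "(\<Sum>u\<in>V. (\<Sum>v\<in>V. adj u v) * (\<tau> * X u)) = \<tau> * \<Delta> * ?X"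
    by (simp add: degree sum_distrib_left mult_ac)
  also have "(L - 1) * ?W \<le> (L - 1) * (\<tau> * \<Delta> * ?X)"
  proof (rule mult_left_mono_neg)
    have "\<tau> * \<Delta> = \<Delta> - h" using \<Delta>_pos by (simp add: \<tau>_def field_simps)
    then show "\<tau> * \<Delta> * ?X \<le> ?W" using sum_wt_ge by simp
    show "L - 1 \<le> 0" using tau(3) by (simp add: L_def)
  qed
  also have "\<tau> * \<Delta> * ?X + (L - 1) * (\<tau> * \<Delta> * ?X) = \<tau> * L * (\<Delta> * ?X)" by (simp add: algebra_simps)
  also have "\<dots> \<le> 1 * ln (1 + 2 * h / \<Delta>) * (\<Delta> * ?X)"
    using tau sum_X_pos ln_factor_nonneg unfolding L_def
    by (intro mult_right_mono mult_mono) (auto simp: ln_le_zero_iff)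
  finally show ?thesis by (simp add: mult_ac)
qed

text \<open>The support of \<open>X\<close>, where \<open>ln X\<close> is meaningful; pairs that
  leave it carry no weight.\<close>

definition VP :: "nat set" where "VP = {u\<in>V. X u > 0}"

lemma VP: "finite VP" "VP \<subseteq> V" using finV by (auto simp: VP_def)

lemma sum_X_VP: "(\<Sum>u\<in>VP. X u) = (\<Sum>u\<in>V. X u)"
  using finV X_nonneg by (intro sum.mono_neutral_left) (force simp: VP_def)+

lemma wt_zero_outside: "u \<in> V - VP \<Longrightarrow> wt u v = 0"
  using wt_le_X[of u v] wt_nonneg[of u v] by (auto simp: VP_def)

text \<open>Both \<open>X u\<close> and \<open>X v\<close> are at least the weight of the edge
  between them, so their logarithms differ by at most the sum of their distances to
  \<open>ln (wt u v)\<close>. Each of these is an entropy term.\<close>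

lemma log_variation:
  "(\<Sum>u\<in>VP. \<Sum>v\<in>VP. wt u v * \<bar>ln (X u) - ln (X v)\<bar>) \<le> 2 * (\<Delta> * ln (1 + 2 * h / \<Delta>) * (\<Sum>u\<in>V. X u))"
proof -
  let ?g = "\<lambda>u v. wt u v * ln (X u / wt u v)"
  have g0: "0 \<le> ?g u v" if u: "u \<in> V" for u v
  proof (cases "wt u v = 0")
    case False
    then have "wt u v > 0" using wt_nonneg[of u v] by simp
    then show ?thesis using wt_le_X[OF u, of v] by simp
  qed simp
  have pt: "wt u v * \<bar>ln (X u) - ln (X v)\<bar> \<le> ?g u v + ?g v u" if "u \<in> VP" "v \<in> VP" for u v
  proof (cases "wt u v = 0")
    case True
    then show ?thesis using wt_sym[of u v] by simp
  next
    case False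
    then have w: "wt u v > 0" using wt_nonneg[of u v] by simp
    have uv: "u \<in> V" "v \<in> V" "X u > 0" "X v > 0" using that by (auto simp: VP_def)
    have "wt u v \<le> X v" using wt_le_X[OF uv(2), of u] wt_sym by simp
    then have "\<bar>ln (X u) - ln (X v)\<bar> \<le> (ln (X u) - ln (wt u v)) + (ln (X v) - ln (wt u v))"
      using w uv wt_le_X[OF uv(1), of v] by (smt (verit) ln_le_cancel_iff)
    then have "wt u v * \<bar>ln (X u) - ln (X v)\<bar> \<le> wt u v * ((ln (X u) - ln (wt u v)) + (ln (X v) - ln (wt u v)))"
      using w by (intro mult_left_mono) auto
    then show ?thesis using w uv wt_sym[of v u] by (simp add: ln_div algebra_simps)
  qed
  have "(\<Sum>u\<in>VP. \<Sum>v\<in>VP. wt u v * \<bar>ln (X u) - ln (X v)\<bar>) \<le> (\<Sum>u\<in>VP. \<Sum>v\<in>VP. ?g u v + ?g v u)"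
    by (intro sum_mono pt)
  also have "\<dots> \<le> (\<Sum>u\<in>V. \<Sum>v\<in>V. ?g u v + ?g v u)"
  proof -
    have "(\<Sum>u\<in>VP. \<Sum>v\<in>VP. ?g u v + ?g v u) \<le> (\<Sum>u\<in>VP. \<Sum>v\<in>V. ?g u v + ?g v u)"
      using VP finV g0 by (intro sum_mono sum_mono2) (auto intro!: add_nonneg_nonneg)
    also have "\<dots> \<le> (\<Sum>u\<in>V. \<Sum>v\<in>V. ?g u v + ?g v u)"
      using VP finV g0 by (intro sum_mono2 sum_nonneg) (auto intro!: add_nonneg_nonneg)
    finally show ?thesis .
  qed
  also have "\<dots> = 2 * (\<Sum>u\<in>V. \<Sum>v\<in>V. ?g u v)"
    using sum.swap[of "\<lambda>u v. ?g v u" V V] by (simp add: sum.distrib)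
  finally show ?thesis using entropy_bound by linarith
qed

text \<open>Two averaging steps. Some offset separates pairs of weight at most 3/4 lam times the
  total mass, lam / 2 coming from \<open>log_variation\<close> and lam / 4 from rounding to a grid;
  then some bucket of that partition has at most its share. The ends are values of \<open>X\<close>
  at vertices, so the candidates can be enumerated as pairs of vertices.\<close>

lemma bucket_exists:
  obtains a b where "a \<in> V" "b \<in> V" "X a > 0" "X a \<le> X b" "X b \<le> R * X a"
    "cutw wt {u\<in>V. X a \<le> X u \<and> X u \<le> X b} (V - {u\<in>V. X a \<le> X u \<and> X u \<le> X b})
      \<le> 3 / 4 * lam * (\<Sum>u\<in>{u\<in>V. X a \<le> X u \<and> X u \<le> X b}. X u)"
proof -
  let ?X = "\<Sum>u\<in>V. X u"
  \<comment> \<open>Rounding to a grid of step \<open>K / N\<close> adds at most 1 to the distance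
    of each pair, hence at most \<open>\<Delta> * ?X\<close> in total. This \<open>N\<close> keeps
    that below lam / 4 per offset and unit of mass.\<close>
  obtain N :: nat where N: "N > 4 * \<Delta> / lam" using reals_Archimedean2 by blast
  have "4 * \<Delta> / lam \<ge> 0" using lam_pos by simp
  then have N0: "N > 0" using N by (cases N) auto
  have K0: "K > 0" using K_ge1 by simp
  define q where "q u = \<lfloor>N * ln (X u) / K\<rfloor>" for u
  define ix where "ix i u = (q u + int i) div int N" for i u
  let ?sep = "\<lambda>i. \<Sum>u\<in>VP. \<Sum>v\<in>VP. wt u v * (if ix i u \<noteq> ix i v then 1 else 0)"
  have qd: "real_of_int \<bar>q u - q v\<bar> \<le> N / K * \<bar>ln (X u) - ln (X v)\<bar> + 1" for u v
  proof -
    have "\<bar>real_of_int (q u) - real_of_int (q v)\<bar> \<le> \<bar>N * ln (X u) / K - N * ln (X v) / K\<bar> + 1"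
      unfolding q_def
      using floor_correct[of "N * ln (X u) / K"] floor_correct[of "N * ln (X v) / K"]
      unfolding of_int_add of_int_1 abs_le_iff by (smt (verit))
    also have "\<bar>N * ln (X u) / K - N * ln (X v) / K\<bar> = N / K * \<bar>ln (X u) - ln (X v)\<bar>"
    proof -
      have "N * ln (X u) / K - N * ln (X v) / K = N / K * (ln (X u) - ln (X v))"
        by (simp add: algebra_simps diff_divide_distrib)
      then show ?thesis using K0 by (simp add: abs_mult)
    qed
    finally show ?thesis by simp
  qed
  have "(\<Sum>i<N. ?sep i) = (\<Sum>u\<in>VP. \<Sum>v\<in>VP. wt u v * (\<Sum>i<N. if ix i u \<noteq> ix i v then 1 else 0))"
    by (subst sum.swap, subst sum.swap[of _ VP "{..<N}"]) (simp only: sum_distrib_left)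
  also have "\<dots> \<le> (\<Sum>u\<in>VP. \<Sum>v\<in>VP. wt u v * (N / K * \<bar>ln (X u) - ln (X v)\<bar> + 1))"
    unfolding ix_def using separating_offsets[OF N0] qd
    by (intro sum_mono mult_left_mono wt_nonneg) (meson order_trans)
  also have "\<dots> = N / K * (\<Sum>u\<in>VP. \<Sum>v\<in>VP. wt u v * \<bar>ln (X u) - ln (X v)\<bar>) + (\<Sum>u\<in>VP. \<Sum>v\<in>VP. wt u v)"
    by (simp add: sum.distrib sum_distrib_left algebra_simps)
  also have "(\<Sum>u\<in>VP. \<Sum>v\<in>VP. wt u v) \<le> \<Delta> * ?X"
  proof -
    have "(\<Sum>u\<in>VP. \<Sum>v\<in>VP. wt u v) \<le> (\<Sum>u\<in>VP. \<Sum>v\<in>V. wt u v)"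
      using VP finV wt_nonneg by (intro sum_mono sum_mono2) auto
    also have "\<dots> \<le> (\<Sum>u\<in>V. \<Sum>v\<in>V. wt u v)"
      using VP finV wt_nonneg by (intro sum_mono2 sum_nonneg) auto
    finally show ?thesis using sum_wt_le by linarith
  qed
  also have "N / K * (\<Sum>u\<in>VP. \<Sum>v\<in>VP. wt u v * \<bar>ln (X u) - ln (X v)\<bar>)
    \<le> N / K * (2 * (\<Delta> * ln (1 + 2 * h / \<Delta>) * ?X))"
    using log_variation K0 by (intro mult_left_mono) auto
  also have "\<dots> \<le> N * (lam / 2 * ?X)"
  proof -
    have "2 * (\<Delta> * ln (1 + 2 * h / \<Delta>)) \<le> K * (lam / 2)"
      using lam_pos by (simp add: K_def field_simps)
    then have "2 * (\<Delta> * ln (1 + 2 * h / \<Delta>)) * ?X \<le> K * (lam / 2) * ?X"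
      using sum_X_pos by (intro mult_right_mono) auto
    then have "N * (2 * (\<Delta> * ln (1 + 2 * h / \<Delta>)) * ?X) \<le> N * (K * (lam / 2) * ?X)"
      by (intro mult_left_mono) auto
    then show ?thesis using K0 by (simp add: field_simps)
  qed
  also have "\<Delta> * ?X \<le> N * (lam / 4 * ?X)"
  proof -
    have "\<Delta> \<le> N * (lam / 4)" using N lam_pos by (simp add: field_simps)
    then show ?thesis using mult_right_mono[of "real \<Delta>" "N * (lam / 4)" ?X] sum_X_pos by simp
  qed
  finally have tot: "(\<Sum>i<N. ?sep i) \<le> N * (3 / 4 * lam * ?X)" by (simp add: algebra_simps)
  have "\<exists>i<N. ?sep i \<le> 3 / 4 * lam * ?X"
  proof (rule ccontr)
    assume "\<not> ?thesis"
    then have "(\<Sum>i<N. 3 / 4 * lam * ?X) < (\<Sum>i<N. ?sep i)"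
      using N0 by (intro sum_strict_mono) (auto simp: not_le)
    then show False using tot by simp
  qed
  then obtain i where i: "?sep i \<le> 3 / 4 * lam * ?X" by auto
  define B where "B k = {u\<in>VP. ix i u = k}" for k
  have B: "B k \<subseteq> V" "finite (B k)" for k using VP by (auto simp: B_def)
  have cutB: "cutw wt (B k) (V - B k) = (\<Sum>u\<in>B k. \<Sum>v\<in>VP. wt u v * (if ix i u \<noteq> ix i v then 1 else 0))" for k
    unfolding cutw_def
  proof (rule sum.cong[OF refl], rule sum.mono_neutral_cong)
    fix u v assume "u \<in> B k" "v \<in> V - B k - VP"
    then show "wt u v = 0" using wt_zero_outside[of v u] wt_sym by simp
  next
    fix u v assume "u \<in> B k" "v \<in> VP - (V - B k)"
    then show "wt u v * (if ix i u \<noteq> ix i v then 1 else 0) = 0" using VP by (auto simp: B_def)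
  next
    fix u v assume "u \<in> B k" "v \<in> (V - B k) \<inter> VP"
    then have "ix i u \<noteq> ix i v" by (auto simp: B_def)
    then show "wt u v = wt u v * (if ix i u \<noteq> ix i v then 1 else 0)" by simp
  qed (use VP finV in simp_all)
  have sepB: "?sep i = (\<Sum>k\<in>ix i ` VP. cutw wt (B k) (V - B k))"
    unfolding cutB unfolding B_def by (rule sum.image_gen[OF VP(1)])
  have XB: "?X = (\<Sum>k\<in>ix i ` VP. \<Sum>u\<in>B k. X u)"
    unfolding sum_X_VP[symmetric] B_def by (rule sum.image_gen[OF VP(1)])
  have "\<exists>k\<in>ix i ` VP. cutw wt (B k) (V - B k) \<le> 3 / 4 * lam * (\<Sum>u\<in>B k. X u)"
  proof (rule ccontr)
    assume "\<not> ?thesis"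
    moreover have "VP \<noteq> {}" using X_pos_exists by (auto simp: VP_def)
    ultimately have "(\<Sum>k\<in>ix i ` VP. 3 / 4 * lam * (\<Sum>u\<in>B k. X u)) < ?sep i"
      unfolding sepB using VP by (intro sum_strict_mono) (auto simp: not_le)
    then show False using i unfolding XB by (simp add: sum_distrib_left)
  qed
  then obtain k where k: "k \<in> ix i ` VP" "cutw wt (B k) (V - B k) \<le> 3 / 4 * lam * (\<Sum>u\<in>B k. X u)"
    by blast
  then have ne: "B k \<noteq> {}" by (auto simp: B_def)
  have "Min (X ` B k) \<in> X ` B k" "Max (X ` B k) \<in> X ` B k" using ne B by (auto intro!: Min_in Max_in)
  then obtain a b where ab: "a \<in> B k" "X a = Min (X ` B k)" "b \<in> B k" "X b = Max (X ` B k)" by force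
  have range: "X a \<le> X u" "X u \<le> X b" if "u \<in> B k" for u
    using that B(2) unfolding ab by auto
  have pos: "X a > 0" "X b > 0" using ab by (auto simp: B_def VP_def)
  have mono: "ix i u \<le> ix i v" if "X u > 0" "X u \<le> X v" for u v
  proof -
    have "N * ln (X u) / K \<le> N * ln (X v) / K"
      using that K0 by (intro divide_right_mono mult_left_mono) auto
    then show ?thesis unfolding ix_def q_def using N0 by (intro zdiv_mono1 add_right_mono floor_mono) auto
  qed
  \<comment> \<open>The bucket index is monotone in \<open>X\<close>, so a bucket is a full interval
    of values.\<close>
  have eq: "{u\<in>V. X a \<le> X u \<and> X u \<le> X b} = B k"
  proof (intro subset_antisym subsetI)
    fix u assume u: "u \<in> {u\<in>V. X a \<le> X u \<and> X u \<le> X b}"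
    then have "X u > 0" using pos by auto
    moreover have "ix i a \<le> ix i u" "ix i u \<le> ix i b" using u pos \<open>X u > 0\<close> by (auto intro!: mono)
    ultimately show "u \<in> B k" using ab u by (auto simp: B_def VP_def)
  qed (use range B in auto)
  have XbR: "X b \<le> R * X a"
  proof -
    have same: "(q a + int i) div int N = (q b + int i) div int N" using ab by (simp add: B_def ix_def)
    have "q b - q a < int N"
    proof -
      have "q b + int i = int N * ((q b + int i) div int N) + (q b + int i) mod int N" by simp
      moreover have "q a + int i = int N * ((q a + int i) div int N) + (q a + int i) mod int N" by simp
      moreover have "(q b + int i) mod int N < int N" "(q a + int i) mod int N \<ge> 0" using N0 by auto
      ultimately show ?thesis using same by (smt (verit))
    qed
    \<comment> \<open>Integrality turns the strict inequality into a gap of one, which absorbs the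
      rounding in \<open>q b\<close>. So the window length is \<open>K\<close> itself, without an
      extra grid step.\<close>
    then have "q b + 1 \<le> q a + int N" by simp
    then have "real_of_int (q b + 1) \<le> real_of_int (q a + int N)" by (simp only: of_int_le_iff)
    then have "real_of_int (q b) + 1 \<le> real_of_int (q a) + N" by simp
    moreover have "N * ln (X b) / K < real_of_int (q b) + 1" "real_of_int (q a) \<le> N * ln (X a) / K"
      unfolding q_def by linarith+
    ultimately have "N * ln (X b) / K < N * ln (X a) / K + N" by linarith
    then have "N * ln (X b) < N * (ln (X a) + K)" using K0 by (simp add: field_simps)
    then have "ln (X b) < ln (X a) + K" using N0 by simp
    then have "exp (ln (X b)) < exp (ln (X a) + K)" by simp
    then show ?thesis using pos by (simp add: exp_add R_def mult.commute)
  qed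
  show ?thesis
  proof (rule that[of a b])
    show "a \<in> V" "b \<in> V" using ab B by auto
    show "X a \<le> X b" using range(2)[OF ab(1)] .
  qed (use pos k(2) eq XbR in simp_all)
qed

end

section \<open>The potential that pays for sparse cuts\<close>

context sdp_solution begin

definition min_size :: real where "min_size = 3 * \<delta> * n / 8"
text \<open>The summand 1 puts every size from \<open>min_size\<close> on at 1 or above. Hence
  halving such a size lowers the value by a full unit even where the result is clipped at 0.\<close>

definition ell :: "nat \<Rightarrow> real" where "ell s = max 0 (1 + log 2 (s / min_size))"
definition \<Lambda> :: real where "\<Lambda> = max 1 \<bar>ln \<delta>\<bar>"
text \<open>Solved from 2 * \<open>phi\<close> * \<open>R\<close> * 5 \<Lambda> = 3/8 * lam, where 5
  \<Lambda> bounds \<open>ell\<close> and 3/8 = 9/8 - 3/4 is the budget left by the window.\<close>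

definition phi :: real where "phi = 3 / 80 * lam / (R * \<Lambda>)"
text \<open>The second summand pays for the cuts still to be made inside \<open>S\<close>; \<open>ell\<close> counts how often the
  size can still be halved.\<close>

definition \<Psi> :: "nat set \<Rightarrow> real" where
  "\<Psi> S = cutw wt S (V - S) + 2 * phi * R * (\<Sum>u\<in>S. X u) * ell (card S)"
text \<open>The bounded ratio of \<open>X\<close>-values passes to subsets, so a split only has to
  preserve the inequality for \<Psi>.\<close>

definition good :: "nat set \<Rightarrow> bool" where
  "good S \<longleftrightarrow> S \<subseteq> V \<and> S \<noteq> {} \<and> (\<exists>m>0. \<forall>u\<in>S. m \<le> X u \<and> X u \<le> R * m) \<and>
    \<Psi> S \<le> 9 / 8 * lam * (\<Sum>u\<in>S. X u)"

lemma R_pos: "R > 0" and \<Lambda>_ge1: "\<Lambda> \<ge> 1" and phi_pos: "phi > 0"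
  using lam_pos by (auto simp: R_def \<Lambda>_def phi_def)

lemma min_size_pos: "min_size > 0"
  using \<delta>_pos n_ge2 by (simp add: min_size_def)

lemma ell_nonneg: "ell s \<ge> 0"
  by (simp add: ell_def)

lemma ell_mono: "0 < s \<Longrightarrow> s \<le> t \<Longrightarrow> ell s \<le> ell t"
  unfolding ell_def using min_size_pos by (intro max.mono add_left_mono) (auto simp: divide_right_mono)

lemma ell_half:
  assumes "0 < s" "2 * s \<le> t" "min_size \<le> t"
  shows "ell s \<le> ell t - 1"
proof -
  have t: "0 \<le> log 2 (t / min_size)"
    using assms min_size_pos by (simp add: zero_le_log_cancel_iff)
  have "log 2 (s / min_size) + 1 = log 2 (2 * real s / min_size)"
  proof -
    have "log 2 (2 * (s / min_size)) = log 2 2 + log 2 (s / min_size)"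
      using assms min_size_pos by (intro log_mult_pos) auto
    then show ?thesis by simp
  qed
  also have "\<dots> \<le> log 2 (t / min_size)"
  proof (subst log_le_cancel_iff)
    have "real (2 * s) \<le> real t" using assms(2) by (simp only: of_nat_le_iff)
    then show "2 * real s / min_size \<le> real t / min_size"
      using min_size_pos by (intro divide_right_mono) auto
  qed (use assms min_size_pos in auto)
  finally show ?thesis using t by (simp add: ell_def)
qed

text \<open>The bound is 1 + 3/2 + 2 \<Lambda>: log 2 (8/3) \<le> 3/2 because the square of 8/3 is
  below 8, and 1 / ln 2 \<le> 2.\<close>

lemma ell_le:
  assumes "0 < s" "s \<le> n"
  shows "ell s \<le> 5 * \<Lambda>"
proof -
  have n: "real n > 0" using n_ge2 by simp
  have "log 2 (s / min_size) \<le> log 2 (n / min_size)"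
    using assms min_size_pos by (simp add: divide_right_mono)
  also have "n / min_size = 8 / 3 * (1 / \<delta>)" using n \<delta>_pos by (simp add: min_size_def field_simps)
  also have "log 2 (8 / 3 * (1 / \<delta>)) = log 2 (8 / 3) + log 2 (1 / \<delta>)"
    using \<delta>_pos by (intro log_mult_pos) auto
  also have "log 2 (8 / 3) \<le> (3 / 2 :: real)"
  proof -
    have "2 * log 2 (8 / 3) = log 2 ((8 / 3) ^ 2 :: real)" by (subst log_nat_power) auto
    also have "\<dots> \<le> log 2 (2 ^ 3)" by (subst log_le_cancel_iff) (auto simp: power2_eq_square)
    also have "\<dots> = 3" by (subst log_nat_power) auto
    finally show ?thesis by simp
  qed
  also have "log 2 (1 / \<delta>) \<le> 2 * \<Lambda>"
  proof -
    have "log 2 (1 / \<delta>) = (- ln \<delta>) / ln 2" using \<delta>_pos by (simp add: log_def ln_div)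
    also have "\<dots> \<le> \<Lambda> / (1 / 2)"
    proof (intro frac_le)
      have "exp (1 / 2) ^ 2 = exp (1::real)" by (simp add: exp_double[symmetric])
      then have "exp (1 / 2 :: real) ^ 2 \<le> 2 ^ 2" using exp_le by simp
      then have "exp (1 / 2 :: real) \<le> 2" by (rule power2_le_imp_le) simp
      then show "1 / 2 \<le> ln (2::real)" by (subst ln_ge_iff) auto
    qed (use \<Lambda>_ge1 in \<open>auto simp: \<Lambda>_def\<close>)
    finally show ?thesis by simp
  qed
  finally show ?thesis using \<Lambda>_ge1 by (simp add: ell_def)
qed

lemma good_sum_pos: "good S \<Longrightarrow> (\<Sum>u\<in>S. X u) > 0"
  unfolding good_def using finV by (intro sum_pos) (auto intro: finite_subset)

lemma good_interval: "\<exists>a\<in>V. \<exists>b\<in>V. good {u\<in>V. X a \<le> X u \<and> X u \<le> X b}"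
proof -
  obtain a b where ab: "a \<in> V" "b \<in> V" "X a > 0" "X a \<le> X b" "X b \<le> R * X a"
    "cutw wt {u\<in>V. X a \<le> X u \<and> X u \<le> X b} (V - {u\<in>V. X a \<le> X u \<and> X u \<le> X b})
      \<le> 3 / 4 * lam * (\<Sum>u\<in>{u\<in>V. X a \<le> X u \<and> X u \<le> X b}. X u)"
    by (rule bucket_exists)
  define S where "S = {u\<in>V. X a \<le> X u \<and> X u \<le> X b}"
  have S: "S \<subseteq> V" "a \<in> S" "finite S" using ab finV by (auto simp: S_def)
  have c: "0 < card S" "card S \<le> n" using S finV by (auto simp: card_gt_0_iff n_def card_mono)
  have X0: "(\<Sum>u\<in>S. X u) \<ge> 0" using S X_nonneg by (intro sum_nonneg) auto
  have "2 * phi * R * (\<Sum>u\<in>S. X u) * ell (card S) \<le> 2 * phi * R * (\<Sum>u\<in>S. X u) * (5 * \<Lambda>)"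
    using ell_le[OF c] phi_pos R_pos X0 by (intro mult_left_mono) auto
  also have "\<dots> = 3 / 8 * lam * (\<Sum>u\<in>S. X u)"
    using R_pos \<Lambda>_ge1 by (simp add: phi_def field_simps)
  finally have "\<Psi> S \<le> 9 / 8 * lam * (\<Sum>u\<in>S. X u)"
    using ab(6) by (simp add: \<Psi>_def S_def[symmetric])
  moreover have "\<forall>u\<in>S. X a \<le> X u \<and> X u \<le> R * X a" using ab by (auto simp: S_def)
  ultimately have "good S" unfolding good_def using S ab by auto
  then show ?thesis using ab S_def by auto
qed

text \<open>\<Psi> dominates the boundary, and 9/8 is below the factor 5/4 that every small set
  has.\<close>

lemma good_large:
  assumes S: "good S"
  shows "card S \<ge> 2" "min_size \<le> card S"
proof -
  have SV: "S \<subseteq> V" using S by (simp add: good_def)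
  have "\<not> (card S < 2 \<or> real (card S) < min_size)"
  proof
    assume "card S < 2 \<or> real (card S) < min_size"
    then have "5 / 4 * lam * (\<Sum>u\<in>S. X u) \<le> cutw wt S (V - S)"
      using small_set_boundary[OF SV] by (simp add: min_size_def)
    also have "\<dots> \<le> \<Psi> S"
      using good_sum_pos[OF S] phi_pos R_pos ell_nonneg by (simp add: \<Psi>_def)
    also have "\<dots> \<le> 9 / 8 * lam * (\<Sum>u\<in>S. X u)" using S by (simp add: good_def)
    finally show False using good_sum_pos[OF S] lam_pos by simp
  qed
  then show "card S \<ge> 2" "min_size \<le> card S" by auto
qed

text \<open>The split adds twice the weight of the cut to the boundaries, at most
  \<open>2 * phi * R\<close> times the mass of \<open>A\<close>. As \<open>A\<close> has at most
  half the vertices, its \<open>ell\<close> drops by 1, which releases exactly this amount. So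
  \<Psi> does not increase in total while the masses add up, and one of the parts inherits the ratio
  9/8.\<close>

lemma good_split:
  assumes S: "good S" and A: "A \<subseteq> S" "A \<noteq> {}" "2 * card A \<le> card S"
    and sparse: "cutw adj A (S - A) \<le> phi * card A"
  shows "good A \<or> good (S - A)"
proof -
  have SV: "S \<subseteq> V" using S by (simp add: good_def)
  have "finite S" using SV finV by (rule finite_subset)
  moreover have "finite A" using A(1) calculation by (rule finite_subset)
  ultimately have fin: "finite S" "finite A" .
  obtain m where m: "m > 0" "\<And>u. u \<in> S \<Longrightarrow> m \<le> X u \<and> X u \<le> R * m"
    using S by (auto simp: good_def)
  have cA: "card A > 0" using A fin by (simp add: card_gt_0_iff)
  have cD: "card (S - A) = card S - card A" using A fin by (intro card_Diff_subset) auto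
  \<comment> \<open>Counting edges is exchanged for mass at the cost of a factor \<open>R\<close>:
    an edge at \<open>A\<close> weighs at most \<open>R * m\<close>, a vertex at least
    \<open>m\<close>.\<close>
  have "cutw wt A (S - A) \<le> R * m * cutw adj A (S - A)"
    unfolding cutw_def sum_distrib_left
  proof (intro sum_mono)
    fix u v assume "u \<in> A"
    then have "u \<in> S" "u \<in> V" using A SV by auto
    then have "wt u v \<le> adj u v * X u" "X u \<le> R * m" using wt_le_adj_X m by auto
    then show "wt u v \<le> R * m * adj u v"
      using adj_nonneg[of u v] by (metis mult.commute mult_left_mono order_trans)
  qed
  also have "\<dots> \<le> R * m * (phi * card A)"
    using sparse R_pos m by (intro mult_left_mono) auto
  also have "\<dots> \<le> phi * R * (\<Sum>u\<in>A. X u)"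
  proof -
    have "m * card A \<le> (\<Sum>u\<in>A. X u)"
      using sum_bounded_below[of A m X] m A by (auto simp: mult.commute)
    then have "phi * R * (m * card A) \<le> phi * R * (\<Sum>u\<in>A. X u)"
      using phi_pos R_pos by (intro mult_left_mono) auto
    then show ?thesis by (simp add: mult_ac)
  qed
  finally have w: "cutw wt A (S - A) \<le> phi * R * (\<Sum>u\<in>A. X u)" .
  have bd: "cutw wt A (V - A) + cutw wt (S - A) (V - (S - A)) = cutw wt S (V - S) + 2 * cutw wt A (S - A)"
  proof -
    have e1: "V - A = (V - S) \<union> (S - A)" and e2: "V - (S - A) = (V - S) \<union> A"
      and e3: "S = A \<union> (S - A)" using A SV by auto
    have c1: "cutw wt A ((V - S) \<union> (S - A)) = cutw wt A (V - S) + cutw wt A (S - A)"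
      by (rule cutw_union_right) (use fin finV A in auto)
    have c2: "cutw wt (S - A) ((V - S) \<union> A) = cutw wt (S - A) (V - S) + cutw wt (S - A) A"
      by (rule cutw_union_right) (use fin finV A in auto)
    have "cutw wt (A \<union> (S - A)) (V - S) = cutw wt A (V - S) + cutw wt (S - A) (V - S)"
      by (rule cutw_union_left) (use fin finV A in auto)
    then have c3: "cutw wt S (V - S) = cutw wt A (V - S) + cutw wt (S - A) (V - S)"
      by (simp only: e3[symmetric])
    have c4: "cutw wt (S - A) A = cutw wt A (S - A)" by (rule cutw_sym) (rule wt_sym)
    show ?thesis unfolding e1 e2 c1 c2 c3 c4 by simp
  qed
  have XS: "(\<Sum>u\<in>S. X u) = (\<Sum>u\<in>A. X u) + (\<Sum>u\<in>S - A. X u)"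
    using fin A by (metis add.commute sum.subset_diff)
  have XA: "(\<Sum>u\<in>A. X u) \<ge> 0" "(\<Sum>u\<in>S - A. X u) \<ge> 0"
    using A SV X_nonneg by (auto intro!: sum_nonneg)
  have "ell (card A) \<le> ell (card S) - 1"
    using cA A good_large(2)[OF S] by (intro ell_half) auto
  then have eA: "2 * phi * R * (\<Sum>u\<in>A. X u) * ell (card A) \<le> 2 * phi * R * (\<Sum>u\<in>A. X u) * (ell (card S) - 1)"
    using XA phi_pos R_pos by (intro mult_left_mono) auto
  have "ell (card (S - A)) \<le> ell (card S)"
    using cA A cD by (intro ell_mono) auto
  then have eB: "2 * phi * R * (\<Sum>u\<in>S - A. X u) * ell (card (S - A)) \<le> 2 * phi * R * (\<Sum>u\<in>S - A. X u) * ell (card S)"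
    using XA phi_pos R_pos by (intro mult_left_mono) auto
  have "\<Psi> A + \<Psi> (S - A) \<le> cutw wt S (V - S) + 2 * (phi * R * (\<Sum>u\<in>A. X u))
      + 2 * phi * R * (\<Sum>u\<in>A. X u) * (ell (card S) - 1)
      + 2 * phi * R * (\<Sum>u\<in>S - A. X u) * ell (card S)"
    using bd w eA eB unfolding \<Psi>_def by linarith
  also have "\<dots> = \<Psi> S" unfolding \<Psi>_def XS by (simp add: algebra_simps)
  also have "\<dots> \<le> 9 / 8 * lam * (\<Sum>u\<in>S. X u)" using S by (simp add: good_def)
  finally have "\<Psi> A + \<Psi> (S - A) \<le> 9 / 8 * lam * (\<Sum>u\<in>A. X u) + 9 / 8 * lam * (\<Sum>u\<in>S - A. X u)"
    unfolding XS by (simp add: algebra_simps)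
  then have "\<Psi> A \<le> 9 / 8 * lam * (\<Sum>u\<in>A. X u) \<or> \<Psi> (S - A) \<le> 9 / 8 * lam * (\<Sum>u\<in>S - A. X u)"
    by linarith
  moreover have "S - A \<noteq> {}"
  proof
    assume "S - A = {}"
    then have "card (S - A) = 0" by (simp only: card.empty)
    then show False using cA A cD by simp
  qed
  moreover have "A \<subseteq> V" "S - A \<subseteq> V" using A SV by auto
  ultimately show ?thesis unfolding good_def using A m by blast
qed

text \<open>Squaring doubles the 4 in \<open>K\<close> to the exponent 8 and gives 6400 from 80. The
  square of 3 cancels against the square of e, which stems from the summand 1 in \<open>K\<close>
  and is at most 9.\<close>

lemma phi_bound: "phi\<^sup>2 \<ge> 1 / 6400 * lam\<^sup>2 / (max 1 ((ln \<delta>)\<^sup>2) * (1 + 2 * h / \<Delta>) powr (8 * \<Delta> / lam))"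
proof -
  have b: "1 + 2 * h / \<Delta> > 0" using h_nonneg by (smt (verit) divide_nonneg_nonneg of_nat_0_le_iff)
  have L2: "\<Lambda>\<^sup>2 = max 1 ((ln \<delta>)\<^sup>2)"
  proof (cases "\<bar>ln \<delta>\<bar> \<le> 1")
    case True
    then have "(ln \<delta>)\<^sup>2 \<le> 1" by (simp add: abs_square_le_1)
    then show ?thesis using True by (simp add: \<Lambda>_def)
  next
    case False
    then have "1 \<le> (ln \<delta>)\<^sup>2" using abs_square_less_1[of "ln \<delta>"] by linarith
    then show ?thesis using False by (simp add: \<Lambda>_def max_def)
  qed
  have "R\<^sup>2 = exp (2 + 8 * \<Delta> / lam * ln (1 + 2 * h / \<Delta>))"
    unfolding R_def K_def exp_double[symmetric] by (simp add: algebra_simps)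
  also have "\<dots> = exp 1 ^ 2 * (1 + 2 * h / \<Delta>) powr (8 * \<Delta> / lam)"
    using b by (simp add: exp_add powr_def exp_double[symmetric])
  finally have R2: "R\<^sup>2 = exp 1 ^ 2 * (1 + 2 * h / \<Delta>) powr (8 * \<Delta> / lam)" .
  have "exp (1::real) ^ 2 \<le> 3 ^ 2" by (intro power_mono exp_le) auto
  then have R9: "R\<^sup>2 \<le> 9 * (1 + 2 * h / \<Delta>) powr (8 * \<Delta> / lam)"
    unfolding R2 by (intro mult_right_mono) auto
  have "1 / 6400 * lam\<^sup>2 / (max 1 ((ln \<delta>)\<^sup>2) * (1 + 2 * h / \<Delta>) powr (8 * \<Delta> / lam))
     = 9 / 6400 * lam\<^sup>2 / (\<Lambda>\<^sup>2 * (9 * (1 + 2 * h / \<Delta>) powr (8 * \<Delta> / lam)))"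
    unfolding L2 by (simp add: field_simps)
  also have "\<dots> \<le> 9 / 6400 * lam\<^sup>2 / (\<Lambda>\<^sup>2 * R\<^sup>2)"
  proof (intro divide_left_mono mult_left_mono R9 mult_pos_pos)
    show "0 < (1 + 2 * h / \<Delta>) powr (8 * \<Delta> / lam)" using b by simp
  qed (use R_pos \<Lambda>_ge1 in auto)
  also have "\<dots> = phi\<^sup>2" by (simp add: phi_def power_divide power_mult_distrib mult_ac)
  finally show ?thesis .
qed

text \<open>The cut inequality for a single vertex \<open>u\<close> with positive
  \<open>X u\<close>: all its \<open>y\<close>-mass leaves, while at most
  \<open>\<Delta> * X u\<close> of edge weight does. It serves to bound \<open>phi\<close> by n, so
  that n / \<open>phi\<close> is at least 1.\<close>

lemma lam_le: "lam \<le> \<Delta> / 2"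
proof -
  obtain u where u: "u \<in> V" "X u > 0" using X_pos_exists by auto
  have "2 * lam * X u \<le> 2 * lam * cutw yw {u} (V - {u})"
  proof -
    have "(\<Sum>v\<in>V. yw u v) = (\<Sum>v\<in>V - {u}. yw u v)"
      using finV by (intro sum.mono_neutral_right) (auto simp: yw_def)
    then have "X u \<le> cutw yw {u} (V - {u})" using X_le_yw[OF u(1)] by (simp add: cutw_def)
    then show ?thesis using lam_pos by (intro mult_left_mono) auto
  qed
  also have "\<dots> \<le> cutw wt {u} (V - {u})" using u by (intro cut_wt_ge) auto
  also have "\<dots> \<le> (\<Sum>v\<in>V. wt u v)"
    unfolding cutw_def using finV wt_nonneg by (simp add: sum_mono2)
  also have "\<dots> \<le> (\<Sum>v\<in>V. adj u v * X u)" by (intro sum_mono wt_le_adj_X u)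
  also have "\<dots> = \<Delta> * X u" using degree[OF u(1)] by (simp add: sum_distrib_right[symmetric])
  finally show ?thesis using u by simp
qed

lemma phi_le: "phi \<le> n"
proof -
  have "1 * 1 \<le> R * \<Lambda>" using K_ge1 \<Lambda>_ge1 by (intro mult_mono) (auto simp: R_def)
  then have "phi \<le> 3 / 80 * lam / 1" unfolding phi_def using lam_pos by (intro divide_left_mono) auto
  also have "\<dots> \<le> n" using lam_le \<Delta>_less lam_pos by (simp add: field_simps)
  finally show ?thesis .
qed

end

section \<open>Certifying expansion by a walk\<close>

lemma laplacian_induced_apply:
  fixes g :: "nat \<Rightarrow> real"
  assumes G: "simple_graph V E" and S: "S \<subseteq> V" and a: "a \<in> S"
  shows "(\<Sum>b\<in>S. laplacian (induced_edges E S) a b * g b)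
    = (\<Sum>v\<in>S. (if {a, v} \<in> E then 1 else 0) * (g a - g v))"
proof -
  let ?E = "induced_edges E S"
  have GS: "simple_graph S ?E"
    using G S by (auto simp: simple_graph_def induced_edges_def intro: finite_subset)
  note fin = simple_graph_finite[OF GS]
  define c where "c e = (\<Sum>b\<in>S. edge_lap e a b * g b)" for e
  have "(\<Sum>b\<in>S. laplacian ?E a b * g b) = (\<Sum>e\<in>?E. c e)"
    unfolding laplacian_def c_def sum_distrib_right by (rule sum.swap)
  also have "\<dots> = (\<Sum>e | e \<in> ?E \<and> a \<in> e. c e)"
  proof (rule sum.mono_neutral_right)
    show "\<forall>e\<in>?E - {e. e \<in> ?E \<and> a \<in> e}. c e = 0"
    proof
      fix e assume e: "e \<in> ?E - {e. e \<in> ?E \<and> a \<in> e}"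
      then have "e = {Min e, Max e}" "a \<notin> e" using GS card_two_Min_Max(1)[of e] by (auto simp: simple_graph_def)
      then have "a \<noteq> Min e" "a \<noteq> Max e" by auto
      then show "c e = 0" by (simp add: c_def edge_lap_def pair_lap_def pair_vec_def)
    qed
  qed (use fin in auto)
  also have "\<dots> = (\<Sum>v\<in>S. if {a, v} \<in> ?E then c {a, v} else 0)"
    by (rule sum_incident_edges[OF GS])
  also have "\<dots> = (\<Sum>v\<in>S. (if {a, v} \<in> E then 1 else 0) * (g a - g v))"
  proof (intro sum.cong refl)
    fix v assume v: "v \<in> S"
    have "c {a, v} = g a - g v" if "{a, v} \<in> E"
    proof -
      have av: "a \<noteq> v" using simple_graph_edge[OF G that] by simp
      have "c {a, v} = (\<Sum>b\<in>S. (if b = a then g a else 0) - (if b = v then g v else 0))"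
        unfolding c_def edge_lap_pair[OF av] using av
        by (intro sum.cong) (auto simp: pair_lap_def pair_vec_def)
      then show ?thesis using fin a v by (simp add: sum_subtractf)
    qed
    moreover have "{a, v} \<in> ?E \<longleftrightarrow> {a, v} \<in> E" using a v by (auto simp: induced_edges_def)
    ultimately show "(if {a, v} \<in> ?E then c {a, v} else 0) = (if {a, v} \<in> E then 1 else 0) * (g a - g v)"
      by simp
  qed
  finally show ?thesis .
qed

lemma laplacian_induced_symmetric:
  "laplacian F a b = laplacian F b a"
  by (simp add: laplacian_def edge_lap_def pair_lap_def mult.commute)

text \<open>Discrete Green formula: exchange the two summation variables and average.\<close>

lemma sum_sum_antisym:
  fixes k :: "nat \<Rightarrow> nat \<Rightarrow> real"
  assumes sym: "\<And>u v. k u v = k v u"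
  shows "(\<Sum>u\<in>S. f u * (\<Sum>v\<in>S. k u v * (g u - g v))) = (\<Sum>u\<in>S. \<Sum>v\<in>S. k u v * ((f u - f v) * (g u - g v))) / 2"
proof -
  let ?T = "\<Sum>u\<in>S. \<Sum>v\<in>S. k u v * (f u * (g u - g v))"
  have e: "(\<Sum>u\<in>S. f u * (\<Sum>v\<in>S. k u v * (g u - g v))) = ?T"
    by (simp add: sum_distrib_left mult_ac)
  have "?T = (\<Sum>u\<in>S. \<Sum>v\<in>S. k v u * (f v * (g v - g u)))"
    by (rule sum.swap)
  also have "\<dots> = (\<Sum>u\<in>S. \<Sum>v\<in>S. k u v * (f v * (g v - g u)))"
    by (simp add: sym)
  finally have "2 * ?T = ?T + (\<Sum>u\<in>S. \<Sum>v\<in>S. k u v * (f v * (g v - g u)))" by simp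
  also have "\<dots> = (\<Sum>u\<in>S. \<Sum>v\<in>S. k u v * ((f u - f v) * (g u - g v)))"
    unfolding sum.distrib[symmetric] by (intro sum.cong refl) (simp add: algebra_simps)
  finally show ?thesis unfolding e by simp
qed

text \<open>The bridge from matrices indexed by positions in a sorted list to functions on
  \<open>S\<close>. The later spectral arguments use only the eigenvalue equation stated
  here.\<close>

lemma lambda2_laplacian_eigenfunction:
  fixes E :: "nat set set"
  assumes G: "simple_graph V E" and S: "S \<subseteq> V" and card: "card S \<ge> 2"
  shows "\<exists>f. (\<forall>u\<in>S. (\<Sum>v\<in>S. (if {u, v} \<in> E then 1 else 0) * (f u - f v))
        = lambda2 (mat_on S (laplacian (induced_edges E S))) * f u) \<and>
    (\<Sum>u\<in>S. f u) = 0 \<and> (\<exists>u\<in>S. f u \<noteq> 0)"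
proof -
  let ?L = "laplacian (induced_edges E S)"
  define A where "A = mat_on S ?L"
  define vs where "vs = sorted_list_of_set S"
  define m where "m = card S"
  have finS: "finite S" using card by (metis card.infinite not_numeral_le_zero)
  have A: "A \<in> carrier_mat m m" by (simp add: A_def mat_on_def m_def Let_def)
  have el: "A $$ (i, j) = ?L (vs ! i) (vs ! j)" if "i < m" "j < m" for i j
    using that by (simp add: A_def mat_on_def m_def Let_def vs_def)
  have bij: "bij_betw (\<lambda>i. vs ! i) {..<m} S"
  proof (rule bij_betw_nth)
    show "distinct vs" by (simp add: vs_def)
    show "{..<m} = {..<length vs}" by (simp add: vs_def m_def)
    show "S = set vs" using finS by (simp add: vs_def)
  qed
  have reidx: "(\<Sum>j<m. F (vs ! j)) = (\<Sum>v\<in>S. F v)" for F :: "nat \<Rightarrow> real"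
    by (rule sum.reindex_bij_betw[OF bij])
  have mem: "vs ! i \<in> S" if "i < m" for i using bij that by (auto simp: bij_betw_def)
  define pos where "pos = the_inv_into {..<m} (\<lambda>i. vs ! i)"
  have pos: "pos (vs ! i) = i" if "i < m" for i
    using that bij unfolding pos_def bij_betw_def by (intro the_inv_into_f_f) auto
  have apply_L: "(\<Sum>j<m. A $$ (i, j) * f j) = (\<Sum>v\<in>S. (if {vs ! i, v} \<in> E then 1 else 0) * (f i - f (pos v)))"
    if i: "i < m" for i and f :: "nat \<Rightarrow> real"
  proof -
    have "(\<Sum>j<m. A $$ (i, j) * f j) = (\<Sum>j<m. ?L (vs ! i) (vs ! j) * f (pos (vs ! j)))"
      using i by (intro sum.cong) (auto simp: el pos)
    also have "\<dots> = (\<Sum>b\<in>S. ?L (vs ! i) b * f (pos b))" by (rule reidx)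
    also have "\<dots> = (\<Sum>v\<in>S. (if {vs ! i, v} \<in> E then 1 else 0) * (f (pos (vs ! i)) - f (pos v)))"
      by (rule laplacian_induced_apply[OF G S mem[OF i]])
    finally show ?thesis using pos[OF i] by simp
  qed
  have "\<exists>f. (\<forall>i<m. (\<Sum>j<m. A $$ (i, j) * f j) = lambda2 A * f i) \<and>
    (\<Sum>i<m. f i) = 0 \<and> (\<exists>i<m. f i \<noteq> 0)"
  proof (rule lambda2_eigenvector[OF A])
    show "2 \<le> m" using card by (simp add: m_def)
    show "A $$ (i, j) = A $$ (j, i)" if "i < m" "j < m" for i j
      using that el laplacian_induced_symmetric by simp
    show "(\<Sum>j<m. A $$ (i, j)) = 0" if "i < m" for i
      using apply_L[OF that, of "\<lambda>_. 1"] by simp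
    show "0 \<le> (\<Sum>i<m. \<Sum>j<m. f i * A $$ (i, j) * f j)" for f
    proof -
      have "(\<Sum>i<m. \<Sum>j<m. f i * A $$ (i, j) * f j) = (\<Sum>i<m. f i * (\<Sum>j<m. A $$ (i, j) * f j))"
        by (simp add: sum_distrib_left mult_ac)
      also have "\<dots> = (\<Sum>i<m. f (pos (vs ! i)) * (\<Sum>v\<in>S. (if {vs ! i, v} \<in> E then 1 else 0) * (f (pos (vs ! i)) - f (pos v))))"
        by (intro sum.cong refl) (auto simp: apply_L pos)
      also have "\<dots> = (\<Sum>u\<in>S. f (pos u) * (\<Sum>v\<in>S. (if {u, v} \<in> E then 1 else 0) * (f (pos u) - f (pos v))))"
        by (rule reidx)
      also have "\<dots> = (\<Sum>u\<in>S. \<Sum>v\<in>S. (if {u, v} \<in> E then 1 else 0) * ((f (pos u) - f (pos v)) * (f (pos u) - f (pos v)))) / 2"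
        by (rule sum_sum_antisym) (simp add: insert_commute)
      also have "\<dots> \<ge> 0" by (intro divide_nonneg_nonneg sum_nonneg) auto
      finally show ?thesis .
    qed
  qed
  then obtain f where f: "\<forall>i<m. (\<Sum>j<m. A $$ (i, j) * f j) = lambda2 A * f i"
    "(\<Sum>i<m. f i) = 0" "\<exists>i<m. f i \<noteq> 0" by blast
  have ex: "\<exists>i<m. u = vs ! i" if "u \<in> S" for u
    using bij that unfolding bij_betw_def by (metis imageE lessThan_iff)
  show ?thesis
  proof (intro exI[of _ "\<lambda>u. f (pos u)"] conjI ballI)
    fix u assume "u \<in> S"
    then obtain i where i: "i < m" "u = vs ! i" using ex by blast
    show "(\<Sum>v\<in>S. (if {u, v} \<in> E then 1 else 0) * (f (pos u) - f (pos v)))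
      = lambda2 (mat_on S ?L) * f (pos u)"
      using apply_L[OF i(1), of f] f(1) i pos unfolding A_def by simp
  next
    have "(\<Sum>u\<in>S. f (pos u)) = (\<Sum>j<m. f (pos (vs ! j)))" by (rule reidx[symmetric])
    then show "(\<Sum>u\<in>S. f (pos u)) = 0" using f(2) pos by simp
    show "\<exists>u\<in>S. f (pos u) \<noteq> 0" using f(3) mem pos by metis
  qed
qed

text \<open>Cauchy-Schwarz, from Lagrange's identity.\<close>

lemma sum_product_square_le:
  fixes f g :: "nat \<Rightarrow> real"
  shows "(\<Sum>u\<in>S. f u * g u)\<^sup>2 \<le> (\<Sum>u\<in>S. (f u)\<^sup>2) * (\<Sum>u\<in>S. (g u)\<^sup>2)"
proof -
  have "0 \<le> (\<Sum>u\<in>S. \<Sum>v\<in>S. (f u * g v - f v * g u)\<^sup>2)" by (intro sum_nonneg) auto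
  also have "\<dots> = (\<Sum>u\<in>S. \<Sum>v\<in>S. (f u)\<^sup>2 * (g v)\<^sup>2) + (\<Sum>u\<in>S. \<Sum>v\<in>S. (g u)\<^sup>2 * (f v)\<^sup>2)
      - 2 * (\<Sum>u\<in>S. \<Sum>v\<in>S. (f u * g u) * (f v * g v))"
    by (simp add: power2_diff power_mult_distrib sum.distrib sum_subtractf sum_distrib_left algebra_simps)
  also have "\<dots> = 2 * ((\<Sum>u\<in>S. (f u)\<^sup>2) * (\<Sum>u\<in>S. (g u)\<^sup>2)) - 2 * (\<Sum>u\<in>S. f u * g u)\<^sup>2"
    unfolding power2_eq_square[of "\<Sum>u\<in>S. f u * g u"] sum_product[symmetric] by simp
  finally show ?thesis by simp
qed

text \<open>The shift 2 n is at least 2 d, an upper bound for the spectrum of the Laplacian, so the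
  smallest eigenvalues get the largest multipliers. Without normalisation, integer vectors stay
  integer.\<close>

definition walk_step :: "(nat \<Rightarrow> nat \<Rightarrow> real) \<Rightarrow> nat \<Rightarrow> nat set \<Rightarrow> (nat \<Rightarrow> real) \<Rightarrow> nat \<Rightarrow> real" where
  "walk_step a n S z u = 2 * real n * z u - (\<Sum>v\<in>S. a u v * (z u - z v))"

locale bounded_kernel =
  fixes a :: "nat \<Rightarrow> nat \<Rightarrow> real" and S :: "nat set" and d :: real and n :: nat
  assumes finS: "finite S" and a_sym: "\<And>u v. a u v = a v u" and a_nonneg: "\<And>u v. 0 \<le> a u v"
    and deg: "\<And>u. u \<in> S \<Longrightarrow> (\<Sum>v\<in>S. a u v) \<le> d" and d_pos: "d > 0" and d_le: "d \<le> n"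
begin

lemma energy_eq: "(\<Sum>u\<in>S. z u * (\<Sum>v\<in>S. a u v * (z u - z v))) = energy a S z"
  unfolding sum_sum_antisym[OF a_sym] energy_def by (simp add: power2_eq_square)

lemma self_adjoint:
  "(\<Sum>u\<in>S. f u * walk_step a n S z u) = (\<Sum>u\<in>S. walk_step a n S f u * z u)"
proof -
  have "(\<Sum>u\<in>S. f u * (\<Sum>v\<in>S. a u v * (z u - z v))) = (\<Sum>u\<in>S. z u * (\<Sum>v\<in>S. a u v * (f u - f v)))"
    unfolding sum_sum_antisym[OF a_sym] by (simp add: mult.commute)
  then show ?thesis
    by (simp add: walk_step_def right_diff_distrib left_diff_distrib sum_subtractf mult_ac)
qed

text \<open>Cauchy-Schwarz at each vertex with the weights \<open>a u v\<close>, whose sum is at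
  most \<open>d\<close>. In operator form the square of L is at most 2 d L.\<close>

lemma laplacian_norm_le: "(\<Sum>u\<in>S. (\<Sum>v\<in>S. a u v * (z u - z v))\<^sup>2) \<le> 2 * d * energy a S z"
proof -
  have "(\<Sum>v\<in>S. a u v * (z u - z v))\<^sup>2 \<le> d * (\<Sum>v\<in>S. a u v * (z u - z v)\<^sup>2)" if u: "u \<in> S" for u
  proof -
    have "(\<Sum>v\<in>S. a u v * (z u - z v))\<^sup>2 = (\<Sum>v\<in>S. sqrt (a u v) * (sqrt (a u v) * (z u - z v)))\<^sup>2"
      using a_nonneg by (simp add: mult.assoc[symmetric])
    also have "\<dots> \<le> (\<Sum>v\<in>S. (sqrt (a u v))\<^sup>2) * (\<Sum>v\<in>S. (sqrt (a u v) * (z u - z v))\<^sup>2)"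
      by (rule sum_product_square_le)
    also have "\<dots> = (\<Sum>v\<in>S. a u v) * (\<Sum>v\<in>S. a u v * (z u - z v)\<^sup>2)"
      using a_nonneg by (simp add: power_mult_distrib)
    also have "\<dots> \<le> d * (\<Sum>v\<in>S. a u v * (z u - z v)\<^sup>2)"
      using deg[OF u] a_nonneg by (intro mult_right_mono sum_nonneg) auto
    finally show ?thesis .
  qed
  then have "(\<Sum>u\<in>S. (\<Sum>v\<in>S. a u v * (z u - z v))\<^sup>2) \<le> (\<Sum>u\<in>S. d * (\<Sum>v\<in>S. a u v * (z u - z v)\<^sup>2))"
    by (intro sum_mono)
  then show ?thesis unfolding energy_def sum_distrib_left[symmetric] by simp
qed

text \<open>Expanding the square gives a loss of 4 n times the energy;
  \<open>laplacian_norm_le\<close> shows that the quadratic term returns at most half of it.\<close>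

lemma walk_step_norm_le:
  assumes "\<rho> * (\<Sum>u\<in>S. (z u)\<^sup>2) \<le> energy a S z"
  shows "(\<Sum>u\<in>S. (walk_step a n S z u)\<^sup>2) \<le> (4 * (real n)\<^sup>2 - 2 * real n * \<rho>) * (\<Sum>u\<in>S. (z u)\<^sup>2)"
proof -
  let ?l = "\<lambda>u. \<Sum>v\<in>S. a u v * (z u - z v)" and ?N = "\<Sum>u\<in>S. (z u)\<^sup>2"
  have e0: "energy a S z \<ge> 0" unfolding energy_def using a_nonneg by (intro divide_nonneg_nonneg sum_nonneg) auto
  have "(\<Sum>u\<in>S. (walk_step a n S z u)\<^sup>2) = (\<Sum>u\<in>S. 4 * (real n)\<^sup>2 * (z u)\<^sup>2 - 4 * real n * (z u * ?l u) + (?l u)\<^sup>2)"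
    by (intro sum.cong refl) (simp add: walk_step_def power2_diff power_mult_distrib algebra_simps)
  also have "\<dots> = 4 * (real n)\<^sup>2 * ?N - 4 * real n * energy a S z + (\<Sum>u\<in>S. (?l u)\<^sup>2)"
    by (simp only: sum.distrib sum_subtractf sum_distrib_left[symmetric] energy_eq)
  also have "\<dots> \<le> 4 * (real n)\<^sup>2 * ?N - 4 * real n * energy a S z + 2 * real n * energy a S z"
    using laplacian_norm_le[of z] mult_right_mono[OF d_le e0] by simp
  also have "\<dots> \<le> 4 * (real n)\<^sup>2 * ?N - 2 * real n * (\<rho> * ?N)"
    using mult_left_mono[OF assms, of "2 * real n"] by simp
  finally show ?thesis by (simp add: algebra_simps)
qed

lemma walk_step_sum: "(\<Sum>u\<in>S. walk_step a n S z u) = 2 * real n * (\<Sum>u\<in>S. z u)"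
  using self_adjoint[of "\<lambda>_. 1" z] by (simp add: walk_step_def sum_distrib_left)

text \<open>The start is \<open>card S\<close> times the projection of the indicator of
  \<open>v\<close> off the constants; the scaling makes it integral.\<close>

primrec walk :: "nat \<Rightarrow> nat \<Rightarrow> nat \<Rightarrow> real" where
  "walk v 0 = (\<lambda>u. if u = v then real (card S) - 1 else -1)"
| "walk v (Suc t) = walk_step a n S (walk v t)"

lemma walk_sum: "v \<in> S \<Longrightarrow> (\<Sum>u\<in>S. walk v t u) = 0"
proof (induction t)
  case 0
  have "(\<Sum>u\<in>S. walk v 0 u) = (\<Sum>u\<in>S. (if u = v then real (card S) else 0) - 1)"
    by (intro sum.cong) auto
  then show ?case using finS 0 by (simp add: sum_subtractf)
next
  case (Suc t)
  then show ?case using walk_step_sum[of "walk v t"] by simp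
qed

lemma walk_inner:
  fixes f :: "nat \<Rightarrow> real" and \<mu> :: real
  assumes ev: "\<And>u. u \<in> S \<Longrightarrow> (\<Sum>v\<in>S. a u v * (f u - f v)) = \<mu> * f u"
    and f0: "(\<Sum>u\<in>S. f u) = 0" and v: "v \<in> S"
  shows "(\<Sum>u\<in>S. f u * walk v t u) = (2 * real n - \<mu>) ^ t * (real (card S) * f v)"
proof (induction t)
  case 0
  have "(\<Sum>u\<in>S. f u * walk v 0 u) = (\<Sum>u\<in>S. (if u = v then real (card S) * f v else 0) - f u)"
    by (intro sum.cong) (auto simp: algebra_simps)
  then show ?case using finS v f0 by (simp add: sum_subtractf)
next
  case (Suc t)
  have "(\<Sum>u\<in>S. f u * walk v (Suc t) u) = (\<Sum>u\<in>S. walk_step a n S f u * walk v t u)"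
    by (simp add: self_adjoint)
  also have "\<dots> = (\<Sum>u\<in>S. (2 * real n - \<mu>) * (f u * walk v t u))"
  proof (intro sum.cong refl)
    fix u assume "u \<in> S"
    then have "walk_step a n S f u = (2 * real n - \<mu>) * f u"
      unfolding walk_step_def by (simp only: ev left_diff_distrib)
    then show "walk_step a n S f u * walk v t u = (2 * real n - \<mu>) * (f u * walk v t u)" by simp
  qed
  finally show ?case by (simp only: sum_distrib_left[symmetric] Suc.IH power_Suc mult.assoc)
qed

text \<open>If \<mu> were below \<rho> / 4, the component of the walk along \<open>f\<close> would
  lose per step at most half as much, in squared norm, as \<open>cheeger_sweep\<close> forces on the
  whole vector. After n^8 steps the component would exceed the norm. The factor 4 between \<rho> and
  \<mu>, on top of the 2 in Cheeger's inequality, gives the 8.\<close>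

theorem walk_certificate:
  fixes f :: "nat \<Rightarrow> real" and \<mu> :: real
  assumes n2: "n \<ge> 2" and card2: "card S \<ge> 2" and cardn: "card S \<le> n" and phi: "\<phi> \<ge> 1 / n"
    and cuts: "\<And>v t w A. v \<in> S \<Longrightarrow> t < n ^ 8 \<Longrightarrow> w \<in> S \<Longrightarrow> A = {u\<in>S. walk v t u \<ge> walk v t w} \<Longrightarrow>
      \<phi> * min (real (card A)) (real (card (S - A))) \<le> cutw a A (S - A)"
    and ev: "\<And>u. u \<in> S \<Longrightarrow> (\<Sum>v\<in>S. a u v * (f u - f v)) = \<mu> * f u"
    and f0: "(\<Sum>u\<in>S. f u) = 0" and fnz: "\<exists>u\<in>S. f u \<noteq> 0"
  shows "\<phi>\<^sup>2 / (8 * d) \<le> \<mu>"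
proof (rule ccontr)
  assume neg: "\<not> \<phi>\<^sup>2 / (8 * d) \<le> \<mu>"
  define \<rho> where "\<rho> = \<phi>\<^sup>2 / (2 * d)"
  have mu: "\<mu> < \<rho> / 4" using neg by (simp add: \<rho>_def)
  have n0: "real n > 0" using n2 by simp
  have phi0: "\<phi> > 0" using phi n0 by (smt (verit) divide_pos_pos)
  have rho0: "\<rho> > 0" using phi0 d_pos by (simp add: \<rho>_def)
  define m where "m = real (card S)"
  have m2: "m \<ge> 2" using card2 by (simp add: m_def)
  define q where "q = 4 * (real n)\<^sup>2 - 2 * real n * \<rho>"
  have step: "(\<Sum>u\<in>S. (walk v (Suc t) u)\<^sup>2) \<le> q * (\<Sum>u\<in>S. (walk v t u)\<^sup>2)"
    if v: "v \<in> S" and t: "t < n ^ 8" for v t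
  proof -
    have "\<rho> * (\<Sum>u\<in>S. (walk v t u)\<^sup>2) \<le> energy a S (walk v t)"
      unfolding \<rho>_def
      by (rule cheeger_sweep[OF finS a_sym a_nonneg deg d_pos phi0 walk_sum[OF v]])
        (use cuts[OF v t] in auto)
    then show ?thesis unfolding q_def walk.simps by (rule walk_step_norm_le)
  qed
  have N0: "(\<Sum>u\<in>S. (walk v 0 u)\<^sup>2) = m * (m - 1)" if v: "v \<in> S" for v
  proof -
    have "(\<Sum>u\<in>S. (walk v 0 u)\<^sup>2) = (\<Sum>u\<in>S. (if u = v then m\<^sup>2 - 2 * m else 0) + 1)"
      by (intro sum.cong) (auto simp: m_def power2_eq_square algebra_simps)
    also have "\<dots> = m\<^sup>2 - 2 * m + m" using finS v by (simp add: sum.distrib m_def)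
    finally show ?thesis by (simp add: power2_eq_square algebra_simps)
  qed
  \<comment> \<open>At a maximum of |f| the initial component along \<open>f\<close> is not too
    small: the comparison with the norm then costs only the factor \<open>m\<close>.\<close>
  obtain v where v: "v \<in> S" "(\<Sum>u\<in>S. (f u)\<^sup>2) \<le> m * (f v)\<^sup>2" "f v \<noteq> 0"
  proof -
    have "S \<noteq> {}" using fnz by auto
    then have "Max ((\<lambda>u. (f u)\<^sup>2) ` S) \<in> (\<lambda>u. (f u)\<^sup>2) ` S" using finS by (intro Max_in) auto
    then obtain v where v: "v \<in> S" "(f v)\<^sup>2 = Max ((\<lambda>u. (f u)\<^sup>2) ` S)" by force
    then have mx: "(f u)\<^sup>2 \<le> (f v)\<^sup>2" if "u \<in> S" for u using finS that by simp
    have "(\<Sum>u\<in>S. (f u)\<^sup>2) \<le> m * (f v)\<^sup>2"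
      using sum_bounded_above[of S "\<lambda>u. (f u)\<^sup>2" "(f v)\<^sup>2"] mx by (simp add: m_def)
    moreover have "f v \<noteq> 0"
    proof
      assume z: "f v = 0"
      obtain u where "u \<in> S" "f u \<noteq> 0" using fnz by auto
      then show False using mx[of u] z by simp
    qed
    ultimately show ?thesis using that v(1) by blast
  qed
  define T where "T = n ^ 8"
  have T0: "T > 0" using n2 by (simp add: T_def)
  \<comment> \<open>Read off from the first step: \<open>q\<close> times a positive number bounds a
    norm.\<close>
  have q0: "q \<ge> 0"
  proof -
    have "0 \<le> (\<Sum>u\<in>S. (walk v (Suc 0) u)\<^sup>2)" by (intro sum_nonneg) auto
    also have "\<dots> \<le> q * (m * (m - 1))" using step[OF v(1), of 0] T0 N0[OF v(1)] by (simp add: T_def)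
    finally have "0 \<le> q * (m * (m - 1))" .
    moreover have "m * (m - 1) > 0" using m2 by simp
    ultimately show ?thesis by (simp only: zero_le_mult_iff) linarith
  qed
  have norm: "(\<Sum>u\<in>S. (walk v t u)\<^sup>2) \<le> q ^ t * (m * (m - 1))" if "t \<le> T" for t
    using that
  proof (induction t)
    case 0 then show ?case using N0[OF v(1)] by simp
  next
    case (Suc t)
    have "(\<Sum>u\<in>S. (walk v (Suc t) u)\<^sup>2) \<le> q * (\<Sum>u\<in>S. (walk v t u)\<^sup>2)"
      using Suc.prems by (intro step v) (simp add: T_def)
    also have "\<dots> \<le> q * (q ^ t * (m * (m - 1)))"
      using Suc q0 by (intro mult_left_mono) auto
    finally show ?case by (simp add: mult_ac)
  qed
  have "((2 * real n - \<mu>) ^ T * (m * f v))\<^sup>2 = (\<Sum>u\<in>S. f u * walk v T u)\<^sup>2"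
    by (simp add: walk_inner[OF ev f0 v(1)] m_def)
  also have "\<dots> \<le> (\<Sum>u\<in>S. (f u)\<^sup>2) * (\<Sum>u\<in>S. (walk v T u)\<^sup>2)"
    by (rule sum_product_square_le)
  also have "\<dots> \<le> (m * (f v)\<^sup>2) * (q ^ T * (m * (m - 1)))"
    using v(2) norm[of T] m2 by (intro mult_mono sum_nonneg) auto
  also have "\<dots> \<le> (m * (f v)\<^sup>2) * (q ^ T * (m * m))"
    using m2 q0 by (intro mult_left_mono) auto
  finally have "((2 * real n - \<mu>) ^ T)\<^sup>2 * (m\<^sup>2 * (f v)\<^sup>2) \<le> (q ^ T * m) * (m\<^sup>2 * (f v)\<^sup>2)"
    by (simp add: power_mult_distrib power2_eq_square mult_ac)
  then have main: "((2 * real n - \<mu>)\<^sup>2) ^ T \<le> q ^ T * m"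
    using v(3) m2 by (simp add: mult_le_cancel_right_pos power_mult[symmetric] mult.commute)
  define b where "b = \<rho> / (2 * real n)"
  have b: "0 < b" "b \<le> 1"
  proof -
    show "0 < b" using rho0 n0 by (simp add: b_def)
    have "2 * real n * \<rho> \<le> 2 * real n * (2 * real n)" using q0 by (simp add: q_def power2_eq_square)
    then have "\<rho> \<le> 2 * real n" using n0 by (simp add: mult_le_cancel_left_pos)
    then show "b \<le> 1" using n0 by (simp add: b_def)
  qed
  have rb: "\<rho> = 2 * real n * b" using n0 by (simp add: b_def)
  have qb: "q = (2 * real n)\<^sup>2 * (1 - b)" by (simp add: q_def rb power2_eq_square algebra_simps)
  have lo: "(2 * real n)\<^sup>2 * (1 - b / 2) \<le> (2 * real n - \<mu>)\<^sup>2"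
  proof -
    have "(2 * real n)\<^sup>2 * (1 - b / 2) \<le> (2 * real n * (1 - b / 4))\<^sup>2"
      using b by (auto simp: power2_eq_square algebra_simps intro!: mult_nonneg_nonneg)
    also have "\<dots> \<le> (2 * real n - \<mu>)\<^sup>2"
      using mu b n0 by (intro power_mono) (auto simp: rb algebra_simps)
    finally show ?thesis by simp
  qed
  have "((2 * real n)\<^sup>2) ^ T * (1 - b / 2) ^ T \<le> ((2 * real n - \<mu>)\<^sup>2) ^ T"
    unfolding power_mult_distrib[symmetric] using lo b by (intro power_mono) auto
  also have "\<dots> \<le> ((2 * real n)\<^sup>2) ^ T * ((1 - b) ^ T * m)" using main by (simp add: qb power_mult_distrib mult.assoc)
  finally have "(1 - b / 2) ^ T \<le> (1 - b) ^ T * m" using n0 by (simp add: mult_le_cancel_left_pos)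
  \<comment> \<open>Since \<open>1 - b\<close> is at most the square of \<open>1 - b / 2\<close>,
    one of the two powers cancels against the left-hand side.\<close>
  also have "\<dots> \<le> ((1 - b / 2) * (1 - b / 2)) ^ T * m"
    using b m2 by (intro mult_right_mono power_mono) (auto simp: algebra_simps)
  also have "\<dots> = (1 - b / 2) ^ T * ((1 - b / 2) ^ T * m)" by (simp add: power_mult_distrib)
  finally have "1 \<le> (1 - b / 2) ^ T * m" using b by (simp add: mult_le_cancel_left1)
  moreover have "(1 - b / 2) ^ T \<le> exp (- real n)"
  proof -
    have "(1 - b / 2) ^ T \<le> exp (- b / 2) ^ T"
      using b exp_ge_add_one_self[of "- b / 2"] by (intro power_mono) auto
    also have "\<dots> = exp (- (T * (b / 2)))" by (simp add: exp_of_nat_mult[symmetric])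
    also have "\<dots> \<le> exp (- real n)"
    proof -
      \<comment> \<open>Origin of the n^8: \<phi> \<ge> 1/n and d \<le> n give 4 b n^4 \<ge> 1, so
        n^8 steps make the exponent \<open>T * (b / 2)\<close> at least n^4 / 8, and this is at
        least n for n \<ge> 2.\<close>
      have "(1 / n)\<^sup>2 \<le> \<phi>\<^sup>2" using phi n0 by (intro power_mono) auto
      then have p1: "1 \<le> \<phi>\<^sup>2 * (real n)\<^sup>2" using n0 by (simp add: field_simps power_divide)
      have p2: "\<phi>\<^sup>2 = b * (4 * real n * d)" using n0 d_pos by (simp add: b_def \<rho>_def field_simps)
      have p3: "b * (4 * real n * d) * (real n)\<^sup>2 \<le> b * (4 * real n * real n) * (real n)\<^sup>2"
        using b d_le n0 by (intro mult_right_mono mult_left_mono) auto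
      have "1 \<le> b * (4 * real n * real n) * (real n)\<^sup>2" using p1 p3 unfolding p2 by linarith
      then have "1 \<le> 4 * b * real n ^ 4" by (simp add: power4_eq_xxxx power2_eq_square mult_ac)
      then have "real n ^ 4 * 1 \<le> real n ^ 4 * (4 * b * real n ^ 4)" by (intro mult_left_mono) auto
      moreover have e8: "real T = real n ^ 4 * real n ^ 4" by (simp add: T_def power_add[symmetric])
      have "8 * (real T * (b / 2)) = real n ^ 4 * (4 * b * real n ^ 4)" unfolding e8 by simp
      ultimately have "real n ^ 4 \<le> 8 * (real T * (b / 2))" by linarith
      moreover have "8 * real n \<le> real n ^ 4"
      proof -
        have "(2::real) ^ 3 \<le> real n ^ 3" using n2 by (intro power_mono) auto
        then have "8 * real n \<le> real n ^ 3 * n" using n0 by simp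
        then show ?thesis by (simp add: power4_eq_xxxx power3_eq_cube)
      qed
      ultimately have "real n \<le> real T * (b / 2)" by linarith
      then show ?thesis by simp
    qed
    finally show ?thesis .
  qed
  ultimately have "1 \<le> exp (- real n) * m" using m2 mult_right_mono[of "(1 - b / 2) ^ T" "exp (- real n)" m] by linarith
  then have "exp (real n) \<le> m" by (simp add: exp_minus field_simps)
  moreover have "1 + real n \<le> exp (real n)" by (rule exp_ge_add_one_self)
  moreover have "m \<le> n" using cardn by (simp add: m_def)
  ultimately show False by simp
qed

end

section \<open>Cuts and walks in integer arithmetic, and the sparsity level of the program\<close>

definition cut_count :: "nat set set \<Rightarrow> nat set \<Rightarrow> nat set \<Rightarrow> int" where
  "cut_count E A B = (\<Sum>u\<in>A. \<Sum>v\<in>B. if {u, v} \<in> E then 1 else 0)"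

text \<open>Sparsity below n / j with respect to the smaller side, cleared of denominators.
  Strictness excludes the two trivial cuts.\<close>

definition sparse_cut :: "nat set set \<Rightarrow> nat \<Rightarrow> nat \<Rightarrow> nat set \<Rightarrow> nat set \<Rightarrow> bool" where
  "sparse_cut E n j S A \<longleftrightarrow> A \<subseteq> S \<and> cut_count E A (S - A) * int j < int n * int (card A) \<and>
     cut_count E A (S - A) * int j < int n * int (card (S - A))"

fun walk_int :: "nat set set \<Rightarrow> nat \<Rightarrow> nat set \<Rightarrow> nat \<Rightarrow> nat \<Rightarrow> nat \<Rightarrow> int" where
  "walk_int E n S v 0 u = (if u = v then int (card S) - 1 else -1)"
| "walk_int E n S v (Suc t) u = 2 * int n * walk_int E n S v t u
     - (\<Sum>w\<in>S. if {u, w} \<in> E then walk_int E n S v t u - walk_int E n S v t w else 0)"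

definition sweep_free :: "nat set set \<Rightarrow> nat \<Rightarrow> nat \<Rightarrow> nat set \<Rightarrow> bool" where
  "sweep_free E n j S \<longleftrightarrow> (\<forall>v\<in>S. \<forall>t<n^8. \<forall>w\<in>S.
     \<not> sparse_cut E n j S {u\<in>S. walk_int E n S v t u \<ge> walk_int E n S v t w})"

context sdp_solution begin

lemma cut_count_adj: "real_of_int (cut_count E A B) = cutw adj A B"
  unfolding cut_count_def cutw_def adj_def of_int_sum by (intro sum.cong refl) auto

text \<open>204800 = 6400 * 32. The 6400 is that of \<open>phi_bound\<close>; in 32 = 4 * 8 the 4
  pays for replacing \<open>phi\<close> by a level n / j, which loses at most a factor 2 before
  squaring, and the 8 is that of \<open>walk_certificate\<close>.\<close>

lemma expanding_if_lambda2:
  assumes "S \<subseteq> V" "card S \<ge> 2" "min_size \<le> card S"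
    and l2: "phi\<^sup>2 / (32 * real \<Delta>) \<le> lambda2 (mat_on S (laplacian (induced_edges E S)))"
  shows "expanding_set (1 / 204800) 8 V E \<Delta> \<delta> h lam S"
proof -
  let ?D = "max 1 ((ln \<delta>)\<^sup>2) * (1 + 2 * h / \<Delta>) powr (8 * \<Delta> / lam)"
  have "1 / 204800 * lam\<^sup>2 / (\<Delta> * max 1 ((ln \<delta>)\<^sup>2) * (1 + 2 * h / \<Delta>) powr (8 * \<Delta> / lam))
    = (1 / 6400 * lam\<^sup>2 / ?D) / (32 * real \<Delta>)"
    by (simp add: field_simps)
  also have "\<dots> \<le> phi\<^sup>2 / (32 * real \<Delta>)"
    by (rule divide_right_mono[OF phi_bound]) simp
  finally show ?thesis
    unfolding expanding_set_def using assms by (simp add: min_size_def n_def)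
qed

lemma kernel: "S \<subseteq> V \<Longrightarrow> bounded_kernel adj S \<Delta> n"
proof
  assume S: "S \<subseteq> V"
  show "finite S" using S finV by (rule finite_subset)
  show "(\<Sum>v\<in>S. adj u v) \<le> \<Delta>" if "u \<in> S" for u
  proof -
    have "(\<Sum>v\<in>S. adj u v) \<le> (\<Sum>v\<in>V. adj u v)"
      using S finV adj_nonneg by (intro sum_mono2) auto
    then show ?thesis using degree[of u] S that by auto
  qed
  show "real \<Delta> > 0" using \<Delta>_pos by simp
  show "real \<Delta> \<le> real n" using \<Delta>_less by simp
qed (auto simp: adj_sym adj_nonneg)

lemma eigenfunction:
  assumes "S \<subseteq> V" "card S \<ge> 2"
  shows "\<exists>f. (\<forall>u\<in>S. (\<Sum>v\<in>S. adj u v * (f u - f v))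
        = lambda2 (mat_on S (laplacian (induced_edges E S))) * f u) \<and>
    (\<Sum>u\<in>S. f u) = 0 \<and> (\<exists>u\<in>S. f u \<noteq> 0)"
  using lambda2_laplacian_eigenfunction[OF graph assms] unfolding adj_def .

lemma good_split_min:
  assumes S: "good S" and A: "A \<subseteq> S" "A \<noteq> {}" "A \<noteq> S"
    and sparse: "cutw adj A (S - A) \<le> phi * min (real (card A)) (real (card (S - A)))"
  shows "good A \<or> good (S - A)"
proof -
  have finS: "finite S" using S finV by (auto simp: good_def intro: finite_subset)
  have cD: "card (S - A) = card S - card A" "card A \<le> card S"
    using A finS by (auto intro: card_Diff_subset finite_subset card_mono)
  have mA: "phi * min (real (card A)) (real (card (S - A))) \<le> phi * card A"
    "phi * min (real (card A)) (real (card (S - A))) \<le> phi * card (S - A)"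
    using phi_pos by (auto intro!: mult_left_mono)
  show ?thesis
  proof (cases "2 * card A \<le> card S")
    case True
    then show ?thesis using good_split[OF S A(1,2) True] sparse mA(1) by linarith
  next
    case False
    have "S - (S - A) = A" using A by auto
    moreover have "S - A \<noteq> {}" using A by auto
    moreover have "2 * card (S - A) \<le> card S" using False cD by linarith
    moreover have "cutw adj (S - A) A = cutw adj A (S - A)" by (rule cutw_sym) (rule adj_sym)
    ultimately show ?thesis using good_split[OF S, of "S - A"] sparse mA(2) by auto
  qed
qed

text \<open>This covers arbitrary real parameters, which have no encoding for the program. A good
  set of least cardinality replaces the output: each part of a cut sparser than \<open>phi\<close>
  is smaller, and one of them would be good. Cheeger's inequality is applied to the eigenfunction
  itself.\<close>

theorem expanding_exists: "\<exists>S. expanding_set (1 / 204800) 8 V E \<Delta> \<delta> h lam S"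
proof -
  have "\<exists>S. good S" using good_interval by blast
  then obtain S where S: "good S" and minS: "\<And>S'. good S' \<Longrightarrow> card S \<le> card S'"
    by (metis ex_has_least_nat)
  have SV: "S \<subseteq> V" using S by (simp add: good_def)
  interpret bounded_kernel adj S \<Delta> n by (rule kernel[OF SV])
  obtain f where f: "\<And>u. u \<in> S \<Longrightarrow> (\<Sum>v\<in>S. adj u v * (f u - f v))
        = lambda2 (mat_on S (laplacian (induced_edges E S))) * f u"
    "(\<Sum>u\<in>S. f u) = 0" "\<exists>u\<in>S. f u \<noteq> 0"
    using eigenfunction[OF SV good_large(1)[OF S]] by auto
  define \<mu> where "\<mu> = lambda2 (mat_on S (laplacian (induced_edges E S)))"
  have cuts: "phi * min (real (card A)) (real (card (S - A))) \<le> cutw adj A (S - A)" if A: "A \<subseteq> S" for A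
  proof (rule ccontr)
    assume neg: "\<not> ?thesis"
    have nn: "0 \<le> cutw adj A (S - A)" by (rule cutw_nonneg) (rule adj_nonneg)
    have "A \<noteq> {}" "A \<noteq> S" using neg nn by auto
    then have "good A \<or> good (S - A)" using good_split_min[OF S A] neg by auto
    moreover have "card A < card S" "card (S - A) < card S"
      using A \<open>A \<noteq> {}\<close> \<open>A \<noteq> S\<close> finS by (auto intro!: psubset_card_mono)
    ultimately show False using minS by (meson not_le)
  qed
  have "phi\<^sup>2 / (2 * real \<Delta>) * (\<Sum>u\<in>S. (f u)\<^sup>2) \<le> energy adj S f"
    by (rule cheeger_sweep[OF finS a_sym a_nonneg deg d_pos phi_pos f(2)]) (use cuts in auto)
  also have "energy adj S f = (\<Sum>u\<in>S. f u * (\<mu> * f u))"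
    unfolding energy_eq[symmetric] by (intro sum.cong refl) (simp add: f(1) \<mu>_def)
  also have "\<dots> = \<mu> * (\<Sum>u\<in>S. (f u)\<^sup>2)" by (simp add: sum_distrib_left power2_eq_square mult_ac)
  finally have *: "phi\<^sup>2 / (2 * real \<Delta>) * (\<Sum>u\<in>S. (f u)\<^sup>2) \<le> \<mu> * (\<Sum>u\<in>S. (f u)\<^sup>2)" .
  have "(\<Sum>u\<in>S. (f u)\<^sup>2) > 0"
  proof -
    obtain u where "u \<in> S" "f u \<noteq> 0" using f(3) by auto
    then show ?thesis using finS by (intro sum_pos2[of _ u]) auto
  qed
  then have "phi\<^sup>2 / (2 * real \<Delta>) \<le> \<mu>" using * by (simp only: mult_le_cancel_right_pos)
  moreover have "phi\<^sup>2 / (32 * real \<Delta>) \<le> phi\<^sup>2 / (2 * real \<Delta>)"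
    using \<Delta>_pos by (intro divide_left_mono) auto
  ultimately show ?thesis
    using expanding_if_lambda2[OF SV good_large[OF S]] unfolding \<mu>_def by fastforce
qed

text \<open>\<open>walk_certificate\<close> for \<phi> = n / j; its requirement \<phi> \<ge> 1/n is
  the bound on \<open>j\<close>.\<close>

lemma sweep_free_lambda2:
  assumes S: "S \<subseteq> V" "card S \<ge> 2" and j: "1 \<le> j" "j \<le> n\<^sup>2" and free: "sweep_free E n j S"
  shows "(n / j)\<^sup>2 / (8 * real \<Delta>) \<le> lambda2 (mat_on S (laplacian (induced_edges E S)))"
proof -
  interpret bounded_kernel adj S \<Delta> n by (rule kernel[OF S(1)])
  obtain f where f: "\<And>u. u \<in> S \<Longrightarrow> (\<Sum>v\<in>S. adj u v * (f u - f v))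
        = lambda2 (mat_on S (laplacian (induced_edges E S))) * f u"
    "(\<Sum>u\<in>S. f u) = 0" "\<exists>u\<in>S. f u \<noteq> 0"
    using eigenfunction[OF S] by auto
  have w: "walk v t u = real_of_int (walk_int E n S v t u)" for v t u
  proof (induction t arbitrary: u)
    case (Suc t)
    have "(\<Sum>w\<in>S. adj u w * (walk v t u - walk v t w))
      = (\<Sum>w\<in>S. real_of_int (if {u, w} \<in> E then walk_int E n S v t u - walk_int E n S v t w else 0))"
      by (intro sum.cong refl) (auto simp: adj_def Suc.IH)
    then show ?case by (simp add: walk_step_def Suc.IH)
  qed simp
  show ?thesis
  proof (rule walk_certificate[OF n_ge2 S(2) _ _ _ f])
    show "card S \<le> n" using S(1) finV by (simp add: n_def card_mono)
    have "real j \<le> (real n)\<^sup>2" using j(2) by (metis of_nat_le_iff of_nat_power)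
    then show "1 / real n \<le> real n / real j"
      using j n_ge2 by (simp add: field_simps power2_eq_square)
    fix v t w A
    assume v: "v \<in> S" and t: "t < n ^ 8" and ww: "w \<in> S" and A: "A = {u\<in>S. walk v t u \<ge> walk v t w}"
    have "\<not> sparse_cut E n j S A"
      using free v t ww unfolding sweep_free_def A w by simp
    moreover have "A \<subseteq> S" using A by auto
    ultimately have "int n * int (card A) \<le> cut_count E A (S - A) * int j
       \<or> int n * int (card (S - A)) \<le> cut_count E A (S - A) * int j"
      by (auto simp: sparse_cut_def)
    then have "real n * real (card A) \<le> cutw adj A (S - A) * real j
       \<or> real n * real (card (S - A)) \<le> cutw adj A (S - A) * real j"
      unfolding cut_count_adj[symmetric]
      by (metis (no_types, lifting) of_int_le_iff of_int_mult of_int_of_nat_eq)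
    then have "real n / real j * real (card A) \<le> cutw adj A (S - A)
       \<or> real n / real j * real (card (S - A)) \<le> cutw adj A (S - A)"
      using j by (simp add: field_simps)
    moreover have "real n / real j * min (real (card A)) (real (card (S - A))) \<le> real n / real j * real (card A)"
      "real n / real j * min (real (card A)) (real (card (S - A))) \<le> real n / real j * real (card (S - A))"
      by (intro mult_left_mono; simp)+
    ultimately show "real n / real j * min (real (card A)) (real (card (S - A))) \<le> cutw adj A (S - A)"
      by linarith
  qed
qed

text \<open>A cut of sparsity below \<open>1/n\<close> is empty, so \<open>j\<close> never has to exceed \<open>n\<^sup>2\<close>.\<close>

definition jstar :: nat where "jstar = min (nat \<lceil>n / phi\<rceil>) (n\<^sup>2)"

text \<open>Rounding n / \<open>phi\<close> up at most doubles it because it is at least 1; squared,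
  this is the 4.\<close>

lemma jstar: "1 \<le> jstar" "jstar \<le> n\<^sup>2" "phi\<^sup>2 / 4 \<le> (n / jstar)\<^sup>2"
proof -
  have n0: "real n > 0" using n_ge2 by simp
  have q: "1 \<le> n / phi" using phi_pos phi_le by simp
  then have c: "1 \<le> \<lceil>n / phi\<rceil>" by linarith
  then have "1 \<le> nat \<lceil>n / phi\<rceil>" by linarith
  moreover have "1 \<le> n\<^sup>2" using n_ge2 by simp
  ultimately show j1: "1 \<le> jstar" unfolding jstar_def by simp
  show "jstar \<le> n\<^sup>2" by (simp add: jstar_def)
  have "real jstar \<le> 2 * n / phi"
  proof -
    have "real jstar \<le> real (nat \<lceil>n / phi\<rceil>)" by (simp add: jstar_def)
    also have "\<dots> = of_int \<lceil>n / phi\<rceil>" using c by simp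
    also have "\<dots> \<le> n / phi + 1" by linarith
    also have "\<dots> \<le> 2 * n / phi" using q by simp
    finally show ?thesis .
  qed
  then have "phi / 2 \<le> n / jstar" using j1 phi_pos by (simp add: field_simps)
  then have "(phi / 2)\<^sup>2 \<le> (n / jstar)\<^sup>2" using phi_pos by (intro power_mono) auto
  then show "phi\<^sup>2 / 4 \<le> (n / jstar)\<^sup>2" by (simp add: power_divide)
qed

text \<open>If the cap is not in force, sparsity below n / \<open>jstar\<close> implies sparsity at
  most \<open>phi\<close>. At the cap, the smaller side has at most n vertices, so fewer than one
  edge is cut.\<close>

lemma jstar_sparse:
  assumes S: "good S" and sp: "sparse_cut E n jstar S A"
  shows "good A \<or> good (S - A)"
proof -
  let ?c = "cut_count E A (S - A)"
  let ?m = "min (real (card A)) (real (card (S - A)))"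
  have SV: "S \<subseteq> V" using S by (simp add: good_def)
  have finS: "finite S" using SV finV by (rule finite_subset)
  have A: "A \<subseteq> S" using sp by (simp add: sparse_cut_def)
  have c0: "?c \<ge> 0" unfolding cut_count_def by (intro sum_nonneg) auto
  then have "0 \<le> ?c * int jstar" by simp
  then have "int n * int (card A) > 0" "int n * int (card (S - A)) > 0"
    using sp unfolding sparse_cut_def by linarith+
  then have ne: "A \<noteq> {}" "A \<noteq> S" by auto
  have n0: "real n > 0" using n_ge2 by simp
  have "real_of_int (?c * int jstar) < real_of_int (int n * int (card A))"
    "real_of_int (?c * int jstar) < real_of_int (int n * int (card (S - A)))"
    using sp unfolding sparse_cut_def of_int_less_iff by auto
  then have cm: "real_of_int ?c * jstar < n * ?m"
    unfolding min_def by auto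
  have "real_of_int ?c \<le> phi * ?m"
  proof (cases "nat \<lceil>n / phi\<rceil> \<le> n\<^sup>2")
    case True
    then have "n / phi \<le> jstar" unfolding jstar_def by (simp add: min_absorb1) linarith
    then have "n \<le> phi * jstar" using phi_pos by (simp add: field_simps)
    then have "n * ?m \<le> phi * jstar * ?m" by (intro mult_right_mono) auto
    then have "real_of_int ?c * jstar < (phi * ?m) * jstar" using cm by (simp add: mult_ac)
    then show ?thesis using jstar(1) by (simp add: mult_less_cancel_right_pos)
  next
    case False
    then have js: "jstar = n\<^sup>2" unfolding jstar_def by (intro min_absorb2) linarith
    have "card A \<le> n" using A SV finV unfolding n_def by (intro card_mono) auto
    then have "?m \<le> n" by simp
    then have "real n * ?m \<le> real n * real n" by (intro mult_left_mono) auto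
    then have "real_of_int ?c * (real n * real n) < 1 * (real n * real n)" using cm js by (simp add: power2_eq_square)
    then have "real_of_int ?c < 1" using n0 by (simp only: mult_less_cancel_right_pos mult_pos_pos)
    then have "?c = 0" using c0 by simp
    then show ?thesis using phi_pos by simp
  qed
  then show ?thesis using good_split_min[OF S A ne] by (simp add: cut_count_adj)
qed

text \<open>No reference to \<open>good\<close>: a large set that passes all tests certifies itself,
  from whatever window it was obtained.\<close>

lemma output_expanding:
  assumes "S \<subseteq> V" "card S \<ge> 2" "min_size \<le> card S" "1 \<le> j" "j \<le> jstar" "sweep_free E n j S"
  shows "expanding_set (1 / 204800) 8 V E \<Delta> \<delta> h lam S"
proof (rule expanding_if_lambda2)
  have "real n / jstar \<le> n / j" using assms(4,5) by (intro divide_left_mono) auto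
  then have "(real n / jstar)\<^sup>2 \<le> (n / j)\<^sup>2" by (intro power_mono) auto
  then have "phi\<^sup>2 / 4 \<le> (n / j)\<^sup>2" using jstar(3) by linarith
  then have "phi\<^sup>2 / 4 / (8 * real \<Delta>) \<le> (n / j)\<^sup>2 / (8 * real \<Delta>)" by (intro divide_right_mono) auto
  also have "\<dots> \<le> lambda2 (mat_on S (laplacian (induced_edges E S)))"
    using assms jstar(2) by (intro sweep_free_lambda2) auto
  finally show "phi\<^sup>2 / (32 * real \<Delta>) \<le> lambda2 (mat_on S (laplacian (induced_edges E S)))" by simp
qed (use assms in auto)

end

section \<open>Loop programs\<close>

text \<open>Every loop runs \<open>n\<close> times, where \<open>n\<close> is the first input cell, and indices are built from loop
  counters only. Hence running times are polynomial in \<open>n\<close> by construction; and since no product is ever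
  stored, the bit lengths of stored values grow by a constant per step, so the logarithmic cost is
  polynomial as well.\<close>

datatype aexp =
    Num int
  | Size
  | Ctr nat
  | Cell nat aexp
  | Plus aexp aexp
  | Minus aexp aexp
  | Times aexp aexp

datatype prog =
    Nop
  | Put nat aexp aexp
  | Get nat aexp aexp
  | Emit aexp aexp
  | Then prog prog
  | Cond aexp prog prog
  | For nat prog

record state =
  raw :: "nat \<Rightarrow> int"
  ctr :: "nat \<Rightarrow> nat"
  arr :: "nat \<Rightarrow> nat \<Rightarrow> int"

fun aval :: "nat \<Rightarrow> aexp \<Rightarrow> state \<Rightarrow> int" where
  "aval n (Num i) s = i"
| "aval n Size s = int n"
| "aval n (Ctr c) s = int (ctr s c)"
| "aval n (Cell a e) s = arr s a (nat (aval n e s))"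
| "aval n (Plus e f) s = aval n e s + aval n f s"
| "aval n (Minus e f) s = aval n e s - aval n f s"
| "aval n (Times e f) s = aval n e s * aval n f s"

definition set_ctr :: "nat \<Rightarrow> nat \<Rightarrow> state \<Rightarrow> state" where
  "set_ctr c k s = s\<lparr>ctr := (ctr s)(c := k)\<rparr>"

definition put :: "nat \<Rightarrow> nat \<Rightarrow> int \<Rightarrow> state \<Rightarrow> state" where
  "put a i v s = s\<lparr>arr := (arr s)(a := (arr s a)(i := v))\<rparr>"

lemma state_simps [simp]:
  "raw (set_ctr c k s) = raw s" "ctr (set_ctr c k s) = (ctr s)(c := k)" "arr (set_ctr c k s) = arr s"
  "raw (put a i v s) = raw s" "ctr (put a i v s) = ctr s"
  "arr (put a i v s) = (arr s)(a := (arr s a)(i := v))"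
  by (simp_all add: set_ctr_def put_def)

text \<open>832 = 64 * 13, so the work space starts at a multiple of its stride 64.\<close>

definition input_cells :: "nat \<Rightarrow> nat" where "input_cells n = 832 * n * n"

text \<open>After each round the counter is set, whatever the body did to it. Compiled code
  increments it instead; the two agree because \<open>wf_prog\<close> forbids the body to use the
  same counter.\<close>

fun for_loop :: "nat \<Rightarrow> (state \<Rightarrow> state) \<Rightarrow> nat \<Rightarrow> state \<Rightarrow> state" where
  "for_loop c f 0 s = set_ctr c 0 s"
| "for_loop c f (Suc k) s = set_ctr c (Suc k) (f (for_loop c f k s))"

text \<open>An out-of-range \<open>Get\<close> or \<open>Emit\<close> does nothing, which the
  compiled code achieves by guards, so the simulation needs no bounds on indices. \<open>raw\<close>
  describes the memory on the input cells only, and \<open>Emit\<close> must touch neither cell 0,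
  which holds n, nor the work space.\<close>

fun sem :: "nat \<Rightarrow> prog \<Rightarrow> state \<Rightarrow> state" where
  "sem n Nop s = s"
| "sem n (Put a e f) s = put a (nat (aval n e s)) (aval n f s) s"
| "sem n (Get a e f) s = (if aval n f s < int (input_cells n)
     then put a (nat (aval n e s)) (raw s (nat (aval n f s))) s else s)"
| "sem n (Emit e f) s = (if 0 < aval n e s \<and> aval n e s < int n
     then s\<lparr>raw := (raw s)(nat (aval n e s) := aval n f s)\<rparr> else s)"
| "sem n (Then P Q) s = sem n Q (sem n P s)"
| "sem n (Cond e P Q) s = (if aval n e s > 0 then sem n P s else sem n Q s)"
| "sem n (For c P) s = for_loop c (sem n P) n s"

fun counters :: "prog \<Rightarrow> nat set" where
  "counters (Then P Q) = counters P \<union> counters Q"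
| "counters (Cond e P Q) = counters P \<union> counters Q"
| "counters (For c P) = insert c (counters P)"
| "counters _ = {}"

fun writes :: "prog \<Rightarrow> nat set" where
  "writes (Put a e f) = {a}"
| "writes (Get a e f) = {a}"
| "writes (Then P Q) = writes P \<union> writes Q"
| "writes (Cond e P Q) = writes P \<union> writes Q"
| "writes (For c P) = writes P"
| "writes _ = {}"

fun emits :: "prog \<Rightarrow> bool" where
  "emits (Emit e f) \<longleftrightarrow> True"
| "emits (Then P Q) \<longleftrightarrow> emits P \<or> emits Q"
| "emits (Cond e P Q) \<longleftrightarrow> emits P \<or> emits Q"
| "emits (For c P) \<longleftrightarrow> emits P"
| "emits _ \<longleftrightarrow> False"

lemma ctr_frame: "c \<notin> counters P \<Longrightarrow> ctr (sem n P s) c = ctr s c"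
proof (induction P arbitrary: s)
  case (For c' P)
  have "ctr (for_loop c' (sem n P) k s) c = ctr s c" for k
    by (induction k) (use For in auto)
  then show ?case by simp
qed auto

lemma arr_frame: "a \<notin> writes P \<Longrightarrow> arr (sem n P s) a = arr s a"
proof (induction P arbitrary: s)
  case (For c' P)
  have "arr (for_loop c' (sem n P) k s) a = arr s a" for k
    by (induction k) (use For in auto)
  then show ?case by simp
qed auto

lemma raw_frame: "\<not> emits P \<Longrightarrow> raw (sem n P s) = raw s"
proof (induction P arbitrary: s)
  case (For c' P)
  have "raw (for_loop c' (sem n P) k s) = raw s" for k
    by (induction k) (use For in auto)
  then show ?case by simp
qed auto

lemma for_loop_ctr: "ctr (for_loop c f k s) c = k"
  by (cases k) auto

text \<open>A loop rule with the frame conditions built in: the step may assume that everything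
  outside the write set of the body has its initial value, so invariants mention only what
  changes.\<close>

lemma for_rule:
  assumes base: "I 0 (set_ctr c 0 s)"
    and step: "\<And>k s'. k < n \<Longrightarrow> I k s' \<Longrightarrow> ctr s' c = k \<Longrightarrow>
      (\<And>a. a \<notin> writes P \<Longrightarrow> arr s' a = arr s a) \<Longrightarrow>
      (\<And>c'. c' \<notin> insert c (counters P) \<Longrightarrow> ctr s' c' = ctr s c') \<Longrightarrow>
      (\<not> emits P \<Longrightarrow> raw s' = raw s) \<Longrightarrow>
      I (Suc k) (set_ctr c (Suc k) (sem n P s'))"
  shows "I n (sem n (For c P) s)"
proof -
  have fr: "(\<forall>a. a \<notin> writes P \<longrightarrow> arr (for_loop c (sem n P) k s) a = arr s a) \<and>
      (\<forall>c'. c' \<notin> insert c (counters P) \<longrightarrow> ctr (for_loop c (sem n P) k s) c' = ctr s c') \<and>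
      (\<not> emits P \<longrightarrow> raw (for_loop c (sem n P) k s) = raw s)" for k
    by (induction k) (auto simp: arr_frame ctr_frame raw_frame)
  have "I k (for_loop c (sem n P) k s)" if "k \<le> n" for k
    using that
  proof (induction k)
    case (Suc k)
    then show ?case
      using step[of k "for_loop c (sem n P) k s"] fr[of k] for_loop_ctr[of c "sem n P" k s] by simp
  qed (use base in simp)
  then show ?thesis by simp
qed

fun nest :: "nat list \<Rightarrow> prog \<Rightarrow> prog" where
  "nest [] P = P"
| "nest (c # cs) P = For c (nest cs P)"

lemma nest_sets [simp]:
  "counters (nest cs P) = set cs \<union> counters P" "writes (nest cs P) = writes P"
  "emits (nest cs P) = emits P"
  by (induction cs) auto

text \<open>For invariants that ignore the loop counters, nested loops behave like a single loop of
  \<open>n ^ length cs\<close> rounds, counted by \<open>i\<close>.\<close>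

lemma nest_rule:
  assumes ctr: "\<And>j c k s. c \<in> set cs \<Longrightarrow> I j s \<Longrightarrow> I j (set_ctr c k s)"
    and step: "\<And>i s'. i < n ^ length cs \<Longrightarrow> I (j + i) s' \<Longrightarrow> I (Suc (j + i)) (sem n P s')"
    and start: "I j s"
  shows "I (j + n ^ length cs) (sem n (nest cs P) s)"
  using assms
proof (induction cs arbitrary: j s)
  case Nil
  then show ?case using Nil.prems(2)[of 0 s] by simp
next
  case (Cons c cs)
  have "I (j + n * n ^ length cs) (sem n (For c (nest cs P)) s)"
  proof (rule for_rule[where I = "\<lambda>k s. I (j + k * n ^ length cs) s"])
    show "I (j + 0 * n ^ length cs) (set_ctr c 0 s)" using Cons.prems by simp
    fix k s' assume k: "k < n" and I: "I (j + k * n ^ length cs) s'"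
    have "I (j + k * n ^ length cs + n ^ length cs) (sem n (nest cs P) s')"
    proof (rule Cons.IH[OF _ _ I])
      show "I i (set_ctr c' k' s'')" if "c' \<in> set cs" "I i s''" for i c' k' s''
        using Cons.prems(1) that by simp
      fix i s'' assume i: "i < n ^ length cs" and J: "I (j + k * n ^ length cs + i) s''"
      have "k * n ^ length cs + i < Suc k * n ^ length cs" using i by simp
      also have "\<dots> \<le> n * n ^ length cs" using k by (intro mult_right_mono) auto
      finally have "k * n ^ length cs + i < n ^ length (c # cs)" by simp
      from Cons.prems(2)[OF this, of s''] J
      show "I (Suc (j + k * n ^ length cs + i)) (sem n P s'')" by (simp add: add.assoc)
    qed
    then show "I (j + Suc k * n ^ length cs) (set_ctr c (Suc k) (sem n (nest cs P) s'))"
      using Cons.prems(1)[of c] by (simp add: add_ac)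
  qed
  then show ?case by simp
qed

section \<open>Compilation\<close>

text \<open>Addresses pass through \<open>nat\<close>; this syntactic criterion guarantees that
  nothing is truncated there.\<close>

fun nonneg :: "aexp \<Rightarrow> bool" where
  "nonneg (Num i) \<longleftrightarrow> 0 \<le> i"
| "nonneg Size \<longleftrightarrow> True"
| "nonneg (Ctr c) \<longleftrightarrow> True"
| "nonneg (Plus e f) \<longleftrightarrow> nonneg e \<and> nonneg f"
| "nonneg (Times e f) \<longleftrightarrow> nonneg e \<and> nonneg f"
| "nonneg _ \<longleftrightarrow> False"

fun wf_aexp :: "aexp \<Rightarrow> bool" where
  "wf_aexp (Num i) \<longleftrightarrow> True"
| "wf_aexp Size \<longleftrightarrow> True"
| "wf_aexp (Ctr c) \<longleftrightarrow> c < 32"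
| "wf_aexp (Cell a e) \<longleftrightarrow> a < 32 \<and> nonneg e \<and> wf_aexp e"
| "wf_aexp (Plus e f) \<longleftrightarrow> wf_aexp e \<and> wf_aexp f"
| "wf_aexp (Minus e f) \<longleftrightarrow> wf_aexp e \<and> wf_aexp f"
| "wf_aexp (Times e f) \<longleftrightarrow> wf_aexp e \<and> wf_aexp f"

fun linear :: "aexp \<Rightarrow> bool" where
  "linear (Plus e f) \<longleftrightarrow> linear e \<and> linear f"
| "linear (Minus e f) \<longleftrightarrow> linear e \<and> linear f"
| "linear (Times e f) \<longleftrightarrow> False"
| "linear _ \<longleftrightarrow> True"

fun wf_prog :: "prog \<Rightarrow> bool" where
  "wf_prog Nop \<longleftrightarrow> True"
| "wf_prog (Put a e f) \<longleftrightarrow> a < 32 \<and> nonneg e \<and> wf_aexp e \<and> wf_aexp f \<and> linear f"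
| "wf_prog (Get a e f) \<longleftrightarrow> a < 32 \<and> nonneg e \<and> wf_aexp e \<and> nonneg f \<and> wf_aexp f"
| "wf_prog (Emit e f) \<longleftrightarrow> wf_aexp e \<and> wf_aexp f \<and> linear f"
| "wf_prog (Then P Q) \<longleftrightarrow> wf_prog P \<and> wf_prog Q"
| "wf_prog (Cond e P Q) \<longleftrightarrow> wf_aexp e \<and> wf_prog P \<and> wf_prog Q"
| "wf_prog (For c P) \<longleftrightarrow> c < 32 \<and> c \<notin> counters P \<and> wf_prog P"

lemma nonneg_aval: "nonneg e \<Longrightarrow> 0 \<le> aval n e s"
  by (induction e) auto

text \<open>The input has \<open>5 n\<^sup>2 + 8\<close> cells, so everything from \<open>832 n\<^sup>2\<close> on is free. There, 32 counters and 32
  arrays are interleaved with stride 64. Cell 0 must keep \<open>n\<close>, on which all addresses depend.\<close>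

definition addr :: "nat \<Rightarrow> nat \<Rightarrow> nat \<Rightarrow> nat" where
  "addr n k i = 64 * (i + 13 * (n * n)) + k"

lemma addr_inj: "k < 64 \<Longrightarrow> k' < 64 \<Longrightarrow> addr n k i = addr n k' i' \<longleftrightarrow> k = k' \<and> i = i'"
proof -
  assume k: "k < 64" "k' < 64"
  have "(64 * x + l) mod 64 = l" "(64 * x + l) div 64 = x" if "l < 64" for x l :: nat
    using that by simp_all
  from this[OF k(1), of "i + 13 * (n * n)"] this[OF k(2), of "i' + 13 * (n * n)"]
  show ?thesis unfolding addr_def by (metis add_right_cancel)
qed

lemma addr_ge: "input_cells n \<le> addr n k i"
  by (simp add: addr_def input_cells_def)

definition addr_expr :: "nat \<Rightarrow> expr \<Rightarrow> expr" where
  "addr_expr k e = Add (Mul (Const 64) (Add e (Mul (Const 13) (Mul (Load (Const 0)) (Load (Const 0)))))) (Const (int k))"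

fun comp_aexp :: "aexp \<Rightarrow> expr" where
  "comp_aexp (Num i) = Const i"
| "comp_aexp Size = Load (Const 0)"
| "comp_aexp (Ctr c) = Load (addr_expr c (Const 0))"
| "comp_aexp (Cell a e) = Load (addr_expr (32 + a) (comp_aexp e))"
| "comp_aexp (Plus e f) = Add (comp_aexp e) (comp_aexp f)"
| "comp_aexp (Minus e f) = Sub (comp_aexp e) (comp_aexp f)"
| "comp_aexp (Times e f) = Mul (comp_aexp e) (comp_aexp f)"

definition guard_get :: "aexp \<Rightarrow> expr" where
  "guard_get f = Sub (Mul (Const 832) (Mul (Load (Const 0)) (Load (Const 0)))) (comp_aexp f)"

fun compile :: "prog \<Rightarrow> com" where
  "compile Nop = Skip"
| "compile (Put a e f) = Store (addr_expr (32 + a) (comp_aexp e)) (comp_aexp f)"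
| "compile (Get a e f) = If (guard_get f)
     (Store (addr_expr (32 + a) (comp_aexp e)) (Load (comp_aexp f))) Skip"
| "compile (Emit e f) = If (comp_aexp e)
     (If (Sub (Load (Const 0)) (comp_aexp e)) (Store (comp_aexp e) (comp_aexp f)) Skip) Skip"
| "compile (Then P Q) = Seq (compile P) (compile Q)"
| "compile (Cond e P Q) = If (comp_aexp e) (compile P) (compile Q)"
| "compile (For c P) = Seq (Store (addr_expr c (Const 0)) (Const 0))
     (While (Sub (Load (Const 0)) (Load (addr_expr c (Const 0))))
        (Seq (compile P)
          (Store (addr_expr c (Const 0)) (Add (Load (addr_expr c (Const 0))) (Const 1)))))"

definition represents :: "nat \<Rightarrow> state \<Rightarrow> store \<Rightarrow> bool" where
  "represents n s M \<longleftrightarrow> n \<ge> 1 \<and> raw s 0 = int n \<and> (\<forall>i<input_cells n. M i = raw s i) \<and>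
     (\<forall>c<32. M (addr n c 0) = int (ctr s c)) \<and> (\<forall>a<32. \<forall>i. M (addr n (32 + a) i) = arr s a i)"

lemma represents_0: "represents n s M \<Longrightarrow> M 0 = int n"
  by (auto simp: represents_def input_cells_def)

lemma val_addr_expr:
  assumes "represents n s M" "val e M = int i"
  shows "nat (val (addr_expr k e) M) = addr n k i"
proof -
  have "val (addr_expr k e) M = int (addr n k i)"
    using assms represents_0[OF assms(1)] by (simp add: addr_expr_def addr_def)
  then show ?thesis by simp
qed

lemma val_comp_aexp:
  assumes "represents n s M" "wf_aexp e"
  shows "val (comp_aexp e) M = aval n e s"
  using assms(2)
proof (induction e)
  case Size
  then show ?case using represents_0[OF assms(1)] by simp
next
  case (Ctr c)
  then show ?case using val_addr_expr[OF assms(1), of "Const 0" 0 c] assms(1) by (simp add: represents_def)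
next
  case (Cell a e)
  then have "val (comp_aexp e) M = int (nat (aval n e s))" using nonneg_aval[of e n s] by simp
  from val_addr_expr[OF assms(1) this, of "32 + a"] show ?case
    using Cell.prems assms(1) by (simp add: represents_def)
qed auto

lemma represents_put:
  assumes "represents n s M" "a < 32"
  shows "represents n (put a i v s) (M(addr n (32 + a) i := v))"
proof -
  have "addr n (32 + a) i \<noteq> j" if "j < input_cells n" for j
    using addr_ge[of n "32 + a" i] that by simp
  moreover have "addr n c 0 \<noteq> addr n (32 + a) i" if "c < 32" for c
    using addr_inj[of c "32 + a"] assms(2) that by simp
  moreover have "addr n (32 + a') i' = addr n (32 + a) i \<longleftrightarrow> a' = a \<and> i' = i" if "a' < 32" for a' i'
    using addr_inj[of "32 + a'" "32 + a" n i' i] assms(2) that by simp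
  ultimately show ?thesis using assms unfolding represents_def by (auto simp: fun_upd_apply)
qed

lemma represents_set_ctr:
  assumes "represents n s M" "c < 32"
  shows "represents n (set_ctr c k s) (M(addr n c 0 := int k))"
proof -
  have "addr n c 0 \<noteq> j" if "j < input_cells n" for j
    using addr_ge[of n c 0] that by simp
  moreover have "addr n (32 + a) i \<noteq> addr n c 0" if "a < 32" for a i
    using addr_inj[of "32 + a" c] assms(2) that by simp
  moreover have "addr n c' 0 = addr n c 0 \<longleftrightarrow> c' = c" if "c' < 32" for c'
    using addr_inj[of c' c n 0 0] assms(2) that by simp
  ultimately show ?thesis using assms unfolding represents_def by (auto simp: fun_upd_apply)
qed

lemma represents_emit:
  assumes "represents n s M" "0 < i" "i < n"
  shows "represents n (s\<lparr>raw := (raw s)(i := v)\<rparr>) (M(i := v))"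
proof -
  have "n * 1 \<le> n * (832 * n)" using assms(3) by (intro mult_le_mono) auto
  moreover have "input_cells n = n * (832 * n)" by (simp add: input_cells_def)
  ultimately have "i < input_cells n" using assms(3) by linarith
  then have "addr n k j \<noteq> i" for k j using addr_ge[of n k j] by simp
  then show ?thesis using assms unfolding represents_def by (auto simp: fun_upd_apply)
qed

section \<open>Cost of compiled programs\<close>

definition bounded_by :: "nat \<Rightarrow> store \<Rightarrow> bool" where
  "bounded_by b M \<longleftrightarrow> (\<forall>i. \<bar>M i\<bar> < 2 ^ b)"

lemma bounded_by_mono: "bounded_by b M \<Longrightarrow> b \<le> b' \<Longrightarrow> bounded_by b' M"
  unfolding bounded_by_def by (meson less_le_trans one_le_numeral power_increasing)

lemma bits_le: "\<bar>i\<bar> < 2 ^ k \<Longrightarrow> bits i \<le> Suc k"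
proof -
  assume "\<bar>i\<bar> < 2 ^ k"
  then have "nat \<bar>i\<bar> < 2 ^ k" by (simp add: nat_less_iff)
  then show "bits i \<le> Suc k" by (simp add: bits_def floorlog_le_iff)
qed

lemma less_two_power_bits: "\<bar>i\<bar> < 2 ^ bits i"
proof -
  have "nat \<bar>i\<bar> < 2 ^ floorlog 2 (nat \<bar>i\<bar>)"
    using floorlog_bounds[of "nat \<bar>i\<bar>" 2] by (cases "i = 0") (auto simp: floorlog_def)
  then have "\<bar>i\<bar> < 2 ^ floorlog 2 (nat \<bar>i\<bar>)" by (simp add: nat_less_iff)
  also have "\<dots> \<le> 2 ^ bits i" by (simp add: bits_def)
  finally show ?thesis .
qed

fun div_free :: "expr \<Rightarrow> bool" where
  "div_free (Const i) \<longleftrightarrow> True"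
| "div_free (Load e) \<longleftrightarrow> div_free e"
| "div_free (Add e f) \<longleftrightarrow> div_free e \<and> div_free f"
| "div_free (Sub e f) \<longleftrightarrow> div_free e \<and> div_free f"
| "div_free (Mul e f) \<longleftrightarrow> div_free e \<and> div_free f"
| "div_free (Div e f) \<longleftrightarrow> False"

text \<open>A width in multiples of \<open>b + 1\<close> for a memory of \<open>b\<close>-bit cells.
  Products add such multiples, which is harmless for costs. Stored values are measured by
  \<open>growth\<close> instead, a number of bits added to \<open>b\<close>, since multiples would
  compound over a loop.\<close>

fun val_width :: "expr \<Rightarrow> nat" where
  "val_width (Const i) = bits i"
| "val_width (Load e) = 1"
| "val_width (Add e f) = val_width e + val_width f + 1"
| "val_width (Sub e f) = val_width e + val_width f + 1"
| "val_width (Mul e f) = val_width e + val_width f"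
| "val_width (Div e f) = 0"

fun cost_width :: "expr \<Rightarrow> nat" where
  "cost_width (Const i) = bits i"
| "cost_width (Load e) = cost_width e + 1"
| "cost_width (Add e f) = cost_width e + cost_width f + val_width (Add e f) + 1"
| "cost_width (Sub e f) = cost_width e + cost_width f + val_width (Sub e f) + 1"
| "cost_width (Mul e f) = cost_width e + cost_width f + val_width (Mul e f) + 1"
| "cost_width (Div e f) = 0"

fun additive :: "expr \<Rightarrow> bool" where
  "additive (Const i) \<longleftrightarrow> True"
| "additive (Load e) \<longleftrightarrow> True"
| "additive (Add e f) \<longleftrightarrow> additive e \<and> additive f"
| "additive (Sub e f) \<longleftrightarrow> additive e \<and> additive f"
| "additive _ \<longleftrightarrow> False"

fun growth :: "expr \<Rightarrow> nat" where
  "growth (Const i) = bits i"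
| "growth (Load e) = 0"
| "growth (Add e f) = growth e + growth f + 1"
| "growth (Sub e f) = growth e + growth f + 1"
| "growth _ = 0"

lemma two_power_add:
  fixes a b :: int
  assumes "\<bar>a\<bar> < 2 ^ x" "\<bar>b\<bar> < 2 ^ y" "x \<le> z" "y \<le> z"
  shows "\<bar>a + b\<bar> < 2 ^ (z + 1)" "\<bar>a - b\<bar> < 2 ^ (z + 1)"
proof -
  have "(2::int) ^ x \<le> 2 ^ z" "(2::int) ^ y \<le> 2 ^ z" using assms by simp_all
  then show "\<bar>a + b\<bar> < 2 ^ (z + 1)" "\<bar>a - b\<bar> < 2 ^ (z + 1)"
    unfolding power_add power_one_right using assms(1,2) by linarith+
qed

lemma val_bound:
  assumes "bounded_by b M" "div_free e"
  shows "\<bar>val e M\<bar> < 2 ^ (val_width e * (b + 1))"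
  using assms(2)
proof (induction e)
  case (Const i)
  have "\<bar>i\<bar> < 2 ^ bits i" by (rule less_two_power_bits)
  also have "\<dots> \<le> 2 ^ (bits i * (b + 1))" by (intro power_increasing) auto
  finally show ?case by simp
next
  case (Load e)
  have "\<bar>M (nat (val e M))\<bar> < 2 ^ b" using assms(1) by (simp add: bounded_by_def)
  also have "\<dots> \<le> 2 ^ (b + 1)" by simp
  finally show ?case by simp
next
  case (Add e f)
  let ?z = "(val_width e + val_width f) * (b + 1)"
  have "\<bar>val e M + val f M\<bar> < 2 ^ (?z + 1)"
    using Add by (intro two_power_add(1)[of _ "val_width e * (b + 1)" _ "val_width f * (b + 1)"] mult_right_mono) auto
  also have "\<dots> \<le> 2 ^ (val_width (Add e f) * (b + 1))" by (intro power_increasing) auto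
  finally show ?case by simp
next
  case (Sub e f)
  let ?z = "(val_width e + val_width f) * (b + 1)"
  have "\<bar>val e M - val f M\<bar> < 2 ^ (?z + 1)"
    using Sub by (intro two_power_add(2)[of _ "val_width e * (b + 1)" _ "val_width f * (b + 1)"] mult_right_mono) auto
  also have "\<dots> \<le> 2 ^ (val_width (Sub e f) * (b + 1))" by (intro power_increasing) auto
  finally show ?case by simp
next
  case (Mul e f)
  have "\<bar>val e M\<bar> * \<bar>val f M\<bar> < 2 ^ (val_width e * (b + 1)) * 2 ^ (val_width f * (b + 1))"
    using Mul by (intro mult_strict_mono') auto
  then show ?case by (simp add: abs_mult power_add[symmetric] add_mult_distrib add_ac)
qed simp

lemma cost_bound:
  assumes "bounded_by b M" "div_free e"
  shows "cost e M \<le> cost_width e * (b + 1)"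
  using assms(2)
proof (induction e)
  case (Load e)
  have "\<bar>M (nat (val e M))\<bar> < 2 ^ b" using assms(1) by (simp add: bounded_by_def)
  then show ?case using Load bits_le[of "M (nat (val e M))" b] by simp
next
  case (Add e f)
  then show ?case using bits_le[OF val_bound[OF assms(1), of "Add e f"]] by (simp add: algebra_simps)
next
  case (Sub e f)
  then show ?case using bits_le[OF val_bound[OF assms(1), of "Sub e f"]] by (simp add: algebra_simps)
next
  case (Mul e f)
  then show ?case using bits_le[OF val_bound[OF assms(1), of "Mul e f"]] by (simp add: algebra_simps)
qed auto

lemma additive_bound:
  assumes "bounded_by b M" "additive e"
  shows "\<bar>val e M\<bar> < 2 ^ (b + growth e)"
  using assms(2)
proof (induction e)
  case (Const i)
  have "\<bar>i\<bar> < 2 ^ bits i" by (rule less_two_power_bits)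
  also have "\<dots> \<le> 2 ^ (b + bits i)" by (intro power_increasing) auto
  finally show ?case by simp
next
  case (Load e)
  then show ?case using assms(1) by (simp add: bounded_by_def)
next
  case (Add e f)
  then show ?case
    using two_power_add(1)[of "val e M" "b + growth e" "val f M" "b + growth f" "b + growth e + growth f"]
    by (simp add: add.assoc)
next
  case (Sub e f)
  then show ?case
    using two_power_add(2)[of "val e M" "b + growth e" "val f M" "b + growth f" "b + growth e + growth f"]
    by (simp add: add.assoc)
qed auto

lemma comp_aexp_div_free [simp]: "div_free (comp_aexp e)"
  by (induction e) (auto simp: addr_expr_def)

lemma addr_expr_div_free [simp]: "div_free (addr_expr k e) \<longleftrightarrow> div_free e"
  by (simp add: addr_expr_def)

lemma comp_aexp_additive: "linear e \<Longrightarrow> additive (comp_aexp e)"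
  by (induction e) auto

lemma run_Skip_Suc: "run Skip M M (Suc 0)"
  using run_Skip by simp

definition store_cost :: "expr \<Rightarrow> expr \<Rightarrow> nat" where
  "store_cost e f = 1 + cost_width e + cost_width f"

lemma run_store_bounded:
  assumes b: "bounded_by b M" and e: "div_free e" and f: "div_free f" "additive f"
    and i: "nat (val e M) = i" and v: "val f M = v"
  shows "\<exists>t. run (Store e f) M (M(i := v)) t \<and> t \<le> store_cost e f * (b + growth f + 1) \<and>
    bounded_by (b + growth f) (M(i := v))"
proof (intro exI conjI)
  show "run (Store e f) M (M(i := v)) (1 + cost e M + cost f M)"
    using run_Store[of e f M] i v by simp
  have "1 + cost e M + cost f M \<le> store_cost e f * (b + 1)"
    using cost_bound[OF b e] cost_bound[OF b f(1)] by (simp add: store_cost_def algebra_simps)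
  also have "\<dots> \<le> store_cost e f * (b + growth f + 1)" by (intro mult_left_mono) auto
  finally show "1 + cost e M + cost f M \<le> store_cost e f * (b + growth f + 1)" .
  have "\<bar>v\<bar> < 2 ^ (b + growth f)" using additive_bound[OF b f(2)] v by simp
  then show "bounded_by (b + growth f) (M(i := v))"
    using bounded_by_mono[OF b, of "b + growth f"] by (auto simp: bounded_by_def)
qed

abbreviation ctr_addr :: "nat \<Rightarrow> expr" where "ctr_addr c \<equiv> addr_expr c (Const 0)"
abbreviation incr :: "nat \<Rightarrow> expr" where "incr c \<equiv> Add (Load (ctr_addr c)) (Const 1)"
abbreviation for_test :: "nat \<Rightarrow> expr" where "for_test c \<equiv> Sub (Load (Const 0)) (Load (ctr_addr c))"

fun width_poly :: "prog \<Rightarrow> nat poly" where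
  "width_poly Nop = 0"
| "width_poly (Put a e f) = [:growth (comp_aexp f):]"
| "width_poly (Get a e f) = 0"
| "width_poly (Emit e f) = [:growth (comp_aexp f):]"
| "width_poly (Then P Q) = width_poly P + width_poly Q"
| "width_poly (Cond e P Q) = width_poly P + width_poly Q"
| "width_poly (For c P) = [:growth (Const 0):] + [:0, 1:] * (width_poly P + [:growth (incr c):])"

text \<open>Cost per bit of memory width: in \<open>simulates\<close> the width is a separate
  factor, with the bound valid after the run used throughout. A conditional is charged for both
  branches, a loop for n + 1 tests.\<close>

fun time_poly :: "prog \<Rightarrow> nat poly" where
  "time_poly Nop = 1"
| "time_poly (Put a e f) = [:store_cost (addr_expr (32 + a) (comp_aexp e)) (comp_aexp f):]"
| "time_poly (Get a e f) = [:2 + cost_width (guard_get f)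
     + store_cost (addr_expr (32 + a) (comp_aexp e)) (Load (comp_aexp f)):]"
| "time_poly (Emit e f) = [:3 + cost_width (comp_aexp e) + cost_width (Sub (Load (Const 0)) (comp_aexp e))
     + store_cost (comp_aexp e) (comp_aexp f):]"
| "time_poly (Then P Q) = time_poly P + time_poly Q"
| "time_poly (Cond e P Q) = [:1 + cost_width (comp_aexp e):] + time_poly P + time_poly Q"
| "time_poly (For c P) = [:store_cost (ctr_addr c) (Const 0) + 1 + cost_width (for_test c):]
     + [:0, 1:] * (time_poly P + [:store_cost (ctr_addr c) (incr c) + 1 + cost_width (for_test c):])"

definition simulates :: "nat \<Rightarrow> prog \<Rightarrow> bool" where
  "simulates n P \<longleftrightarrow> (\<forall>s M b. represents n s M \<longrightarrow> bounded_by b M \<longrightarrow>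
     (\<exists>M' t. run (compile P) M M' t \<and> represents n (sem n P s) M' \<and>
        bounded_by (b + poly (width_poly P) n) M' \<and>
        t \<le> poly (time_poly P) n * (b + poly (width_poly P) n + 1)))"

lemma simulates_for:
  assumes P: "simulates n P" and c: "c < 32" "c \<notin> counters P"
  shows "simulates n (For c P)"
  unfolding simulates_def
proof (intro allI impI)
  fix s M b assume rep: "represents n s M" and bd: "bounded_by b M"
  define g where "g = poly (width_poly P) n + growth (incr c)"
  define k0 where "k0 = 1 + cost_width (for_test c)"
  define h where "h = poly (time_poly P) n + store_cost (ctr_addr c) (incr c) + k0"
  define b0 where "b0 = b + growth (Const 0)"
  let ?body = "Seq (compile P) (Store (ctr_addr c) (incr c))"
  have test: "val (for_test c) M > 0 \<longleftrightarrow> ctr s c < n" if "represents n s M" for s M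
  proof -
    have "val (Load (ctr_addr c)) M = int (ctr s c)"
      using val_comp_aexp[OF that, of "Ctr c"] c by simp
    then show ?thesis using represents_0[OF that] by simp
  qed
  \<comment> \<open>Induction on the number \<open>r\<close> of rounds still to run, with the width
    \<open>b\<close> arbitrary, because each round may hand over a memory that is \<open>g\<close>
    bits wider.\<close>
  have loop: "\<exists>M' t. run (While (for_test c) ?body) M M' t \<and>
      represents n (for_loop c (sem n P) n s) M' \<and> bounded_by (b + r * g) M' \<and>
      t \<le> (r * h + k0) * (b + r * g + 1)"
    if "represents n (for_loop c (sem n P) (n - r) s) M" "bounded_by b M" "r \<le> n" for r M b
    using that
  proof (induction r arbitrary: M b)
    case 0
    have "\<not> val (for_test c) M > 0"
      using test[OF 0(1)] by (simp add: for_loop_ctr)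
    then have "run (While (for_test c) ?body) M M (1 + cost (for_test c) M)"
      by (rule run_WhileFalse)
    moreover have "1 + cost (for_test c) M \<le> k0 * (b + 1)"
      using cost_bound[OF 0(2), of "for_test c"] by (simp add: k0_def)
    ultimately show ?case using 0 by (intro exI[of _ M] exI[of _ "1 + cost (for_test c) M"]) simp
  next
    case (Suc r)
    define s1 where "s1 = for_loop c (sem n P) (n - Suc r) s"
    have cs1: "ctr s1 c = n - Suc r" by (simp add: s1_def for_loop_ctr)
    have rep1: "represents n s1 M" using Suc.prems(1) by (simp add: s1_def)
    have pos: "val (for_test c) M > 0" using test[OF rep1] Suc.prems(3) cs1 by simp
    obtain M1 t1 where 1: "run (compile P) M M1 t1" "represents n (sem n P s1) M1"
      "bounded_by (b + poly (width_poly P) n) M1"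
      "t1 \<le> poly (time_poly P) n * (b + poly (width_poly P) n + 1)"
      using P rep1 Suc.prems(2) unfolding simulates_def by blast
    have c1: "ctr (sem n P s1) c = n - Suc r" using ctr_frame[OF c(2)] cs1 by simp
    have "val (incr c) M1 = int (Suc (n - Suc r))"
      using val_comp_aexp[OF 1(2), of "Ctr c"] c c1 by simp
    moreover have "Suc (n - Suc r) = n - r" using Suc.prems(3) by simp
    ultimately have vi: "val (incr c) M1 = int (n - r)" by simp
    define M2 where "M2 = M1(addr n c 0 := int (n - r))"
    obtain t2 where 2: "run (Store (ctr_addr c) (incr c)) M1 M2 t2"
      "t2 \<le> store_cost (ctr_addr c) (incr c) * (b + g + 1)" "bounded_by (b + g) M2"
      using run_store_bounded[OF 1(3), of "ctr_addr c" "incr c" "addr n c 0" "int (n - r)"]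
        val_addr_expr[OF 1(2), of "Const 0" 0 c] vi
      by (auto simp: M2_def g_def add.assoc)
    have "for_loop c (sem n P) (n - r) s = set_ctr c (n - r) (sem n P s1)"
      using \<open>Suc (n - Suc r) = n - r\<close> unfolding s1_def by (metis for_loop.simps(2))
    then have rep2: "represents n (for_loop c (sem n P) (n - r) s) M2"
      using represents_set_ctr[OF 1(2) c(1)] by (simp add: M2_def)
    obtain M3 t3 where 3: "run (While (for_test c) ?body) M2 M3 t3"
      "represents n (for_loop c (sem n P) n s) M3" "bounded_by (b + g + r * g) M3"
      "t3 \<le> (r * h + k0) * (b + g + r * g + 1)"
      using Suc.IH[OF rep2 2(3)] Suc.prems(3) by auto
    let ?B = "b + Suc r * g + 1"
    have "run (While (for_test c) ?body) M M3 (1 + cost (for_test c) M + (t1 + t2) + t3)"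
      by (rule run_WhileTrue[OF pos run_Seq[OF 1(1) 2(1)] 3(1)])
    moreover have "1 + cost (for_test c) M + (t1 + t2) + t3 \<le> (Suc r * h + k0) * ?B"
    proof -
      have "1 + cost (for_test c) M \<le> k0 * (b + 1)"
        using cost_bound[OF Suc.prems(2), of "for_test c"] by (simp add: k0_def)
      also have "\<dots> \<le> k0 * ?B" by (intro mult_left_mono) auto
      finally have a0: "1 + cost (for_test c) M \<le> k0 * ?B" .
      have a1: "t1 \<le> poly (time_poly P) n * ?B"
        by (rule order_trans[OF 1(4)], rule mult_left_mono) (auto simp: g_def)
      have a2: "t2 \<le> store_cost (ctr_addr c) (incr c) * ?B"
        by (rule order_trans[OF 2(2)], rule mult_left_mono) auto
      have a3: "t3 \<le> (r * h + k0) * ?B" using 3(4) by (simp add: add.assoc)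
      have "h * ?B = poly (time_poly P) n * ?B + store_cost (ctr_addr c) (incr c) * ?B + k0 * ?B"
        by (simp only: h_def add_mult_distrib)
      moreover have "(Suc r * h + k0) * ?B = h * ?B + (r * h + k0) * ?B"
        by (simp only: mult_Suc add_mult_distrib add.assoc)
      ultimately show ?thesis using a0 a1 a2 a3 by linarith
    qed
    ultimately show ?case using 3(2,3) by (intro exI conjI) (auto simp: add.assoc)
  qed
  define M0 where "M0 = M(addr n c 0 := 0)"
  obtain t0 where t0: "run (Store (ctr_addr c) (Const 0)) M M0 t0"
    "t0 \<le> store_cost (ctr_addr c) (Const 0) * (b0 + 1)" "bounded_by b0 M0"
    using run_store_bounded[OF bd, of "ctr_addr c" "Const 0" "addr n c 0" 0]
      val_addr_expr[OF rep, of "Const 0" 0 c] by (auto simp: M0_def b0_def)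
  have "represents n (for_loop c (sem n P) (n - n) s) M0"
    using represents_set_ctr[OF rep c(1), of 0] by (simp add: M0_def)
  from loop[OF this t0(3) order_refl] obtain M' t where
    run: "run (While (for_test c) ?body) M0 M' t" "represents n (for_loop c (sem n P) n s) M'"
    "bounded_by (b0 + n * g) M'" "t \<le> (n * h + k0) * (b0 + n * g + 1)" by blast
  have w: "poly (width_poly (For c P)) n = growth (Const 0) + n * g" by (simp add: g_def)
  have tp: "poly (time_poly (For c P)) n = store_cost (ctr_addr c) (Const 0) + k0 + n * h"
    by (simp add: h_def k0_def)
  show "\<exists>M' t. run (compile (For c P)) M M' t \<and> represents n (sem n (For c P) s) M' \<and>
        bounded_by (b + poly (width_poly (For c P)) n) M' \<and>
        t \<le> poly (time_poly (For c P)) n * (b + poly (width_poly (For c P)) n + 1)"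
  proof (intro exI conjI)
    show "run (compile (For c P)) M M' (t0 + t)"
      unfolding compile.simps by (rule run_Seq[OF t0(1) run(1)])
    show "represents n (sem n (For c P) s) M'" using run(2) by simp
    show "bounded_by (b + poly (width_poly (For c P)) n) M'"
      using run(3) unfolding w b0_def by (simp add: add.assoc)
    have "t0 \<le> store_cost (ctr_addr c) (Const 0) * (b0 + n * g + 1)"
      by (rule order_trans[OF t0(2)], rule mult_left_mono) auto
    then have "t0 + t \<le> (store_cost (ctr_addr c) (Const 0) + k0 + n * h) * (b0 + n * g + 1)"
      using run(4) by (simp add: add_mult_distrib)
    then show "t0 + t \<le> poly (time_poly (For c P)) n * (b + poly (width_poly (For c P)) n + 1)"
      unfolding tp w b0_def by (simp only: add.assoc)
  qed
qed

lemma run_if_bounded: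
  assumes b: "bounded_by b M" and e: "div_free e" and r: "run (if val e M > 0 then P else Q) M M' t"
    and t: "t \<le> k * (b' + 1)" and bb: "b \<le> b'"
  shows "\<exists>t'. run (If e P Q) M M' t' \<and> t' \<le> (1 + cost_width e + k) * (b' + 1)"
proof (intro exI conjI)
  show "run (If e P Q) M M' (1 + cost e M + t)"
    using r run_IfTrue[of e M P M' t Q] run_IfFalse[of e M Q M' t P] by (cases "val e M > 0") simp_all
  have "cost e M \<le> cost_width e * (b' + 1)"
    using cost_bound[OF b e] mult_left_mono[of "b + 1" "b' + 1" "cost_width e"] bb by linarith
  then show "1 + cost e M + t \<le> (1 + cost_width e + k) * (b' + 1)"
    using t by (simp add: algebra_simps)
qed

theorem wf_prog_simulates: "wf_prog P \<Longrightarrow> simulates n P"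
proof (induction P)
  case Nop
  show ?case unfolding simulates_def by (auto intro!: exI[of _ "Suc 0"] run_Skip_Suc)
next
  case (Put a e f)
  show ?case unfolding simulates_def
  proof (intro allI impI)
    fix s M b assume rep: "represents n s M" and bd: "bounded_by b M"
    have e: "val (comp_aexp e) M = int (nat (aval n e s))"
      using val_comp_aexp[OF rep, of e] Put nonneg_aval[of e n s] by simp
    have f: "val (comp_aexp f) M = aval n f s" using val_comp_aexp[OF rep] Put by simp
    from run_store_bounded[OF bd _ _ _ val_addr_expr[OF rep e] f, of "32 + a"]
    show "\<exists>M' t. run (compile (Put a e f)) M M' t \<and> represents n (sem n (Put a e f) s) M' \<and>
        bounded_by (b + poly (width_poly (Put a e f)) n) M' \<and>
        t \<le> poly (time_poly (Put a e f)) n * (b + poly (width_poly (Put a e f)) n + 1)"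
      using represents_put[OF rep, of a "nat (aval n e s)" "aval n f s"] Put
      by (auto simp: comp_aexp_additive)
  qed
next
  case (Get a e f)
  show ?case unfolding simulates_def
  proof (intro allI impI)
    fix s M b assume rep: "represents n s M" and bd: "bounded_by b M"
    have e: "val (comp_aexp e) M = int (nat (aval n e s))"
      using val_comp_aexp[OF rep, of e] Get nonneg_aval[of e n s] by simp
    have f: "val (comp_aexp f) M = aval n f s" using val_comp_aexp[OF rep] Get by simp
    have f0: "0 \<le> aval n f s" using Get nonneg_aval[of f n s] by simp
    let ?st = "Store (addr_expr (32 + a) (comp_aexp e)) (Load (comp_aexp f))"
    let ?k = "store_cost (addr_expr (32 + a) (comp_aexp e)) (Load (comp_aexp f))"
    have g: "val (guard_get f) M > 0 \<longleftrightarrow> aval n f s < int (input_cells n)"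
      using f represents_0[OF rep] by (simp add: guard_get_def input_cells_def mult.assoc)
    have df: "div_free (guard_get f)" by (simp add: guard_get_def)
    have "\<exists>M' t. run (if val (guard_get f) M > 0 then ?st else Skip) M M' t \<and>
      represents n (sem n (Get a e f) s) M' \<and> bounded_by b M' \<and> t \<le> (1 + ?k) * (b + 1)"
    proof (cases "val (guard_get f) M > 0")
      case True
      then have lt: "aval n f s < int (input_cells n)" using g by simp
      then have "nat (aval n f s) < input_cells n" using f0 by (simp add: nat_less_iff)
      then have v: "val (Load (comp_aexp f)) M = raw s (nat (aval n f s))"
        using rep f by (simp add: represents_def)
      from run_store_bounded[OF bd _ _ _ val_addr_expr[OF rep e] v, of "32 + a"] obtain t where
        "run ?st M (M(addr n (32 + a) (nat (aval n e s)) := raw s (nat (aval n f s)))) t"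
        "t \<le> ?k * (b + 1)" "bounded_by b (M(addr n (32 + a) (nat (aval n e s)) := raw s (nat (aval n f s))))"
        by auto
      then show ?thesis
        using represents_put[OF rep, of a "nat (aval n e s)" "raw s (nat (aval n f s))"] Get lt True
        by (intro exI conjI) auto
    next
      case False
      then have "sem n (Get a e f) s = s" using g by simp
      then show ?thesis using False rep bd
        by (intro exI[of _ M] exI[of _ "1::nat"]) (auto intro: run_Skip_Suc)
    qed
    then obtain M' t where r: "run (if val (guard_get f) M > 0 then ?st else Skip) M M' t"
      "represents n (sem n (Get a e f) s) M'" "bounded_by b M'" "t \<le> (1 + ?k) * (b + 1)" by blast
    obtain t' where t': "run (compile (Get a e f)) M M' t'"
      "t' \<le> (1 + cost_width (guard_get f) + (1 + ?k)) * (b + 1)"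
      using run_if_bounded[OF bd df r(1) r(4) order_refl] by auto
    have "poly (time_poly (Get a e f)) n = 1 + cost_width (guard_get f) + (1 + ?k)"
      "poly (width_poly (Get a e f)) n = 0" by simp_all
    then show "\<exists>M' t. run (compile (Get a e f)) M M' t \<and> represents n (sem n (Get a e f) s) M' \<and>
        bounded_by (b + poly (width_poly (Get a e f)) n) M' \<and>
        t \<le> poly (time_poly (Get a e f)) n * (b + poly (width_poly (Get a e f)) n + 1)"
      using t' r(2,3) by (intro exI[of _ M'] exI[of _ t']) (simp only: add_0_right)
  qed
next
  case (Emit e f)
  show ?case unfolding simulates_def
  proof (intro allI impI)
    fix s M b assume rep: "represents n s M" and bd: "bounded_by b M"
    let ?B = "b + growth (comp_aexp f)"
    have e: "val (comp_aexp e) M = aval n e s" using val_comp_aexp[OF rep] Emit by simp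
    have f: "val (comp_aexp f) M = aval n f s" using val_comp_aexp[OF rep] Emit by simp
    have M0: "M 0 = int n" by (rule represents_0[OF rep])
    let ?st = "Store (comp_aexp e) (comp_aexp f)" and ?k = "store_cost (comp_aexp e) (comp_aexp f)"
    let ?t2 = "Sub (Load (Const 0)) (comp_aexp e)"
    let ?goal = "\<lambda>M'. represents n (sem n (Emit e f) s) M' \<and> bounded_by ?B M'"
    have bB: "bounded_by ?B M" by (rule bounded_by_mono[OF bd]) simp
    have "\<exists>M' t. run (if val (comp_aexp e) M > 0 then If ?t2 ?st Skip else Skip) M M' t \<and> ?goal M'
        \<and> t \<le> (1 + cost_width ?t2 + (1 + ?k)) * (?B + 1)"
    proof (cases "val (comp_aexp e) M > 0")
      case True
      have "\<exists>M' t. run (if val ?t2 M > 0 then ?st else Skip) M M' t \<and> ?goal M' \<and> t \<le> (1 + ?k) * (?B + 1)"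
      proof (cases "val ?t2 M > 0")
        case T2: True
        let ?M = "M(nat (aval n e s) := aval n f s)"
        obtain t where t: "run ?st M ?M t" "t \<le> ?k * (?B + 1)" "bounded_by ?B ?M"
          using run_store_bounded[OF bd _ _ _ _ f, of "comp_aexp e" "nat (aval n e s)"] e Emit
          by (auto simp: comp_aexp_additive)
        have "represents n (s\<lparr>raw := (raw s)(nat (aval n e s) := aval n f s)\<rparr>) ?M"
          using True T2 e M0 by (intro represents_emit[OF rep]) (auto simp: nat_less_iff)
        then show ?thesis using t T2 True e M0
          by (intro exI[of _ ?M] exI[of _ t]) auto
      next
        case False
        then have "sem n (Emit e f) s = s" using e M0 by simp
        then show ?thesis using False rep bB
          by (intro exI[of _ M] exI[of _ "1::nat"]) (auto intro: run_Skip_Suc)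
      qed
      then obtain M' t where r: "run (if val ?t2 M > 0 then ?st else Skip) M M' t" "?goal M'"
        "t \<le> (1 + ?k) * (?B + 1)" by blast
      from run_if_bounded[OF bd _ r(1) r(3)] r(2) show ?thesis
        unfolding if_P[OF True] by (metis comp_aexp_div_free div_free.simps(1,2,4) le_add1)
    next
      case False
      then have "sem n (Emit e f) s = s" using e by simp
      then show ?thesis using False rep bB
        by (intro exI[of _ M] exI[of _ "1::nat"]) (auto intro: run_Skip_Suc)
    qed
    then obtain M' t where r: "run (if val (comp_aexp e) M > 0 then If ?t2 ?st Skip else Skip) M M' t"
      "?goal M'" "t \<le> (1 + cost_width ?t2 + (1 + ?k)) * (?B + 1)" by blast
    obtain t' where t': "run (compile (Emit e f)) M M' t'"
      "t' \<le> (1 + cost_width (comp_aexp e) + (1 + cost_width ?t2 + (1 + ?k))) * (?B + 1)"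
      using run_if_bounded[OF bd comp_aexp_div_free r(1) r(3)] by auto
    have "poly (time_poly (Emit e f)) n = 1 + cost_width (comp_aexp e) + (1 + cost_width ?t2 + (1 + ?k))"
      by simp
    then show "\<exists>M' t. run (compile (Emit e f)) M M' t \<and> represents n (sem n (Emit e f) s) M' \<and>
        bounded_by (b + poly (width_poly (Emit e f)) n) M' \<and>
        t \<le> poly (time_poly (Emit e f)) n * (b + poly (width_poly (Emit e f)) n + 1)"
      using t' r(2) by (intro exI[of _ M'] exI[of _ t']) (simp only: poly_pCons width_poly.simps poly_0 mult_zero_right add_0_right)
  qed
next
  case (Then P Q)
  show ?case unfolding simulates_def
  proof (intro allI impI)
    fix s M b assume rep: "represents n s M" and bd: "bounded_by b M"
    obtain M1 t1 where 1: "run (compile P) M M1 t1" "represents n (sem n P s) M1"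
      "bounded_by (b + poly (width_poly P) n) M1"
      "t1 \<le> poly (time_poly P) n * (b + poly (width_poly P) n + 1)"
      using Then rep bd unfolding simulates_def wf_prog.simps by blast
    obtain M2 t2 where 2: "run (compile Q) M1 M2 t2" "represents n (sem n Q (sem n P s)) M2"
      "bounded_by (b + poly (width_poly P) n + poly (width_poly Q) n) M2"
      "t2 \<le> poly (time_poly Q) n * (b + poly (width_poly P) n + poly (width_poly Q) n + 1)"
      using Then 1 unfolding simulates_def wf_prog.simps by blast
    have "t1 \<le> poly (time_poly P) n * (b + poly (width_poly P) n + poly (width_poly Q) n + 1)"
      by (rule order_trans[OF 1(4)], rule mult_left_mono) auto
    then have "t1 + t2 \<le> poly (time_poly (Then P Q)) n * (b + poly (width_poly (Then P Q)) n + 1)"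
      using 2(4) by (simp add: add_mult_distrib add.assoc)
    moreover have "run (compile (Then P Q)) M M2 (t1 + t2)"
      unfolding compile.simps by (rule run_Seq[OF 1(1) 2(1)])
    ultimately show "\<exists>M' t. run (compile (Then P Q)) M M' t \<and> represents n (sem n (Then P Q) s) M' \<and>
        bounded_by (b + poly (width_poly (Then P Q)) n) M' \<and>
        t \<le> poly (time_poly (Then P Q)) n * (b + poly (width_poly (Then P Q)) n + 1)"
      using 2(2,3) by (intro exI[of _ M2] exI[of _ "t1 + t2"]) (simp add: add.assoc)
  qed
next
  case (Cond e P Q)
  show ?case unfolding simulates_def
  proof (intro allI impI)
    fix s M b assume rep: "represents n s M" and bd: "bounded_by b M"
    have e: "val (comp_aexp e) M = aval n e s" using val_comp_aexp[OF rep] Cond by simp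
    let ?W = "b + poly (width_poly (Cond e P Q)) n"
    have "\<exists>M' t. run (if val (comp_aexp e) M > 0 then compile P else compile Q) M M' t \<and>
      represents n (sem n (Cond e P Q) s) M' \<and> bounded_by ?W M' \<and>
      t \<le> (poly (time_poly P) n + poly (time_poly Q) n) * (?W + 1)"
    proof (cases "val (comp_aexp e) M > 0")
      case True
      obtain M1 t1 where 1: "run (compile P) M M1 t1" "represents n (sem n P s) M1"
        "bounded_by (b + poly (width_poly P) n) M1"
        "t1 \<le> poly (time_poly P) n * (b + poly (width_poly P) n + 1)"
        using Cond rep bd unfolding simulates_def wf_prog.simps by blast
      have "t1 \<le> (poly (time_poly P) n + poly (time_poly Q) n) * (?W + 1)"
        by (rule order_trans[OF 1(4)], rule mult_mono) auto
      moreover have "bounded_by ?W M1" by (rule bounded_by_mono[OF 1(3)]) simp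
      ultimately show ?thesis using 1(1,2) True e by (intro exI[of _ M1] exI[of _ t1]) simp
    next
      case False
      obtain M1 t1 where 1: "run (compile Q) M M1 t1" "represents n (sem n Q s) M1"
        "bounded_by (b + poly (width_poly Q) n) M1"
        "t1 \<le> poly (time_poly Q) n * (b + poly (width_poly Q) n + 1)"
        using Cond rep bd unfolding simulates_def wf_prog.simps by blast
      have "t1 \<le> (poly (time_poly P) n + poly (time_poly Q) n) * (?W + 1)"
        by (rule order_trans[OF 1(4)], rule mult_mono) auto
      moreover have "bounded_by ?W M1" by (rule bounded_by_mono[OF 1(3)]) simp
      ultimately show ?thesis using 1(1,2) False e by (intro exI[of _ M1] exI[of _ t1]) simp
    qed
    then obtain M' t where r: "run (if val (comp_aexp e) M > 0 then compile P else compile Q) M M' t"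
      "represents n (sem n (Cond e P Q) s) M'" "bounded_by ?W M'"
      "t \<le> (poly (time_poly P) n + poly (time_poly Q) n) * (?W + 1)" by blast
    from run_if_bounded[OF bd comp_aexp_div_free r(1) r(4)] obtain t' where
      "run (compile (Cond e P Q)) M M' t'"
      "t' \<le> (1 + cost_width (comp_aexp e) + (poly (time_poly P) n + poly (time_poly Q) n)) * (?W + 1)"
      by auto
    moreover have "poly (time_poly (Cond e P Q)) n
      = 1 + cost_width (comp_aexp e) + (poly (time_poly P) n + poly (time_poly Q) n)" by simp
    ultimately show "\<exists>M' t. run (compile (Cond e P Q)) M M' t \<and> represents n (sem n (Cond e P Q) s) M' \<and>
        bounded_by ?W M' \<and> t \<le> poly (time_poly (Cond e P Q)) n * (?W + 1)"
      using r(2,3) by (intro exI[of _ M'] exI[of _ t']) (simp only:)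
  qed
next
  case (For c P)
  then show ?case by (intro simulates_for) auto
qed

lemma poly_nat_mono: "x \<le> y \<Longrightarrow> poly p x \<le> poly (p :: nat poly) y"
  by (induction p) (auto intro: add_mono mult_mono)

section \<open>The decomposition program\<close>

text \<open>Scalars are kept in cell 0 of an array of their own.\<close>

abbreviation (input) "ADJ \<equiv> 0 :: nat"
abbreviation (input) "XN \<equiv> 1 :: nat"
abbreviation (input) "XD \<equiv> 2 :: nat"
abbreviation (input) "MN \<equiv> 3 :: nat"
abbreviation (input) "MD \<equiv> 4 :: nat"
abbreviation (input) "LAB \<equiv> 5 :: nat"
abbreviation (input) "ZV \<equiv> 6 :: nat"
abbreviation (input) "ZN \<equiv> 7 :: nat"
abbreviation (input) "CUT \<equiv> 8 :: nat"
abbreviation (input) "OUT \<equiv> 9 :: nat"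
abbreviation (input) "DN \<equiv> 10 :: nat"
abbreviation (input) "DD \<equiv> 11 :: nat"
abbreviation (input) "JJ \<equiv> 12 :: nat"
abbreviation (input) "KK \<equiv> 13 :: nat"
abbreviation (input) "LL \<equiv> 14 :: nat"
abbreviation (input) "FOUND \<equiv> 15 :: nat"
abbreviation (input) "MM \<equiv> 16 :: nat"
abbreviation (input) "CC \<equiv> 17 :: nat"
abbreviation (input) "SA \<equiv> 18 :: nat"
abbreviation (input) "ACC \<equiv> 19 :: nat"

abbreviation (input) Var :: "nat \<Rightarrow> aexp" where "Var a \<equiv> Cell a (Num 0)"
abbreviation (input) At :: "nat \<Rightarrow> nat \<Rightarrow> aexp" where "At a c \<equiv> Cell a (Ctr c)"
abbreviation (input) Set :: "nat \<Rightarrow> aexp \<Rightarrow> prog" where "Set a e \<equiv> Put a (Num 0) e"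
abbreviation (input) pair_ix :: "nat \<Rightarrow> nat \<Rightarrow> aexp" where
  "pair_ix c d \<equiv> Plus (Times (Ctr c) Size) (Ctr d)"

text \<open>The machine tests only for positivity; over the integers, adding 1 to a difference turns
  a strict comparison into a weak one.\<close>

definition when_eq :: "aexp \<Rightarrow> aexp \<Rightarrow> prog \<Rightarrow> prog" where
  "when_eq e f P = Cond (Plus (Minus e f) (Num 1)) (Cond (Plus (Minus f e) (Num 1)) P Nop) Nop"

definition when_le :: "aexp \<Rightarrow> aexp \<Rightarrow> prog \<Rightarrow> prog" where
  "when_le e f P = Cond (Plus (Minus f e) (Num 1)) P Nop"

definition when_less :: "aexp \<Rightarrow> aexp \<Rightarrow> prog \<Rightarrow> prog" where
  "when_less e f P = Cond (Minus f e) P Nop"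

lemma when_sem [simp]:
  "sem n (when_eq e f P) s = (if aval n e s = aval n f s then sem n P s else s)"
  "sem n (when_le e f P) s = (if aval n e s \<le> aval n f s then sem n P s else s)"
  "sem n (when_less e f P) s = (if aval n e s < aval n f s then sem n P s else s)"
  by (auto simp: when_eq_def when_le_def when_less_def)

lemma when_sets [simp]:
  "counters (when_eq e f P) = counters P" "counters (when_le e f P) = counters P"
  "counters (when_less e f P) = counters P"
  "writes (when_eq e f P) = writes P" "writes (when_le e f P) = writes P"
  "writes (when_less e f P) = writes P"
  "emits (when_eq e f P) = emits P" "emits (when_le e f P) = emits P"
  "emits (when_less e f P) = emits P"
  by (auto simp: when_eq_def when_le_def when_less_def)

lemma nat_pair_ix [simp]: "nat (int u * int n + int v) = u * n + v"
  by (metis nat_int of_nat_add of_nat_mult)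

definition piece :: "nat \<Rightarrow> state \<Rightarrow> nat set" where
  "piece n s = {u. u < n \<and> arr s LAB u = arr s LL 0}"

definition upper :: "nat \<Rightarrow> state \<Rightarrow> nat \<Rightarrow> nat set" where
  "upper n s w = {u\<in>piece n s. arr s ZV u \<ge> arr s ZV w}"

definition adj_table :: "nat \<Rightarrow> nat set set \<Rightarrow> state \<Rightarrow> bool" where
  "adj_table n E s \<longleftrightarrow> (\<forall>u<n. \<forall>v<n. arr s ADJ (u * n + v) = (if {u, v} \<in> E then 1 else 0))"

lemma finite_piece: "finite (piece n s)" and piece_subset: "piece n s \<subseteq> {..<n}"
  by (auto simp: piece_def)

lemma sum_lessThan_inter:
  fixes f :: "nat \<Rightarrow> int"
  assumes "A \<subseteq> {..<n}"
  shows "(\<Sum>u<n. if u \<in> A then f u else 0) = (\<Sum>u\<in>A. f u)"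
  using assms by (intro sum.mono_neutral_cong_right) auto

section \<open>Counting and testing cuts\<close>

definition count_piece :: prog where
  "count_piece = Then (Set MM (Num 0))
     (For 0 (when_eq (At LAB 0) (Var LL) (Set MM (Plus (Var MM) (Num 1)))))"

lemma count_piece_sets [simp]:
  "counters count_piece = {0}" "writes count_piece = {MM}" "\<not> emits count_piece"
  by (simp_all add: count_piece_def)

lemma count_piece_sem: "arr (sem n count_piece s) MM 0 = int (card (piece n s))"
proof -
  define s0 where "s0 = sem n (Set MM (Num 0)) s"
  have "arr (sem n (For 0 (when_eq (At LAB 0) (Var LL) (Set MM (Plus (Var MM) (Num 1))))) s0) MM 0
    = (\<Sum>u<n. if u \<in> piece n s then 1 else 0)"
  proof (rule for_rule[where I = "\<lambda>k s'. arr s' MM 0 = (\<Sum>u<k. if u \<in> piece n s then 1 else 0)"], goal_cases)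
    case (2 k s')
    have "arr s' LAB = arr s LAB" "arr s' LL = arr s LL" using 2(4) by (auto simp: s0_def)
    then show ?case using 2(1,2,3) by (simp add: piece_def)
  qed (simp add: s0_def)
  also have "\<dots> = (\<Sum>u\<in>piece n s. 1)" by (rule sum_lessThan_inter) (auto simp: piece_def)
  finally show ?thesis by (simp add: count_piece_def s0_def)
qed

text \<open>The threshold is the value at the vertex in counter 17.\<close>

definition count_cut :: prog where
  "count_cut = Then (Set CC (Num 0)) (Then (Set SA (Num 0))
     (For 0 (when_eq (At LAB 0) (Var LL) (when_le (At ZV 17) (At ZV 0)
        (Then (Set SA (Plus (Var SA) (Num 1)))
          (For 1 (when_eq (At LAB 1) (Var LL) (when_less (At ZV 1) (At ZV 17)
            (Set CC (Plus (Var CC) (Cell ADJ (pair_ix 0 1))))))))))))"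

definition mark_cut :: prog where
  "mark_cut = Then (Set FOUND (Num 1))
     (For 0 (Then (Put CUT (Ctr 0) (Num 0)) (when_eq (At LAB 0) (Var LL) (when_le (At ZV 17) (At ZV 0)
        (Put CUT (Ctr 0) (Num 1))))))"

definition test_cut :: prog where
  "test_cut = Then count_cut
     (when_less (Times (Var CC) (Var JJ)) (Times Size (Var SA))
       (when_less (Times (Var CC) (Var JJ)) (Times Size (Minus (Var MM) (Var SA))) mark_cut))"

lemma test_cut_sets [simp]:
  "counters count_cut = {0, 1}" "writes count_cut = {CC, SA}" "\<not> emits count_cut"
  "counters mark_cut = {0}" "writes mark_cut = {FOUND, CUT}" "\<not> emits mark_cut"
  "counters test_cut = {0, 1}" "writes test_cut = {CC, SA, FOUND, CUT}" "\<not> emits test_cut"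
  by (auto simp: count_cut_def mark_cut_def test_cut_def)

lemma count_cut_sem:
  assumes w: "ctr s 17 = w" and adj: "adj_table n E s"
  defines "A \<equiv> upper n s w"
  shows "arr (sem n count_cut s) SA 0 = int (card A)"
    "arr (sem n count_cut s) CC 0 = cut_count E A (piece n s - A)"
proof -
  let ?S = "piece n s"
  have A: "u \<in> A \<longleftrightarrow> u < n \<and> arr s LAB u = arr s LL 0 \<and> arr s ZV w \<le> arr s ZV u" for u
    by (auto simp: A_def upper_def piece_def)
  have SA: "u \<in> ?S - A \<longleftrightarrow> u < n \<and> arr s LAB u = arr s LL 0 \<and> arr s ZV u < arr s ZV w" for u
    unfolding A Diff_iff by (auto simp: piece_def)
  define row where "row u = (\<Sum>v<n. if v \<in> ?S - A then if {u, v} \<in> E then 1 else 0 else (0::int))" for u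
  define inner where "inner = For 1 (when_eq (At LAB 1) (Var LL) (when_less (At ZV 1) (At ZV 17)
            (Set CC (Plus (Var CC) (Cell ADJ (pair_ix 0 1))))))"
  define s0 where "s0 = sem n (Then (Set CC (Num 0)) (Set SA (Num 0))) s"
  have inner: "arr (sem n inner t) CC 0 = arr t CC 0 + row u"
    if fr: "\<And>a. a \<notin> {CC, SA} \<Longrightarrow> arr t a = arr s a" and u: "ctr t 0 = u" "u < n" and tw: "ctr t 17 = w"
    for t u
    unfolding inner_def row_def
  proof (rule for_rule[where I = "\<lambda>k s'. arr s' CC 0 = arr t CC 0 +
      (\<Sum>v<k. if v \<in> ?S - A then if {u, v} \<in> E then 1 else 0 else 0)"], goal_cases)
    case (2 k s')
    have f: "arr s' LAB = arr s LAB" "arr s' LL = arr s LL" "arr s' ZV = arr s ZV" "arr s' ADJ = arr s ADJ"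
      using 2(4) fr by simp_all
    have c: "ctr s' 0 = u" "ctr s' 17 = w" using 2(5) u tw by simp_all
    have "arr s ADJ (u * n + k) = (if {u, k} \<in> E then 1 else 0)"
      using adj u 2(1) by (simp add: adj_table_def)
    then show ?case using 2(1,2,3) by (simp add: f c SA del: Diff_iff)
  qed simp
  have "arr (sem n (For 0 (when_eq (At LAB 0) (Var LL) (when_le (At ZV 17) (At ZV 0)
        (Then (Set SA (Plus (Var SA) (Num 1))) inner)))) s0) SA 0 = (\<Sum>u<n. if u \<in> A then 1 else 0) \<and>
     arr (sem n (For 0 (when_eq (At LAB 0) (Var LL) (when_le (At ZV 17) (At ZV 0)
        (Then (Set SA (Plus (Var SA) (Num 1))) inner)))) s0) CC 0 = (\<Sum>u<n. if u \<in> A then row u else 0)"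
  proof (rule for_rule[where I = "\<lambda>k s'. arr s' SA 0 = (\<Sum>u<k. if u \<in> A then 1 else 0) \<and>
      arr s' CC 0 = (\<Sum>u<k. if u \<in> A then row u else 0)"], goal_cases)
    case (2 k s')
    have w0: "writes inner = {CC}" "counters inner = {1}" by (simp_all add: inner_def)
    have f: "arr s' a = arr s a" if "a \<notin> {CC, SA}" for a
      using 2(4)[of a] that by (simp add: s0_def w0)
    have c: "ctr s' 17 = w" using 2(5)[of 17] w by (simp add: w0 s0_def)
    define t where "t = sem n (Set SA (Plus (Var SA) (Num 1))) s'"
    have "arr (sem n inner t) CC 0 = arr t CC 0 + row k"
      by (rule inner) (use f c 2(1,3) in \<open>auto simp: t_def\<close>)
    moreover have "arr (sem n inner t) SA = arr t SA" by (rule arr_frame) (simp add: w0)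
    ultimately show ?case using 2(1,2,3) f c by (simp add: A t_def)
  qed (simp add: s0_def)
  moreover have "sem n count_cut s = sem n (For 0 (when_eq (At LAB 0) (Var LL) (when_le (At ZV 17) (At ZV 0)
        (Then (Set SA (Plus (Var SA) (Num 1))) inner)))) s0"
    by (simp add: count_cut_def s0_def inner_def)
  ultimately have r: "arr (sem n count_cut s) SA 0 = (\<Sum>u<n. if u \<in> A then 1 else 0)"
    "arr (sem n count_cut s) CC 0 = (\<Sum>u<n. if u \<in> A then row u else 0)" by simp_all
  have An: "A \<subseteq> {..<n}" by (auto simp: A)
  have "row u = (\<Sum>v\<in>?S - A. if {u, v} \<in> E then 1 else 0)" for u
    unfolding row_def by (rule sum_lessThan_inter) (auto simp: piece_def)
  then show "arr (sem n count_cut s) CC 0 = cut_count E A (?S - A)"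
    unfolding r(2) sum_lessThan_inter[OF An] cut_count_def by simp
  show "arr (sem n count_cut s) SA 0 = int (card A)"
    unfolding r(1) sum_lessThan_inter[OF An] by simp
qed

lemma mark_cut_sem:
  assumes w: "ctr s 17 = w"
  shows "arr (sem n mark_cut s) FOUND 0 = 1"
    "\<forall>u<n. arr (sem n mark_cut s) CUT u = (if u \<in> upper n s w then 1 else 0)"
proof -
  define s0 where "s0 = sem n (Set FOUND (Num 1)) s"
  let ?P = "Then (Put CUT (Ctr 0) (Num 0)) (when_eq (At LAB 0) (Var LL) (when_le (At ZV 17) (At ZV 0)
        (Put CUT (Ctr 0) (Num 1))))"
  have "\<forall>u<n. arr (sem n (For 0 ?P) s0) CUT u = (if u \<in> upper n s w then 1 else 0)"
  proof (rule for_rule[where I = "\<lambda>k s'. \<forall>u<k. arr s' CUT u = (if u \<in> upper n s w then 1 else 0)"], goal_cases)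
    case (2 k s')
    have f: "arr s' LAB = arr s LAB" "arr s' LL = arr s LL" "arr s' ZV = arr s ZV"
      using 2(4) by (simp_all add: s0_def)
    have c: "ctr s' 17 = w" using 2(5)[of 17] w by (simp add: s0_def)
    show ?case using 2(1,2,3) by (auto simp: f c upper_def piece_def less_Suc_eq)
  qed simp
  moreover have "arr (sem n (For 0 ?P) s0) FOUND 0 = arr s0 FOUND 0" by (simp add: arr_frame del: sem.simps)
  ultimately show "arr (sem n mark_cut s) FOUND 0 = 1"
    "\<forall>u<n. arr (sem n mark_cut s) CUT u = (if u \<in> upper n s w then 1 else 0)"
    unfolding mark_cut_def by (simp_all add: s0_def)
qed

lemma test_cut_sem:
  assumes w: "ctr s 17 = w" and adj: "adj_table n E s" and M: "arr s MM 0 = int (card (piece n s))"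
    and J: "arr s JJ 0 = int j"
  defines "A \<equiv> upper n s w"
  shows "sparse_cut E n j (piece n s) A \<Longrightarrow> arr (sem n test_cut s) FOUND 0 = 1 \<and>
      (\<forall>u<n. arr (sem n test_cut s) CUT u = (if u \<in> A then 1 else 0))"
    "\<not> sparse_cut E n j (piece n s) A \<Longrightarrow> arr (sem n test_cut s) FOUND = arr s FOUND \<and>
      arr (sem n test_cut s) CUT = arr s CUT"
proof -
  define s1 where "s1 = sem n count_cut s"
  have f: "arr s1 a = arr s a" if "a \<notin> {CC, SA}" for a using that by (simp add: s1_def arr_frame)
  have c: "ctr s1 17 = w" using w by (simp add: s1_def ctr_frame)
  have up: "upper n s1 w = A" by (simp add: A_def upper_def piece_def f)
  have A: "A \<subseteq> piece n s" by (auto simp: A_def upper_def)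
  have v: "arr s1 SA 0 = int (card A)" "arr s1 CC 0 = cut_count E A (piece n s - A)"
    using count_cut_sem[OF w adj] by (simp_all add: s1_def A_def)
  have d: "int (card (piece n s - A)) = int (card (piece n s)) - int (card A)"
    using A finite_piece[of n s] by (simp add: card_Diff_subset finite_subset card_mono of_nat_diff)
  have cond: "aval n (Times (Var CC) (Var JJ)) s1 < aval n (Times Size (Var SA)) s1 \<and>
      aval n (Times (Var CC) (Var JJ)) s1 < aval n (Times Size (Minus (Var MM) (Var SA))) s1
    \<longleftrightarrow> sparse_cut E n j (piece n s) A"
    using A by (simp add: v f M J sparse_cut_def d)
  have eq: "sem n test_cut s = (if sparse_cut E n j (piece n s) A then sem n mark_cut s1 else s1)"
    unfolding cond[symmetric] by (simp add: test_cut_def s1_def)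
  show "sparse_cut E n j (piece n s) A \<Longrightarrow> arr (sem n test_cut s) FOUND 0 = 1 \<and>
      (\<forall>u<n. arr (sem n test_cut s) CUT u = (if u \<in> A then 1 else 0))"
    using mark_cut_sem[OF c] by (simp add: eq up)
  show "\<not> sparse_cut E n j (piece n s) A \<Longrightarrow> arr (sem n test_cut s) FOUND = arr s FOUND \<and>
      arr (sem n test_cut s) CUT = arr s CUT"
    by (simp add: eq f)
qed

text \<open>The product 2 n z is accumulated over the n rounds of the inner loop, since products are
  not stored. New values are collected in \<open>ZN\<close> because the old ones in
  \<open>ZV\<close> are still read.\<close>

definition walk_prog :: prog where
  "walk_prog = Then
     (For 0 (Then (Set ACC (Num 0))
        (Then (For 1 (Then (Set ACC (Plus (Var ACC) (Plus (At ZV 0) (At ZV 0))))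
            (when_eq (At LAB 1) (Var LL) (Cond (Cell ADJ (pair_ix 0 1))
               (Set ACC (Plus (Var ACC) (Minus (At ZV 1) (At ZV 0)))) Nop))))
          (Put ZN (Ctr 0) (Var ACC)))))
     (For 0 (Put ZV (Ctr 0) (At ZN 0)))"

lemma walk_prog_sets [simp]:
  "counters walk_prog = {0, 1}" "writes walk_prog = {ACC, ZN, ZV}" "\<not> emits walk_prog"
  by (auto simp: walk_prog_def)

lemma walk_prog_sem:
  assumes adj: "adj_table n E s" and u: "u < n"
  shows "arr (sem n walk_prog s) ZV u = 2 * int n * arr s ZV u
     - (\<Sum>w\<in>piece n s. if {u, w} \<in> E then arr s ZV u - arr s ZV w else 0)"
proof -
  let ?S = "piece n s"
  define new where "new u = 2 * int n * arr s ZV u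
     - (\<Sum>w\<in>?S. if {u, w} \<in> E then arr s ZV u - arr s ZV w else 0)" for u
  define incr_term where "incr_term u w = 2 * arr s ZV u
     + (if w \<in> ?S then if {u, w} \<in> E then arr s ZV w - arr s ZV u else 0 else 0)" for u w
  have new: "(\<Sum>w<n. incr_term u w) = new u" for u
  proof -
    have "(\<Sum>w<n. incr_term u w) = int n * (2 * arr s ZV u)
      + (\<Sum>w<n. if w \<in> ?S then if {u, w} \<in> E then arr s ZV w - arr s ZV u else 0 else 0)"
      by (simp add: incr_term_def sum.distrib)
    also have "(\<Sum>w<n. if w \<in> ?S then if {u, w} \<in> E then arr s ZV w - arr s ZV u else 0 else 0)
      = (\<Sum>w\<in>?S. if {u, w} \<in> E then arr s ZV w - arr s ZV u else 0)"
      by (rule sum_lessThan_inter) (rule piece_subset)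
    also have "\<dots> = - (\<Sum>w\<in>?S. if {u, w} \<in> E then arr s ZV u - arr s ZV w else 0)"
      unfolding sum_negf[symmetric] by (intro sum.cong refl) simp
    finally show ?thesis by (simp add: new_def)
  qed
  define inner where "inner = For 1 (Then (Set ACC (Plus (Var ACC) (Plus (At ZV 0) (At ZV 0))))
            (when_eq (At LAB 1) (Var LL) (Cond (Cell ADJ (pair_ix 0 1))
               (Set ACC (Plus (Var ACC) (Minus (At ZV 1) (At ZV 0)))) Nop)))"
  have inner_sets: "writes inner = {ACC}" "counters inner = {1}" by (simp_all add: inner_def)
  have inner: "arr (sem n inner t) ACC 0 = arr t ACC 0 + new u"
    if fr: "\<And>a. a \<notin> {ACC, ZN} \<Longrightarrow> arr t a = arr s a" and u: "ctr t 0 = u" "u < n" for t u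
    unfolding inner_def new[symmetric]
  proof (rule for_rule[where I = "\<lambda>k s'. arr s' ACC 0 = arr t ACC 0 + (\<Sum>w<k. incr_term u w)"], goal_cases)
    case (2 k s')
    have f: "arr s' LAB = arr s LAB" "arr s' LL = arr s LL" "arr s' ZV = arr s ZV" "arr s' ADJ = arr s ADJ"
      using 2(4) fr by simp_all
    have c: "ctr s' 0 = u" using 2(5) u by simp
    have "arr s ADJ (u * n + k) = (if {u, k} \<in> E then 1 else 0)"
      using adj u 2(1) by (simp add: adj_table_def)
    then show ?case using 2(1,2,3) by (simp add: f c incr_term_def piece_def)
  qed simp
  define s1 where "s1 = sem n (For 0 (Then (Set ACC (Num 0)) (Then inner (Put ZN (Ctr 0) (Var ACC))))) s"
  have s1: "\<forall>u<n. arr s1 ZN u = new u"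
    unfolding s1_def
  proof (rule for_rule[where I = "\<lambda>k s'. \<forall>u<k. arr s' ZN u = new u"], goal_cases)
    case (2 k s')
    have f: "arr s' a = arr s a" if "a \<notin> {ACC, ZN}" for a
      using 2(4)[of a] that by (simp add: inner_sets)
    define t where "t = sem n (Set ACC (Num 0)) s'"
    have "arr (sem n inner t) ACC 0 = arr t ACC 0 + new k"
      by (rule inner) (use f 2(1,3) in \<open>auto simp: t_def\<close>)
    moreover have "arr (sem n inner t) ZN = arr t ZN" by (rule arr_frame) (simp add: inner_sets)
    moreover have "ctr (sem n inner t) 0 = ctr t 0" by (rule ctr_frame) (simp add: inner_sets)
    ultimately show ?case using 2(1,2,3) by (auto simp: t_def less_Suc_eq)
  qed simp
  have "\<forall>u<n. arr (sem n (For 0 (Put ZV (Ctr 0) (At ZN 0))) s1) ZV u = new u"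
  proof (rule for_rule[where I = "\<lambda>k s'. \<forall>u<k. arr s' ZV u = new u"], goal_cases)
    case (2 k s')
    have "arr s' ZN = arr s1 ZN" using 2(4) by simp
    then show ?case using 2(1,2,3) s1 by (auto simp: less_Suc_eq)
  qed simp
  moreover have "sem n walk_prog s = sem n (For 0 (Put ZV (Ctr 0) (At ZN 0))) s1"
    by (simp add: walk_prog_def s1_def inner_def)
  ultimately show ?thesis using u by (simp add: new_def)
qed

section \<open>Searching through all sweep cuts\<close>

lemma adj_table_cong: "arr s' ADJ = arr s ADJ \<Longrightarrow> adj_table n E s' = adj_table n E s"
  by (simp add: adj_table_def)

text \<open>\<T> collects the sets tested so far. After a success only the existence of some
  recorded sparse cut is kept, as later successes overwrite \<open>CUT\<close>.\<close>

definition found_inv ::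
    "nat set set \<Rightarrow> nat \<Rightarrow> nat \<Rightarrow> nat set \<Rightarrow> nat set set \<Rightarrow> state \<Rightarrow> bool" where
  "found_inv E n j S \<T> s \<longleftrightarrow>
     arr s FOUND 0 = 0 \<and> (\<forall>A\<in>\<T>. \<not> sparse_cut E n j S A) \<or>
     arr s FOUND 0 = 1 \<and> (\<exists>A. sparse_cut E n j S A \<and> (\<forall>u<n. arr s CUT u = (if u \<in> A then 1 else 0)))"

lemma found_inv_cong:
  "arr s' FOUND = arr s FOUND \<Longrightarrow> arr s' CUT = arr s CUT \<Longrightarrow> found_inv E n j S \<T> s' = found_inv E n j S \<T> s"
  by (simp add: found_inv_def)

definition sweep_loop :: prog where
  "sweep_loop = For 17 (when_eq (At LAB 17) (Var LL) test_cut)"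

definition search_body :: prog where
  "search_body = Then sweep_loop walk_prog"

lemma sweep_sets [simp]:
  "counters sweep_loop = {0, 1, 17}" "writes sweep_loop = {CC, SA, FOUND, CUT}" "\<not> emits sweep_loop"
  "counters search_body = {0, 1, 17}" "writes search_body = {CC, SA, FOUND, CUT, ACC, ZN, ZV}"
  "\<not> emits search_body"
  by (auto simp: sweep_loop_def search_body_def)

lemma sweep_loop_sem:
  assumes adj: "adj_table n E s" and M: "arr s MM 0 = int (card (piece n s))" and J: "arr s JJ 0 = int j"
    and inv: "found_inv E n j (piece n s) \<T> s"
  shows "found_inv E n j (piece n s) (\<T> \<union> upper n s ` piece n s) (sem n sweep_loop s)"
proof -
  let ?S = "piece n s"
  have "found_inv E n j ?S (\<T> \<union> upper n s ` {w\<in>?S. w < n}) (sem n sweep_loop s)"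
    unfolding sweep_loop_def
  proof (rule for_rule[where I = "\<lambda>k s'. found_inv E n j ?S (\<T> \<union> upper n s ` {w\<in>?S. w < k}) s'"], goal_cases)
    case 1
    show ?case using inv by (simp add: found_inv_def)
  next
    case (2 k s')
    have f: "arr s' a = arr s a" if "a \<notin> {CC, SA, FOUND, CUT}" for a using 2(4)[of a] that by simp
    have p: "piece n s' = ?S" by (simp add: piece_def f)
    have up: "upper n s' w = upper n s w" for w by (simp add: upper_def p f)
    have adj': "adj_table n E s'" using adj by (subst adj_table_cong[of _ s]) (simp_all add: f)
    let ?s'' = "sem n test_cut s'"
    show ?case
    proof (cases "k \<in> ?S")
      case False
      then have set: "{w\<in>?S. w < Suc k} = {w\<in>?S. w < k}" by (auto simp: less_Suc_eq)
      have "arr s' LAB k \<noteq> arr s' LL 0" using False 2(1) by (simp add: piece_def f)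
      then show ?thesis using 2(2,3) unfolding set by (simp add: found_inv_def)
    next
      case True
      then have set: "{w\<in>?S. w < Suc k} = insert k {w\<in>?S. w < k}" by (auto simp: less_Suc_eq)
      have "arr s' LAB k = arr s' LL 0" using True by (simp add: piece_def f)
      then have e: "sem n (when_eq (At LAB 17) (Var LL) test_cut) s' = ?s''" using 2(3) by simp
      have M': "arr s' MM 0 = int (card (piece n s'))" unfolding p using M by (simp add: f)
      have J': "arr s' JJ 0 = int j" using J by (simp add: f)
      note t = test_cut_sem[OF 2(3) adj' M' J', unfolded p up]
      show ?thesis
      proof (cases "sparse_cut E n j ?S (upper n s k)")
        case True
        then have "found_inv E n j ?S \<T>' ?s''" for \<T>'
          unfolding found_inv_def using t(1) by blast
        then show ?thesis unfolding e by (simp add: found_inv_def)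
      next
        case False
        from t(2)[OF False] have "found_inv E n j ?S \<T>' ?s'' = found_inv E n j ?S \<T>' s'" for \<T>'
          by (intro found_inv_cong) auto
        then show ?thesis using 2(2) False unfolding e set by (simp add: found_inv_def)
      qed
    qed
  qed
  moreover have "{w\<in>?S. w < n} = ?S" by (auto simp: piece_def)
  ultimately show ?thesis by simp
qed

text \<open>The eight nested loops make \<open>n\<^sup>8\<close> steps of the walk.\<close>

definition search :: prog where
  "search = Then (Set FOUND (Num 0)) (For 8 (when_eq (At LAB 8) (Var LL)
     (Then (For 0 (Put ZV (Ctr 0) (Num (-1))))
       (Then (Put ZV (Ctr 8) (Minus (Var MM) (Num 1)))
         (nest [9, 10, 11, 12, 13, 14, 15, 16] search_body)))))"

lemma search_sets [simp]:
  "counters search = {0, 1, 17, 8, 9, 10, 11, 12, 13, 14, 15, 16}"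
  "writes search = {CC, SA, FOUND, CUT, ACC, ZN, ZV}" "\<not> emits search"
  by (auto simp: search_def simp del: nest.simps)

definition sweep_set :: "nat set set \<Rightarrow> nat \<Rightarrow> nat set \<Rightarrow> nat \<Rightarrow> nat \<Rightarrow> nat \<Rightarrow> nat set" where
  "sweep_set E n S v t w = {u\<in>S. walk_int E n S v t u \<ge> walk_int E n S v t w}"

lemma search_sem:
  assumes adj: "adj_table n E s" and M: "arr s MM 0 = int (card (piece n s))" and J: "arr s JJ 0 = int j"
  defines "S \<equiv> piece n s"
  shows "found_inv E n j S {sweep_set E n S v t w | v t w. v \<in> S \<and> t < n ^ 8 \<and> w \<in> S} (sem n search s)"
proof -
  let ?W = "{CC, SA, FOUND, CUT, ACC, ZN, ZV}"
  define s0 where "s0 = sem n (Set FOUND (Num 0)) s"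
  let ?T = "\<lambda>k. {sweep_set E n S v t w | v t w. v < k \<and> v \<in> S \<and> t < n ^ 8 \<and> w \<in> S}"
  let ?P = "Then (For 0 (Put ZV (Ctr 0) (Num (-1)))) (Then (Put ZV (Ctr 8) (Minus (Var MM) (Num 1)))
         (nest [9, 10, 11, 12, 13, 14, 15, 16] search_body))"
  have Wp: "writes ?P = ?W" by (auto simp del: nest.simps)
  have "found_inv E n j S (?T n) (sem n (For 8 (when_eq (At LAB 8) (Var LL) ?P)) s0)"
  proof (rule for_rule[where I = "\<lambda>k s'. found_inv E n j S (?T k) s'"], goal_cases)
    case 1
    show ?case by (simp add: found_inv_def s0_def)
  next
    case (2 k s')
    have f: "arr s' a = arr s a" if "a \<notin> ?W" for a
      using 2(4)[of a] that unfolding when_sets Wp by (auto simp: s0_def)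
    show ?case
    proof (cases "k \<in> S")
      case False
      then have "arr s' LAB k \<noteq> arr s' LL 0" using 2(1) by (simp add: S_def piece_def f)
      then have e: "sem n (when_eq (At LAB 8) (Var LL) ?P) s' = s'" using 2(3) by (simp del: sem.simps nest.simps)
      have T: "?T (Suc k) = ?T k" using False by (auto simp: less_Suc_eq)
      show ?thesis using 2(2) unfolding e T by (simp add: found_inv_def)
    next
      case True
      then have "arr s' LAB k = arr s' LL 0" by (simp add: S_def piece_def f)
      then have e: "sem n (when_eq (At LAB 8) (Var LL) ?P) s' = sem n ?P s'"
        using 2(3) by (simp del: sem.simps nest.simps)
      define s1 where "s1 = sem n (For 0 (Put ZV (Ctr 0) (Num (-1)))) s'"
      have s1z: "\<forall>u<n. arr s1 ZV u = -1" unfolding s1_def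
        by (rule for_rule[where I = "\<lambda>k s'. \<forall>u<k. arr s' ZV u = -1"]) (auto simp: less_Suc_eq)
      have s1f: "arr s1 a = arr s' a" if "a \<noteq> ZV" for a using that by (simp add: s1_def arr_frame del: sem.simps)
      have s1c: "ctr s1 c = ctr s' c" if "c \<noteq> 0" for c using that by (simp add: s1_def ctr_frame del: sem.simps)
      define s2 where "s2 = sem n (Put ZV (Ctr 8) (Minus (Var MM) (Num 1))) s1"
      have s2f: "arr s2 a = arr s' a" if "a \<noteq> ZV" for a using that by (simp add: s2_def s1f)
      have s2z: "\<forall>u<n. arr s2 ZV u = walk_int E n S k 0 u"
        using s1z 2(3) by (simp add: s2_def s1c s1f f M S_def)
      let ?U = "\<lambda>t. {sweep_set E n S k t' w | t' w. t' < t \<and> w \<in> S}"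
      \<comment> \<open>At time \<open>t\<close> the array holds the vector with index
        \<open>t\<close>, and the sweeps of all earlier times have been tested; no loop counter
        occurs, as \<open>nest_rule\<close> requires.\<close>
      define I where "I t r \<longleftrightarrow> (\<forall>a. a \<notin> ?W \<longrightarrow> arr r a = arr s a) \<and>
        (\<forall>u<n. arr r ZV u = walk_int E n S k t u) \<and> found_inv E n j S (?T k \<union> ?U t) r" for t r
      have "I (0 + n ^ length [9, 10, 11, 12, 13, 14, 15, 16 :: nat])
        (sem n (nest [9, 10, 11, 12, 13, 14, 15, 16] search_body) s2)"
      proof (rule nest_rule)
        show "I t (set_ctr c l r)" if "I t r" for t c l r using that by (simp add: I_def found_inv_def)
        show "I 0 s2"
          using f s2f s2z 2(2) found_inv_cong[of s2 s'] by (simp add: I_def)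
        fix i r assume "I (0 + i) r"
        then have r: "\<And>a. a \<notin> ?W \<Longrightarrow> arr r a = arr s a" "\<And>u. u < n \<Longrightarrow> arr r ZV u = walk_int E n S k i u"
          "found_inv E n j S (?T k \<union> ?U i) r" by (simp_all add: I_def)
        have p: "piece n r = S" by (simp add: piece_def r(1) S_def)
        have up: "upper n r ` S = {sweep_set E n S k i w | w. w \<in> S}"
        proof -
          have "upper n r w = sweep_set E n S k i w" if "w \<in> S" for w
          proof -
            have Sn: "u < n" if "u \<in> S" for u using that by (simp add: S_def piece_def)
            have "upper n r w = {u\<in>S. arr r ZV u \<ge> arr r ZV w}" by (simp add: upper_def p)
            then show ?thesis using r(2) Sn that by (auto simp: sweep_set_def)
          qed
          then show ?thesis by auto
        qed
        have adj': "adj_table n E r" using adj by (subst adj_table_cong[of _ s]) (simp_all add: r(1))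
        define r1 where "r1 = sem n sweep_loop r"
        have r1f: "arr r1 a = arr r a" if "a \<notin> {CC, SA, FOUND, CUT}" for a
          using that by (simp add: r1_def arr_frame)
        have "found_inv E n j S (?T k \<union> ?U i \<union> upper n r ` S) r1"
          unfolding r1_def p[symmetric]
          by (rule sweep_loop_sem[OF adj']) (use r M J in \<open>simp_all add: p S_def\<close>)
        moreover have "?T k \<union> ?U i \<union> upper n r ` S = ?T k \<union> ?U (Suc i)"
          unfolding up by (auto simp: less_Suc_eq)
        ultimately have fi: "found_inv E n j S (?T k \<union> ?U (Suc i)) r1" by simp
        have adj1: "adj_table n E r1" using adj' by (subst adj_table_cong[of _ r]) (simp_all add: r1f)
        have p1: "piece n r1 = S" by (simp add: piece_def r1f r(1) S_def)
        have z: "arr (sem n walk_prog r1) ZV u = walk_int E n S k (Suc i) u" if u: "u < n" for u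
        proof -
          have "(\<Sum>w\<in>S. if {u, w} \<in> E then arr r1 ZV u - arr r1 ZV w else 0)
            = (\<Sum>w\<in>S. if {u, w} \<in> E then walk_int E n S k i u - walk_int E n S k i w else 0)"
            by (intro sum.cong refl) (use r(2) u in \<open>auto simp: r1f S_def piece_def\<close>)
          then show ?thesis using walk_prog_sem[OF adj1 u] r(2)[OF u] by (simp add: p1 r1f)
        qed
        have wf: "arr (sem n walk_prog r1) a = arr r1 a" if "a \<notin> {ACC, ZN, ZV}" for a
          using that by (simp add: arr_frame)
        have "found_inv E n j S (?T k \<union> ?U (Suc i)) (sem n walk_prog r1)"
          using fi found_inv_cong[of "sem n walk_prog r1" r1] by (simp add: wf)
        then show "I (Suc (0 + i)) (sem n search_body r)"
          using z wf r1f r(1) by (simp add: I_def search_body_def r1_def[symmetric])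
      qed
      moreover have "0 + n ^ length [9, 10, 11, 12, 13, 14, 15, 16 :: nat] = n ^ 8"
        by (simp add: numeral_eq_Suc)
      moreover have "sem n ?P s' = sem n (nest [9, 10, 11, 12, 13, 14, 15, 16] search_body) s2"
        by (simp only: sem.simps s2_def s1_def)
      ultimately have "found_inv E n j S (?T k \<union> ?U (n ^ 8)) (sem n ?P s')"
        unfolding I_def by (simp only:)
      moreover have "?T k \<union> ?U (n ^ 8) = ?T (Suc k)" using True by (auto simp: less_Suc_eq)
      ultimately show ?thesis unfolding e by (simp add: found_inv_def)
    qed
  qed
  moreover have "?T n = {sweep_set E n S v t w | v t w. v \<in> S \<and> t < n ^ 8 \<and> w \<in> S}"
    by (auto simp: S_def piece_def)
  ultimately show ?thesis by (simp add: search_def s0_def del: nest.simps)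
qed

text \<open>\<open>LL\<close> is the piece being processed, \<open>KK\<close> the next unused label.\<close>

definition split_prog :: prog where
  "split_prog = Cond (Var FOUND)
     (Then (For 0 (Cond (At CUT 0) (Put LAB (Ctr 0) (Var KK)) Nop)) (Set KK (Plus (Var KK) (Num 1))))
     (Then (when_less (Num 1) (Var MM)
         (when_le (Times (Num 3) (Times (Var DN) Size)) (Times (Num 8) (Times (Var MM) (Var DD)))
           (For 0 (Then (Put OUT (Ctr 0) (Num 0)) (when_eq (At LAB 0) (Var LL) (Put OUT (Ctr 0) (Num 1)))))))
       (Set LL (Plus (Var LL) (Num 1))))"

definition step_prog :: prog where
  "step_prog = Then count_piece (Then search split_prog)"

lemma step_sets [simp]:
  "counters split_prog = {0}" "writes split_prog = {LAB, KK, OUT, LL}" "\<not> emits split_prog"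
  "counters step_prog = {0, 1, 17, 8, 9, 10, 11, 12, 13, 14, 15, 16}"
  "writes step_prog = {MM, CC, SA, FOUND, CUT, ACC, ZN, ZV, LAB, KK, OUT, LL}" "\<not> emits step_prog"
  by (auto simp: split_prog_def step_prog_def)

text \<open>Which sparse cut is used stays open; correctness does not depend on the choice.\<close>

definition is_split :: "nat set set \<Rightarrow> nat \<Rightarrow> nat \<Rightarrow> state \<Rightarrow> state \<Rightarrow> bool" where
  "is_split E n j s s' \<longleftrightarrow> (\<exists>A. sparse_cut E n j (piece n s) A \<and>
     (\<forall>u<n. arr s' LAB u = (if u \<in> A then arr s KK 0 else arr s LAB u)) \<and>
     arr s' KK 0 = arr s KK 0 + 1 \<and> arr s' LL 0 = arr s LL 0 \<and> arr s' OUT = arr s OUT)"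

definition is_skip :: "nat set set \<Rightarrow> nat \<Rightarrow> nat \<Rightarrow> state \<Rightarrow> state \<Rightarrow> bool" where
  "is_skip E n j s s' \<longleftrightarrow> sweep_free E n j (piece n s) \<and> arr s' LAB = arr s LAB \<and>
     arr s' KK 0 = arr s KK 0 \<and> arr s' LL 0 = arr s LL 0 + 1 \<and>
     (if card (piece n s) \<ge> 2 \<and> 3 * (arr s DN 0 * int n) \<le> 8 * (int (card (piece n s)) * arr s DD 0)
      then \<forall>u<n. arr s' OUT u = (if u \<in> piece n s then 1 else 0) else arr s' OUT = arr s OUT)"

lemma step_prog_sem:
  assumes adj: "adj_table n E s" and J: "arr s JJ 0 = int j"
  shows "is_split E n j s (sem n step_prog s) \<or> is_skip E n j s (sem n step_prog s)"
proof -
  let ?S = "piece n s"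
  define s1 where "s1 = sem n count_piece s"
  have f1: "arr s1 a = arr s a" if "a \<noteq> MM" for a using that by (simp add: s1_def arr_frame)
  have p1: "piece n s1 = ?S" by (simp add: piece_def f1)
  have M1: "arr s1 MM 0 = int (card ?S)" by (simp add: s1_def count_piece_sem)
  have adj1: "adj_table n E s1" using adj by (subst adj_table_cong[of _ s]) (simp_all add: f1)
  define s2 where "s2 = sem n search s1"
  have f2: "arr s2 a = arr s1 a" if "a \<notin> {CC, SA, FOUND, CUT, ACC, ZN, ZV}" for a
    using that by (simp add: s2_def arr_frame)
  have inv: "found_inv E n j ?S {sweep_set E n ?S v t w | v t w. v \<in> ?S \<and> t < n ^ 8 \<and> w \<in> ?S} s2"
    using search_sem[OF adj1, of j] M1 J by (simp add: p1 f1 s2_def)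
  have e: "sem n step_prog s = sem n split_prog s2" by (simp add: step_prog_def s1_def s2_def)
  from inv consider (free) "arr s2 FOUND 0 = 0" "sweep_free E n j ?S"
    | (cut) A where "arr s2 FOUND 0 = 1" "sparse_cut E n j ?S A"
      "\<forall>u<n. arr s2 CUT u = (if u \<in> A then 1 else 0)"
    unfolding found_inv_def sweep_free_def sweep_set_def by blast
  then show ?thesis
  proof cases
    case cut
    let ?L = "For 0 (Cond (At CUT 0) (Put LAB (Ctr 0) (Var KK)) Nop)"
    have "\<forall>u<n. arr (sem n ?L s2) LAB u = (if u < n \<and> u \<in> A then arr s KK 0 else arr s LAB u)"
    proof (rule for_rule[where I = "\<lambda>k s'. \<forall>u<n. arr s' LAB u = (if u < k \<and> u \<in> A then arr s KK 0 else arr s LAB u)"], goal_cases)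
      case 1
      show ?case by (simp add: f2 f1)
    next
      case (2 k s')
      have f: "arr s' CUT = arr s2 CUT" "arr s' KK = arr s KK" using 2(4) by (simp_all add: f2 f1)
      show ?case using 2(1,2,3) cut(3) by (auto simp: f less_Suc_eq)
    qed
    moreover have "arr (sem n ?L s2) a = arr s2 a" if "a \<noteq> LAB" for a
      using that by (simp add: arr_frame del: sem.simps)
    moreover have "sem n split_prog s2 = sem n (Set KK (Plus (Var KK) (Num 1))) (sem n ?L s2)"
      using cut(1) by (simp add: split_prog_def)
    ultimately have "is_split E n j s (sem n split_prog s2)"
      unfolding is_split_def using cut(2) by (intro exI[of _ A]) (simp add: f1 f2 del: sem.simps(7))
    then show ?thesis unfolding e ..
  next
    case free
    let ?L = "For 0 (Then (Put OUT (Ctr 0) (Num 0)) (when_eq (At LAB 0) (Var LL) (Put OUT (Ctr 0) (Num 1))))"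
    define s3 where "s3 = (if card ?S \<ge> 2 \<and> 3 * (arr s DN 0 * int n) \<le> 8 * (int (card ?S) * arr s DD 0)
      then sem n ?L s2 else s2)"
    have L: "\<forall>u<n. arr (sem n ?L s2) OUT u = (if u \<in> ?S then 1 else 0)"
    proof (rule for_rule[where I = "\<lambda>k s'. \<forall>u<k. arr s' OUT u = (if u \<in> ?S then 1 else 0)"], goal_cases)
      case (2 k s')
      have f: "arr s' LAB = arr s LAB" "arr s' LL = arr s LL" using 2(4) by (simp_all add: f2 f1)
      show ?case using 2(1,2,3) by (auto simp: f less_Suc_eq piece_def)
    qed simp
    have fL: "arr (sem n ?L s2) a = arr s2 a" if "a \<noteq> OUT" for a
      using that by (simp add: arr_frame del: sem.simps)
    then have f3: "arr s3 a = arr s a" if "a \<in> {LAB, KK, LL}" for a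
      using that by (auto simp: s3_def f2 f1 simp del: sem.simps(7))
    have "1 < int (card ?S) \<longleftrightarrow> 2 \<le> card ?S" by linarith
    then have "sem n split_prog s2 = sem n (Set LL (Plus (Var LL) (Num 1))) s3"
      using free(1) by (simp add: split_prog_def s3_def f2 f1 M1 del: sem.simps(7))
    then have "is_skip E n j s (sem n split_prog s2)"
      unfolding is_skip_def using free(2) L f3 by (auto simp: s3_def f2 f1 simp del: sem.simps(7))
    then show ?thesis unfolding e ..
  qed
qed

text \<open>Label -1 marks the vertices outside the window. It is never processed, since
  \<open>LL\<close> starts at 0 and only grows. Fractions are compared by cross
  multiplication.\<close>

definition init_labels :: prog where
  "init_labels = Then (Set KK (Num 1)) (Then (Set LL (Num 0))
     (For 0 (Then (Put LAB (Ctr 0) (Num (-1)))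
       (when_le (Times (At MN 4) (At MD 0)) (Times (At MN 0) (At MD 4))
         (when_le (Times (At MN 0) (At MD 5)) (Times (At MN 5) (At MD 0))
           (Put LAB (Ctr 0) (Num 0)))))))"

definition interval :: "nat \<Rightarrow> state \<Rightarrow> nat \<Rightarrow> nat \<Rightarrow> nat set" where
  "interval n s a b = {u. u < n \<and> arr s MN a * arr s MD u \<le> arr s MN u * arr s MD a \<and>
     arr s MN u * arr s MD b \<le> arr s MN b * arr s MD u}"

lemma init_labels_sets [simp]:
  "counters init_labels = {0}" "writes init_labels = {KK, LL, LAB}" "\<not> emits init_labels"
  by (auto simp: init_labels_def)

lemma init_labels_sem:
  "\<forall>u<n. arr (sem n init_labels s) LAB u = (if u \<in> interval n s (ctr s 4) (ctr s 5) then 0 else -1)"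
  "arr (sem n init_labels s) KK 0 = 1" "arr (sem n init_labels s) LL 0 = 0"
proof -
  let ?L = "For 0 (Then (Put LAB (Ctr 0) (Num (-1)))
       (when_le (Times (At MN 4) (At MD 0)) (Times (At MN 0) (At MD 4))
         (when_le (Times (At MN 0) (At MD 5)) (Times (At MN 5) (At MD 0))
           (Put LAB (Ctr 0) (Num 0)))))"
  define s0 where "s0 = sem n (Then (Set KK (Num 1)) (Set LL (Num 0))) s"
  have e: "sem n init_labels s = sem n ?L s0" by (simp add: init_labels_def s0_def)
  show "\<forall>u<n. arr (sem n init_labels s) LAB u = (if u \<in> interval n s (ctr s 4) (ctr s 5) then 0 else -1)"
    unfolding e
  proof (rule for_rule[where I = "\<lambda>k s'. \<forall>u<k. arr s' LAB u = (if u \<in> interval n s (ctr s 4) (ctr s 5) then 0 else -1)"], goal_cases)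
    case (2 k s')
    have f: "arr s' MN = arr s MN" "arr s' MD = arr s MD" using 2(4) by (simp_all add: s0_def)
    have c: "ctr s' 4 = ctr s 4" "ctr s' 5 = ctr s 5" using 2(5) by (simp_all add: s0_def)
    show ?case using 2(1,2,3) by (auto simp: f c less_Suc_eq interval_def)
  qed simp
  have "arr (sem n ?L s0) a = arr s0 a" if "a \<noteq> LAB" for a
    using that by (simp add: arr_frame del: sem.simps)
  then show "arr (sem n init_labels s) KK 0 = 1" "arr (sem n init_labels s) LL 0 = 0"
    unfolding e by (simp_all add: s0_def del: sem.simps(7))
qed

section \<open>Correctness of the decomposition\<close>

lemma sparse_cut_proper:
  assumes "sparse_cut E n j S A"
  shows "A \<subseteq> S" "A \<noteq> {}" "S - A \<noteq> {}"
proof -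
  have "cut_count E A (S - A) \<ge> 0" unfolding cut_count_def by (intro sum_nonneg) auto
  then have "0 \<le> cut_count E A (S - A) * int j" by simp
  then have "0 < int n * int (card A)" "0 < int n * int (card (S - A))"
    using assms unfolding sparse_cut_def by linarith+
  then have "card A \<noteq> 0" "card (S - A) \<noteq> 0" by (auto simp: zero_less_mult_iff)
  then show "A \<noteq> {}" "S - A \<noteq> {}" by (metis card.empty)+
  show "A \<subseteq> S" using assms by (simp add: sparse_cut_def)
qed

definition work :: prog where
  "work = Then init_labels (nest [6, 7] step_prog)"

definition main_loop :: prog where
  "main_loop = nest [2, 3] (Then (For 4 (For 5 work)) (Set JJ (Minus (Var JJ) (Num 1))))"

lemma work_sets [simp]:
  "counters work = {0, 1, 17, 6, 7, 8, 9, 10, 11, 12, 13, 14, 15, 16}"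
  "writes work = {MM, CC, SA, FOUND, CUT, ACC, ZN, ZV, LAB, KK, OUT, LL}" "\<not> emits work"
  "counters main_loop = {0, 1, 17, 2, 3, 4, 5, 6, 7, 8, 9, 10, 11, 12, 13, 14, 15, 16}"
  "writes main_loop = {MM, CC, SA, FOUND, CUT, ACC, ZN, ZV, LAB, KK, OUT, LL, JJ}" "\<not> emits main_loop"
  by (auto simp: work_def main_loop_def simp del: nest.simps)

text \<open>The interface between program and analysis: of the sets called good only their size and
  their behaviour under splitting matter here. \<open>js\<close> stands for \<open>jstar\<close>,
  and \<open>dn / dd\<close> for \<delta>.\<close>

locale rounding_target =
  fixes E :: "nat set set" and n js :: nat and dn dd :: int and target :: "nat set \<Rightarrow> bool"
  assumes large: "\<And>S. target S \<Longrightarrow> 2 \<le> card S \<and> 3 * (dn * int n) \<le> 8 * (int (card S) * dd)"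
    and splits: "\<And>S A. target S \<Longrightarrow> sparse_cut E n js S A \<Longrightarrow> target A \<or> target (S - A)"
    and js: "1 \<le> js" "js \<le> n\<^sup>2"
begin

text \<open>The level is only bounded by \<open>js\<close>, so the property survives every later
  overwriting, which happens at smaller or equal levels.\<close>

definition out_ok :: "state \<Rightarrow> bool" where
  "out_ok s \<longleftrightarrow> (\<exists>j S. 1 \<le> j \<and> j \<le> js \<and> S \<subseteq> {..<n} \<and> 2 \<le> card S \<and>
     3 * (dn * int n) \<le> 8 * (int (card S) * dd) \<and> sweep_free E n j S \<and>
     (\<forall>u<n. arr s OUT u = (if u \<in> S then 1 else 0)))"

definition ready :: "state \<Rightarrow> bool" where
  "ready s \<longleftrightarrow> adj_table n E s \<and> arr s DN 0 = dn \<and> arr s DD 0 = dd"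

lemma out_ok_cong: "arr s' OUT = arr s OUT \<Longrightarrow> out_ok s' = out_ok s"
  by (simp add: out_ok_def)

lemma ready_cong:
  assumes "arr s' ADJ = arr s ADJ" "arr s' DN = arr s DN" "arr s' DD = arr s DD"
  shows "ready s' = ready s"
  using assms by (simp add: ready_def adj_table_def)

lemma skip_out_ok:
  assumes r: "ready s" and sk: "is_skip E n j s s'" and j: "1 \<le> j" "j \<le> js"
    and L: "2 \<le> card (piece n s) \<and> 3 * (dn * int n) \<le> 8 * (int (card (piece n s)) * dd)"
  shows "out_ok s'"
proof -
  have d: "arr s DN 0 = dn" "arr s DD 0 = dd" using r by (simp_all add: ready_def)
  have "sweep_free E n j (piece n s)" "\<forall>u<n. arr s' OUT u = (if u \<in> piece n s then 1 else 0)"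
    using sk L unfolding is_skip_def d by simp_all
  then show ?thesis unfolding out_ok_def using j L piece_subset by blast
qed

lemma step_out_ok:
  assumes r: "ready s" and J: "arr s JJ 0 = int j" "1 \<le> j" "j \<le> js" and ok: "out_ok s"
  shows "out_ok (sem n step_prog s)"
proof -
  have "adj_table n E s" using r by (simp add: ready_def)
  from step_prog_sem[OF this J(1)] show ?thesis
  proof
    assume "is_split E n j s (sem n step_prog s)"
    then show ?thesis using ok out_ok_cong[of "sem n step_prog s" s] by (auto simp: is_split_def)
  next
    assume sk: "is_skip E n j s (sem n step_prog s)"
    show ?thesis
    proof (cases "2 \<le> card (piece n s) \<and> 3 * (dn * int n) \<le> 8 * (int (card (piece n s)) * dd)")
      case True
      then show ?thesis using skip_out_ok[OF r sk J(2,3)] by simp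
    next
      case False
      then have "arr (sem n step_prog s) OUT = arr s OUT"
        using sk r unfolding is_skip_def ready_def by (auto split: if_splits)
      then show ?thesis using ok out_ok_cong[of "sem n step_prog s" s] by simp
    qed
  qed
qed

lemma work_preserves:
  assumes r: "ready s" and J: "arr s JJ 0 = int j" "1 \<le> j" "j \<le> js" and ok: "out_ok s"
  shows "out_ok (sem n work s)"
proof -
  define I where "I i t \<longleftrightarrow> (\<forall>a\<in>{ADJ, DN, DD, JJ}. arr t a = arr s a) \<and> out_ok t" for i :: nat and t
  have "I (0 + n ^ length [6, 7 :: nat]) (sem n (nest [6, 7] step_prog) (sem n init_labels s))"
  proof (rule nest_rule)
    show "I i (set_ctr c k t)" if "I i t" for i c k t using that by (simp add: I_def out_ok_def)
    have "arr (sem n init_labels s) a = arr s a" if "a \<notin> {KK, LL, LAB}" for a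
      using that by (simp add: arr_frame)
    then show "I 0 (sem n init_labels s)" using ok out_ok_cong[of "sem n init_labels s" s] by (simp add: I_def)
    fix i t assume "I (0 + i) t"
    then have t: "\<And>a. a \<in> {ADJ, DN, DD, JJ} \<Longrightarrow> arr t a = arr s a" "out_ok t" by (auto simp: I_def)
    have "ready t" using r ready_cong[of t s] t(1) by simp
    then have "out_ok (sem n step_prog t)" using t J by (intro step_out_ok) auto
    then show "I (Suc (0 + i)) (sem n step_prog t)" using t(1) by (simp add: I_def arr_frame)
  qed
  then show ?thesis by (simp add: I_def work_def)
qed

text \<open>A split raises \<open>KK\<close> and a skip raises \<open>LL\<close>, so their sum
  measures progress. Every label below \<open>KK\<close> being in use bounds \<open>KK\<close> by n.
  Until an acceptable output exists, some target piece has a label that is still to be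
  processed.\<close>

definition good_inv :: "nat \<Rightarrow> state \<Rightarrow> bool" where
  "good_inv i t \<longleftrightarrow> 0 \<le> arr t LL 0 \<and> int i + 1 \<le> arr t LL 0 + arr t KK 0 \<and>
     (\<forall>u<n. arr t LAB u < arr t KK 0) \<and>
     (\<forall>l. 0 \<le> l \<and> l < arr t KK 0 \<longrightarrow> (\<exists>u<n. arr t LAB u = l)) \<and>
     (out_ok t \<or> (\<exists>l. arr t LL 0 \<le> l \<and> l < arr t KK 0 \<and> target {u. u < n \<and> arr t LAB u = l}))"

lemma split_good_inv:
  assumes inv: "good_inv i t" and sp: "is_split E n js t t'" and ok': "out_ok t \<Longrightarrow> out_ok t'"
  shows "good_inv (Suc i) t'"
proof -
  obtain A where A: "sparse_cut E n js (piece n t) A"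
    "\<And>u. u < n \<Longrightarrow> arr t' LAB u = (if u \<in> A then arr t KK 0 else arr t LAB u)"
    "arr t' KK 0 = arr t KK 0 + 1" "arr t' LL 0 = arr t LL 0"
    using sp unfolding is_split_def by auto
  note pr = sparse_cut_proper[OF A(1)]
  have AS: "u < n \<and> arr t LAB u = arr t LL 0" if "u \<in> A" for u using pr(1) that by (auto simp: piece_def)
  \<comment> \<open>Both sides of a sparse cut are nonempty, so the old and the new label are both
    in use.\<close>
  obtain x where x: "x \<in> A" using pr by auto
  obtain z where z: "z \<in> piece n t" "z \<notin> A" using pr by auto
  have LK: "0 \<le> arr t LL 0" "arr t LL 0 < arr t KK 0" using AS[OF x] inv by (auto simp: good_inv_def)
  have lab: "\<exists>u<n. arr t' LAB u = l" if l: "0 \<le> l" "l < arr t' KK 0" for l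
  proof -
    consider "l = arr t KK 0" | "l = arr t LL 0" | "l \<noteq> arr t LL 0" "l < arr t KK 0"
      using l A(3) by linarith
    then show ?thesis
    proof cases
      case 1
      then show ?thesis using x AS[OF x] A(2)[of x] by auto
    next
      case 2
      then show ?thesis using z A(2)[of z] by (auto simp: piece_def)
    next
      case 3
      then obtain u where u: "u < n" "arr t LAB u = l" using inv l by (auto simp: good_inv_def)
      then have "u \<notin> A" using 3 AS by auto
      then show ?thesis using u A(2)[of u] by auto
    qed
  qed
  have "out_ok t' \<or> (\<exists>l. arr t' LL 0 \<le> l \<and> l < arr t' KK 0 \<and> target {u. u < n \<and> arr t' LAB u = l})"
  proof (cases "out_ok t")
    case False
    then obtain l where l: "arr t LL 0 \<le> l" "l < arr t KK 0" "target {u. u < n \<and> arr t LAB u = l}"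
      using inv by (auto simp: good_inv_def)
    show ?thesis
    proof (cases "l = arr t LL 0")
      case True
      \<comment> \<open>One side gets the fresh label and the other keeps the current one; neither
        has been passed, so the target side will still be processed.\<close>
      have "target A \<or> target (piece n t - A)"
        using splits[OF _ A(1)] l(3) True by (simp add: piece_def)
      moreover have "{u. u < n \<and> arr t' LAB u = arr t KK 0} = A"
      proof (intro subset_antisym subsetI)
        fix u assume u: "u \<in> {u. u < n \<and> arr t' LAB u = arr t KK 0}"
        then have "arr t LAB u < arr t KK 0" using inv by (auto simp: good_inv_def)
        then show "u \<in> A" using u A(2)[of u] by (auto split: if_splits)
      qed (use A(2) AS in auto)
      moreover have "{u. u < n \<and> arr t' LAB u = arr t LL 0} = piece n t - A"
        using A(2) LK by (auto simp: piece_def split: if_splits)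
      ultimately have "target {u. u < n \<and> arr t' LAB u = arr t KK 0} \<or>
          target {u. u < n \<and> arr t' LAB u = arr t LL 0}" by simp
      then show ?thesis
      proof
        assume "target {u. u < n \<and> arr t' LAB u = arr t KK 0}"
        then show ?thesis using LK A(3,4) by (intro disjI2 exI[of _ "arr t KK 0"]) simp
      next
        assume "target {u. u < n \<and> arr t' LAB u = arr t LL 0}"
        then show ?thesis using LK A(3,4) by (intro disjI2 exI[of _ "arr t LL 0"]) simp
      qed
    next
      case False
      then have "{u. u < n \<and> arr t' LAB u = l} = {u. u < n \<and> arr t LAB u = l}"
        using A(2) AS l(2) by (auto split: if_splits)
      then show ?thesis using l A(3,4) by (intro disjI2 exI[of _ l]) simp
    qed
  qed (use ok' in simp)
  moreover have "arr t' LAB u < arr t' KK 0" if "u < n" for u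
    using A(2)[OF that] A(3) inv that by (fastforce simp: good_inv_def)
  ultimately show ?thesis
    using lab inv A(3,4) unfolding good_inv_def by auto
qed

lemma skip_good_inv:
  assumes inv: "good_inv i t" and sk: "is_skip E n js t t'" and ok': "out_ok t \<Longrightarrow> out_ok t'" and r: "ready t"
  shows "good_inv (Suc i) t'"
proof -
  have t': "arr t' LAB = arr t LAB" "arr t' KK 0 = arr t KK 0" "arr t' LL 0 = arr t LL 0 + 1"
    using sk by (auto simp: is_skip_def)
  have "out_ok t' \<or> (\<exists>l. arr t LL 0 + 1 \<le> l \<and> l < arr t KK 0 \<and> target {u. u < n \<and> arr t LAB u = l})"
  proof (cases "out_ok t")
    case False
    then obtain l where l: "arr t LL 0 \<le> l" "l < arr t KK 0" "target {u. u < n \<and> arr t LAB u = l}"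
      using inv by (auto simp: good_inv_def)
    show ?thesis
    proof (cases "l = arr t LL 0")
      case True
      then have "target (piece n t)" using l(3) by (simp add: piece_def)
      then have "out_ok t'" using skip_out_ok[OF r sk js(1) order_refl] large by simp
      then show ?thesis ..
    next
      case False
      then show ?thesis using l by (intro disjI2 exI[of _ l]) auto
    qed
  qed (use ok' in simp)
  then show ?thesis using inv unfolding good_inv_def t' by auto
qed

text \<open>After n^2 steps \<open>LL + KK\<close> is at least n^2 + 1, hence at least 2 n, while
  \<open>KK\<close> is at most n. So all labels have been passed, no target piece can be pending,
  and the other alternative of \<open>good_inv\<close> must hold.\<close>

lemma work_finds:
  assumes r: "ready s" and J: "arr s JJ 0 = int js" and g: "target (interval n s (ctr s 4) (ctr s 5))"
  shows "out_ok (sem n work s)"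
proof -
  let ?S = "interval n s (ctr s 4) (ctr s 5)"
  define s0 where "s0 = sem n init_labels s"
  note lab = init_labels_sem[of n s, folded s0_def]
  have f0: "arr s0 a = arr s a" if "a \<notin> {KK, LL, LAB}" for a
    using that by (simp add: s0_def arr_frame)
  define I where "I i t \<longleftrightarrow> (\<forall>a\<in>{ADJ, DN, DD, JJ}. arr t a = arr s a) \<and> good_inv i t" for i :: nat and t
  have "I (0 + n ^ length [6, 7 :: nat]) (sem n (nest [6, 7] step_prog) s0)"
  proof (rule nest_rule)
    show "I i (set_ctr c k t)" if "I i t" for i c k t using that by (simp add: I_def good_inv_def out_ok_def)
    have S0: "{u. u < n \<and> arr s0 LAB u = 0} = ?S"
      using lab(1) by (auto simp: interval_def split: if_splits)
    have "?S \<noteq> {}"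
    proof
      assume e: "?S = {}"
      show False using large[OF g] unfolding e by simp
    qed
    then have ex: "\<exists>u<n. arr s0 LAB u = 0" unfolding S0[symmetric] by blast
    have "good_inv 0 s0"
      unfolding good_inv_def lab(2,3)
    proof (intro conjI allI impI)
      show "arr s0 LAB u < 1" if "u < n" for u using lab(1) that by simp
      show "\<exists>u<n. arr s0 LAB u = l" if "0 \<le> l \<and> l < 1" for l
      proof -
        have "l = 0" using that by simp
        then show ?thesis using ex by simp
      qed
      have "target {u. u < n \<and> arr s0 LAB u = 0}" using g unfolding S0 .
      then show "out_ok s0 \<or> (\<exists>l. 0 \<le> l \<and> l < 1 \<and> target {u. u < n \<and> arr s0 LAB u = l})"
        by (intro disjI2 exI[of _ 0] conjI) simp_all
    qed simp_all
    then show "I 0 s0" using f0 by (simp add: I_def)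
    fix i t assume "I (0 + i) t"
    then have t: "\<And>a. a \<in> {ADJ, DN, DD, JJ} \<Longrightarrow> arr t a = arr s a" "good_inv i t" by (auto simp: I_def)
    have rt: "ready t" using r ready_cong[of t s] t(1) by simp
    have Jt: "arr t JJ 0 = int js" using t(1) J by simp
    have ok: "out_ok t \<Longrightarrow> out_ok (sem n step_prog t)" by (rule step_out_ok[OF rt Jt js(1) order_refl])
    have "adj_table n E t" using rt by (simp add: ready_def)
    from step_prog_sem[OF this Jt] have "good_inv (Suc i) (sem n step_prog t)"
      using split_good_inv[OF t(2) _ ok] skip_good_inv[OF t(2) _ ok rt] by blast
    then show "I (Suc (0 + i)) (sem n step_prog t)" using t(1) by (simp add: I_def arr_frame)
  qed
  moreover have "0 + n ^ length [6, 7 :: nat] = n * n" by (simp add: power2_eq_square)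
  ultimately have fin: "good_inv (n * n) (sem n work s)"
    unfolding I_def by (simp add: work_def s0_def del: nest.simps)
  define t where "t = sem n work s"
  have "arr t KK 0 \<le> int n"
  proof -
    have "{0..<arr t KK 0} \<subseteq> arr t LAB ` {..<n}"
      using fin unfolding t_def[symmetric] good_inv_def by fastforce
    then have "card {0..<arr t KK 0} \<le> card (arr t LAB ` {..<n})" by (intro card_mono) auto
    also have "\<dots> \<le> card {..<n}" by (rule card_image_le) simp
    finally show ?thesis by simp
  qed
  moreover have "int (n * n) + 1 \<le> arr t LL 0 + arr t KK 0"
    using fin unfolding t_def[symmetric] good_inv_def by blast
  \<comment> \<open>This is the nonnegativity of the square of n - 1; the 1 comes from the initial
    label count.\<close>
  moreover have "2 * int n \<le> int (n * n) + 1"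
  proof -
    have "0 \<le> (int n - 1)\<^sup>2" by simp
    then show ?thesis by (simp add: power2_eq_square algebra_simps)
  qed
  ultimately have "arr t KK 0 \<le> arr t LL 0" by linarith
  then show ?thesis using fin unfolding t_def[symmetric] good_inv_def by fastforce
qed

text \<open>Before level \<open>js\<close> nothing is known about the output. At level
  \<open>js\<close> the double loop over \<open>a\<close> and \<open>b\<close> meets the window of
  the target, and from then on every output is acceptable.\<close>

theorem main_loop_sem:
  assumes r: "ready s" and J: "arr s JJ 0 = int (n * n)" and a: "a < n" and b: "b < n"
    and g: "target (interval n s a b)"
  shows "out_ok (sem n main_loop s)"
proof -
  let ?W = "{MM, CC, SA, FOUND, CUT, ACC, ZN, ZV, LAB, KK, OUT, LL}"
  have n0: "n > 0" using a by simp
  have pres: "out_ok (sem n (For 4 (For 5 work)) t)"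
    if t: "ready t" "arr t JJ 0 = int j" "1 \<le> j" "j \<le> js" "out_ok t" for t j
  proof (rule for_rule[where I = "\<lambda>k t'. out_ok t'"], goal_cases)
    case (2 k t')
    have rt': "ready t'" using t(1) ready_cong[of t' t] 2(4) by simp
    have Jt': "arr t' JJ 0 = int j" using t(2) 2(4) by simp
    have "out_ok (sem n (For 5 work) t')"
    proof (rule for_rule[where I = "\<lambda>k t'. out_ok t'"], goal_cases)
      case (2 k' t'')
      have rt'': "ready t''" using rt' ready_cong[of t'' t'] 2(4) by simp
      have Jt'': "arr t'' JJ 0 = int j" using Jt' 2(4) by simp
      have "out_ok (sem n work t'')" by (rule work_preserves[OF rt'' Jt'' t(3,4) 2(2)])
      then show ?case by (simp add: out_ok_def)
    qed (use 2 in \<open>simp add: out_ok_def\<close>)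
    then show ?case by (simp add: out_ok_def)
  qed (use t in \<open>simp add: out_ok_def\<close>)
  have find: "out_ok (sem n (For 4 (For 5 work)) t)"
    if t: "ready t" "arr t JJ 0 = int js" "target (interval n t a b)" for t
  proof -
    have "a < n \<longrightarrow> out_ok (sem n (For 4 (For 5 work)) t)"
    proof (rule for_rule[where I = "\<lambda>k t'. a < k \<longrightarrow> out_ok t'"], goal_cases)
      case (2 k t')
      have rt': "ready t'" using t(1) ready_cong[of t' t] 2(4) by simp
      have Jt': "arr t' JJ 0 = int js" using t(2) 2(4) by simp
      have iv': "interval n t' a b = interval n t a b" using 2(4) by (simp add: interval_def)
      have "(a < k \<or> a = k \<and> b < n) \<longrightarrow> out_ok (sem n (For 5 work) t')"
      proof (rule for_rule[where I = "\<lambda>l t'. (a < k \<or> a = k \<and> b < l) \<longrightarrow> out_ok t'"], goal_cases)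
        case 1
        show ?case using 2(2) by (simp add: out_ok_def)
      next
        case 3: (2 l t'')
        have rt'': "ready t''" using rt' ready_cong[of t'' t'] 3(4) by simp
        have Jt'': "arr t'' JJ 0 = int js" using Jt' 3(4) by simp
        have iv'': "interval n t'' a b = interval n t' a b" using 3(4) by (simp add: interval_def)
        have c: "ctr t'' 4 = k" "ctr t'' 5 = l" using 3(3,5) 2(3) by simp_all
        have "out_ok (sem n work t'')" if "a < k \<or> a = k \<and> b < Suc l"
        proof (cases "a = k \<and> b = l")
          case True
          then show ?thesis using work_finds[OF rt'' Jt''] t(3) c iv' iv'' by simp
        next
          case False
          then have "out_ok t''" using 3(2) that by (auto simp: less_Suc_eq)
          then show ?thesis using work_preserves[OF rt'' Jt'' js(1) order_refl] by simp
        qed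
        then show ?case by (auto simp: out_ok_def)
      qed
      then show ?case using b by (auto simp: out_ok_def less_Suc_eq)
    qed simp
    then show ?thesis using a by simp
  qed
  \<comment> \<open>\<open>JJ\<close> is the level still to be processed, so an acceptable output is
    claimed once it has fallen below \<open>js\<close>. At the end it is 0, and \<open>js\<close> is
    at least 1.\<close>
  define I where "I i t \<longleftrightarrow> (\<forall>x\<in>{ADJ, DN, DD, MN, MD}. arr t x = arr s x) \<and>
    (i \<le> n * n \<longrightarrow> arr t JJ 0 = int (n * n - i)) \<and> (n * n - i < js \<longrightarrow> out_ok t)" for i t
  have "I (0 + n ^ length [2, 3 :: nat]) (sem n main_loop s)"
    unfolding main_loop_def
  proof (rule nest_rule)
    show "I i (set_ctr c k t)" if "I i t" for i c k t using that by (simp add: I_def out_ok_def)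
    have "js \<le> n * n" using js(2) by (simp add: power2_eq_square)
    then show "I 0 s" using J by (simp add: I_def)
    fix i t assume i: "i < n ^ length [2, 3 :: nat]" and "I (0 + i) t"
    then have i': "i < n * n" and t: "\<And>x. x \<in> {ADJ, DN, DD, MN, MD} \<Longrightarrow> arr t x = arr s x"
      "arr t JJ 0 = int (n * n - i)" "n * n - i < js \<Longrightarrow> out_ok t"
      by (auto simp: I_def power2_eq_square)
    have rt: "ready t" using r ready_cong[of t s] t(1) by simp
    define u where "u = sem n (For 4 (For 5 work)) t"
    have uf: "arr u x = arr t x" if "x \<notin> ?W" for x
      using that by (simp add: u_def arr_frame del: sem.simps)
    have ok: "out_ok u" if le: "n * n - i \<le> js"
    proof (cases "n * n - i = js")
      case True
      have "interval n t a b = interval n s a b" using t(1) by (simp add: interval_def)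
      then show ?thesis unfolding u_def using find[OF rt] t(2) True g by simp
    next
      case False
      then show ?thesis unfolding u_def using pres[OF rt t(2)] t(3) i' le by simp
    qed
    have js0: "n * n - Suc i < js \<Longrightarrow> n * n - i \<le> js" by simp
    show "I (Suc (0 + i)) (sem n (Then (For 4 (For 5 work)) (Set JJ (Minus (Var JJ) (Num 1)))) t)"
      unfolding I_def sem.simps(5) u_def[symmetric]
      using uf t(1,2) ok js0 i' by (auto simp: out_ok_def)
  qed
  then show ?thesis using js(1) by (simp add: I_def power2_eq_square)
qed

end

section \<open>Input and output\<close>

lemma pair_less: "u < n \<Longrightarrow> v < n \<Longrightarrow> u * n + v < n * n" for u v n :: nat
proof -
  assume "u < n" "v < n"
  then have "u * n + v < Suc u * n" by simp
  also have "\<dots> \<le> n * n" using \<open>u < n\<close> by (intro mult_right_mono) auto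
  finally show ?thesis .
qed

text \<open>The header has 8 cells: n, \<Delta> and three fractions, the first of which is \<delta>
  in cells 2 and 3. The table of \<open>x\<close> follows the n^2 adjacency cells, two cells per
  entry, hence the offsets 8 + n^2 and 9 + n^2.\<close>

definition read_prog :: prog where
  "read_prog = Then
     (For 0 (For 1 (Then (Get ADJ (pair_ix 0 1) (Plus (Num 8) (pair_ix 0 1)))
       (Then (Get XN (pair_ix 0 1) (Plus (Plus (Num 8) (Times Size Size)) (Times (Num 2) (pair_ix 0 1))))
             (Get XD (pair_ix 0 1) (Plus (Plus (Num 9) (Times Size Size)) (Times (Num 2) (pair_ix 0 1))))))))
     (Then (Get DN (Num 0) (Num 2)) (Get DD (Num 0) (Num 3)))"

lemma read_sets [simp]:
  "counters read_prog = {0, 1}" "writes read_prog = {ADJ, XN, XD, DN, DD}" "\<not> emits read_prog"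
  by (auto simp: read_prog_def)

lemma read_prog_sem:
  fixes s :: state
  assumes n: "n \<ge> 1"
  defines "s' \<equiv> sem n read_prog s"
  shows "\<And>u v. u < n \<Longrightarrow> v < n \<Longrightarrow> arr s' ADJ (u * n + v) = raw s (8 + (u * n + v)) \<and>
      arr s' XN (u * n + v) = raw s (8 + n * n + 2 * (u * n + v)) \<and>
      arr s' XD (u * n + v) = raw s (9 + n * n + 2 * (u * n + v))"
    "arr s' DN 0 = raw s 2" "arr s' DD 0 = raw s 3"
proof -
  have nn: "1 \<le> n * n" using n by (metis mult_le_mono nat_mult_1)
  have lim: "input_cells n = 832 * (n * n)" by (simp add: input_cells_def)
  let ?P = "Then (Get ADJ (pair_ix 0 1) (Plus (Num 8) (pair_ix 0 1)))
       (Then (Get XN (pair_ix 0 1) (Plus (Plus (Num 8) (Times Size Size)) (Times (Num 2) (pair_ix 0 1))))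
             (Get XD (pair_ix 0 1) (Plus (Plus (Num 9) (Times Size Size)) (Times (Num 2) (pair_ix 0 1)))))"
  define Q where "Q i t \<longleftrightarrow> arr t ADJ i = raw s (8 + i) \<and> arr t XN i = raw s (8 + n * n + 2 * i) \<and>
      arr t XD i = raw s (9 + n * n + 2 * i)" for i and t :: state
  have body: "Q i t' \<longrightarrow> Q i (sem n ?P t')" "Q (u * n + v) (sem n ?P t')"
    if u: "ctr t' 0 = u" "u < n" and v: "ctr t' 1 = v" "v < n" and r: "raw t' = raw s" for t' :: state and u v i
  proof -
    define m where "m = u * n + v"
    have m: "m < n * n" using pair_less[OF u(2) v(2)] by (simp add: m_def)
    have ix: "int u * int n + int v = int m" by (simp add: m_def)
    have nm: "8 + int m < int (832 * (n * n))" "8 + int n * int n + 2 * int m < int (832 * (n * n))"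
      "9 + int n * int n + 2 * int m < int (832 * (n * n))"
      using m nn by (auto simp flip: of_nat_mult)
    have nt: "nat (8 + int m) = 8 + m" "nat (8 + int n * int n + 2 * int m) = 8 + n * n + 2 * m"
      "nat (9 + int n * int n + 2 * int m) = 9 + n * n + 2 * m"
      by (simp_all add: nat_add_distrib nat_mult_distrib)
    have e: "sem n ?P t' = put XD m (raw s (9 + n * n + 2 * m)) (put XN m (raw s (8 + n * n + 2 * m))
        (put ADJ m (raw s (8 + m)) t'))"
      using u v r nm by (simp add: ix lim nt)
    show "Q i t' \<longrightarrow> Q i (sem n ?P t')" unfolding e by (auto simp: Q_def)
    show "Q (u * n + v) (sem n ?P t')" unfolding e m_def[symmetric] by (simp add: Q_def)
  qed
  define s1 where "s1 = sem n (For 0 (For 1 ?P)) s"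
  have all: "\<forall>u<n. \<forall>v<n. Q (u * n + v) s1"
    unfolding s1_def
  proof (rule for_rule[where I = "\<lambda>k t. \<forall>u<k. \<forall>v<n. Q (u * n + v) t"], goal_cases)
    case (2 k t)
    have rt: "raw t = raw s" using 2(6) by simp
    have "(\<forall>u<k. \<forall>v<n. Q (u * n + v) (sem n (For 1 ?P) t)) \<and> (\<forall>v<n. Q (k * n + v) (sem n (For 1 ?P) t))"
    proof (rule for_rule[where I = "\<lambda>l t. (\<forall>u<k. \<forall>v<n. Q (u * n + v) t) \<and> (\<forall>v<l. Q (k * n + v) t)"], goal_cases)
      case 1
      then show ?case using 2(2) by (simp add: Q_def)
    next
      case 3: (2 l t')
      have c: "ctr t' 0 = k" "ctr t' 1 = l" using 3(3,5) 2(3) by simp_all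
      have rt': "raw t' = raw s" using 3(6) rt by simp
      note b = body[OF c(1) 2(1) c(2) 3(1) rt']
      have "Q i (set_ctr 1 (Suc l) (sem n ?P t')) = Q i (sem n ?P t')" for i
        by (simp add: Q_def del: sem.simps)
      then show ?case using 3(2) b by (auto simp: less_Suc_eq simp del: sem.simps)
    qed
    then show ?case by (auto simp: Q_def less_Suc_eq simp del: sem.simps)
  qed simp
  have raw1: "raw s1 = raw s" by (simp add: s1_def raw_frame del: sem.simps)
  have e: "s' = put DD 0 (raw s 3) (put DN 0 (raw s 2) s1)"
  proof -
    have "832 * 1 \<le> input_cells n" unfolding lim using nn by (intro mult_left_mono) auto
    then have "2 < int (input_cells n)" "3 < int (input_cells n)" by simp_all
    then show ?thesis
      using raw1 unfolding s'_def read_prog_def s1_def[symmetric] sem.simps(5) by simp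
  qed
  show "arr s' DN 0 = raw s 2" "arr s' DD 0 = raw s 3" by (simp_all add: e)
  show "arr s' ADJ (u * n + v) = raw s (8 + (u * n + v)) \<and>
      arr s' XN (u * n + v) = raw s (8 + n * n + 2 * (u * n + v)) \<and>
      arr s' XD (u * n + v) = raw s (9 + n * n + 2 * (u * n + v))" if "u < n" "v < n" for u v
    using all that by (simp add: e Q_def)
qed

text \<open>Starting from 0/1 does not change the maximum, because \<open>x\<close> is nonnegative
  on edges and padded with 0 elsewhere.\<close>

definition max_prog :: prog where
  "max_prog = For 0 (Then (Put MN (Ctr 0) (Num 0)) (Then (Put MD (Ctr 0) (Num 1))
     (For 1 (when_less (Times (At MN 0) (Cell XD (pair_ix 0 1))) (Times (Cell XN (pair_ix 0 1)) (At MD 0))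
        (Then (Put MN (Ctr 0) (Cell XN (pair_ix 0 1))) (Put MD (Ctr 0) (Cell XD (pair_ix 0 1))))))))"

lemma max_sets [simp]:
  "counters max_prog = {0, 1}" "writes max_prog = {MN, MD}" "\<not> emits max_prog"
  by (auto simp: max_prog_def)

definition is_max :: "state \<Rightarrow> (nat \<Rightarrow> real) \<Rightarrow> nat \<Rightarrow> nat \<Rightarrow> bool" where
  "is_max t f k u \<longleftrightarrow> arr t MD u > 0 \<and>
     (\<forall>v<k. f v \<le> real_of_int (arr t MN u) / real_of_int (arr t MD u)) \<and>
     (real_of_int (arr t MN u) / real_of_int (arr t MD u) = 0 \<or>
       (\<exists>v<k. real_of_int (arr t MN u) / real_of_int (arr t MD u) = f v))"

lemma max_prog_sem:
  fixes r :: "nat \<Rightarrow> nat \<Rightarrow> real"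
  assumes pos: "\<And>u v. u < n \<Longrightarrow> v < n \<Longrightarrow> arr s XD (u * n + v) > 0"
    and r: "\<And>u v. u < n \<Longrightarrow> v < n \<Longrightarrow>
      r u v = real_of_int (arr s XN (u * n + v)) / real_of_int (arr s XD (u * n + v))"
  shows "\<forall>u<n. is_max (sem n max_prog s) (r u) n u"
  unfolding max_prog_def
proof (rule for_rule[where I = "\<lambda>k t. \<forall>u<k. is_max t (r u) n u"], goal_cases)
  case (2 k t)
  let ?P = "when_less (Times (At MN 0) (Cell XD (pair_ix 0 1))) (Times (Cell XN (pair_ix 0 1)) (At MD 0))
        (Then (Put MN (Ctr 0) (Cell XN (pair_ix 0 1))) (Put MD (Ctr 0) (Cell XD (pair_ix 0 1))))"
  define t0 where "t0 = sem n (Then (Put MN (Ctr 0) (Num 0)) (Put MD (Ctr 0) (Num 1))) t"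
  have "(\<forall>u<k. is_max (sem n (For 1 ?P) t0) (r u) n u) \<and> is_max (sem n (For 1 ?P) t0) (r k) n k"
  proof (rule for_rule[where I = "\<lambda>l t. (\<forall>u<k. is_max t (r u) n u) \<and> is_max t (r k) l k"], goal_cases)
    case 1
    show ?case using 2(2,3) by (simp add: t0_def is_max_def)
  next
    case 3: (2 l t')
    have f: "arr t' XN = arr s XN" "arr t' XD = arr s XD" using 3(4) 2(4) by (simp_all add: t0_def)
    have c: "ctr t' 0 = k" "ctr t' 1 = l" using 3(3,5) 2(3) by (simp_all add: t0_def)
    let ?i = "k * n + l"
    have p: "arr s XD ?i > 0" by (rule pos[OF 2(1) 3(1)])
    have mk: "is_max t' (r k) l k" using 3(2) by simp
    have mdpos: "arr t' MD k > 0" using mk by (simp add: is_max_def)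
    define cur where "cur = real_of_int (arr t' MN k) / real_of_int (arr t' MD k)"
    have "arr t' MN k * arr s XD ?i < arr s XN ?i * arr t' MD k \<longleftrightarrow>
        real_of_int (arr t' MN k * arr s XD ?i) < real_of_int (arr s XN ?i * arr t' MD k)"
      by (simp only: of_int_less_iff)
    also have "\<dots> \<longleftrightarrow> cur < r k l"
      using p mdpos unfolding cur_def r[OF 2(1) 3(1)] by (simp add: field_simps)
    finally have test: "arr t' MN k * arr s XD ?i < arr s XN ?i * arr t' MD k \<longleftrightarrow> cur < r k l" .
    show ?case
    proof (cases "cur < r k l")
      case True
      have e: "sem n ?P t' = put MD k (arr s XD ?i) (put MN k (arr s XN ?i) t')"
        using True test c f by simp
      have "is_max (put MD k (arr s XD ?i) (put MN k (arr s XN ?i) t')) (r k) (Suc l) k"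
      proof -
        let ?T = "put MD k (arr s XD ?i) (put MN k (arr s XN ?i) t')"
        have v: "real_of_int (arr ?T MN k) / real_of_int (arr ?T MD k) = r k l"
          using r[OF 2(1) 3(1)] by simp
        have "r k v \<le> r k l" if "v < Suc l" for v
          using that mk True unfolding is_max_def cur_def[symmetric] by (fastforce simp: less_Suc_eq)
        then show ?thesis unfolding is_max_def v using p by auto
      qed
      moreover have "\<forall>u<k. is_max (put MD k (arr s XD ?i) (put MN k (arr s XN ?i) t')) (r u) n u"
        using 3(2) by (simp add: is_max_def)
      ultimately show ?thesis unfolding e by (auto simp: is_max_def)
    next
      case False
      have e: "sem n ?P t' = t'" using False test c f by simp
      have "is_max t' (r k) (Suc l) k"
        using mk False unfolding is_max_def cur_def by (auto simp: less_Suc_eq)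
      then show ?thesis using 3(2) unfolding e by (auto simp: is_max_def)
    qed
  qed
  then show ?case by (auto simp: t0_def is_max_def less_Suc_eq)
qed simp

text \<open>Again no product may be stored, so n^2 is obtained by counting.\<close>

definition count_prog :: prog where
  "count_prog = Then (Set JJ (Num 0)) (nest [0, 1] (Set JJ (Plus (Var JJ) (Num 1))))"

lemma count_sets [simp]:
  "counters count_prog = {0, 1}" "writes count_prog = {JJ}" "\<not> emits count_prog"
  by (auto simp: count_prog_def)

lemma count_prog_sem: "arr (sem n count_prog s) JJ 0 = int (n * n)"
proof -
  have "arr (sem n (nest [0, 1] (Set JJ (Plus (Var JJ) (Num 1)))) (sem n (Set JJ (Num 0)) s)) JJ 0
    = int (0 + n ^ length [0, 1 :: nat])"
    by (rule nest_rule[where I = "\<lambda>i t. arr t JJ 0 = int i"]) simp_all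
  then show ?thesis by (simp add: count_prog_def del: nest.simps)
qed

definition out_prog :: prog where
  "out_prog = For 0 (Emit (Ctr 0) (At OUT 0))"

lemma out_prog_sem:
  shows "\<forall>u<n. 0 < u \<longrightarrow> raw (sem n out_prog s) u = arr s OUT u"
    "arr (sem n out_prog s) = arr s"
proof -
  show a: "arr (sem n out_prog s) = arr s" by (rule ext) (rule arr_frame, simp add: out_prog_def)
  show "\<forall>u<n. 0 < u \<longrightarrow> raw (sem n out_prog s) u = arr s OUT u"
    unfolding out_prog_def
  proof (rule for_rule[where I = "\<lambda>k t. \<forall>u<k. 0 < u \<longrightarrow> raw t u = arr s OUT u"], goal_cases)
    case (2 k t)
    have "arr t OUT = arr s OUT" using 2(4) by simp
    then show ?case using 2(1,2,3) by (auto simp: less_Suc_eq)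
  qed simp
qed

definition algorithm :: prog where
  "algorithm = Then read_prog (Then max_prog (Then count_prog (Then main_loop out_prog)))"

lemma wf_algorithm: "wf_prog algorithm"
  unfolding algorithm_def read_prog_def max_prog_def count_prog_def main_loop_def out_prog_def work_def
    init_labels_def step_prog_def count_piece_def search_def search_body_def sweep_loop_def walk_prog_def
    split_prog_def test_cut_def count_cut_def mark_cut_def when_eq_def when_le_def when_less_def
  by simp

text \<open>Cell 0 is overwritten last, as it holds \<open>n\<close>.\<close>

definition final_store :: com where
  "final_store = Store (Const 0) (comp_aexp (Var OUT))"

definition program :: com where
  "program = Seq (compile algorithm) final_store"

lemma algorithm_run:
  assumes n: "n \<ge> 1" and xs0: "xs \<noteq> []" "xs ! 0 = int n" and len: "length xs \<le> input_cells n"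
  defines "s \<equiv> sem n algorithm \<lparr>raw = load_input xs, ctr = \<lambda>_. 0, arr = \<lambda>_ _. 0\<rparr>"
  shows "\<exists>M t. run program (load_input xs) M t \<and>
    t \<le> (poly (time_poly algorithm) n + store_cost (Const 0) (comp_aexp (Var OUT)))
         * (input_size xs + poly (width_poly algorithm) n + 1) \<and>
    M 0 = arr s OUT 0 \<and> (\<forall>v<n. 0 < v \<longrightarrow> M v = raw s v)"
proof -
  let ?s0 = "\<lparr>raw = load_input xs, ctr = \<lambda>_. 0, arr = \<lambda>_ _. 0\<rparr> :: state"
  \<comment> \<open>Cells beyond the input are 0, so all counters and arrays start out as 0 in the
    abstract state.\<close>
  have zero: "load_input xs (addr n k i) = 0" for k i
    using addr_ge[of n k i] len by (simp add: load_input_def)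
  have "represents n ?s0 (load_input xs)"
    using n xs0 zero by (simp add: represents_def load_input_def)
  moreover have bd: "bounded_by (input_size xs) (load_input xs)"
    unfolding bounded_by_def
  proof
    fix i
    show "\<bar>load_input xs i\<bar> < 2 ^ input_size xs"
    proof (cases "i < length xs")
      case True
      then have "bits (xs ! i) \<in> set (map bits xs)" by simp
      then have "bits (xs ! i) \<le> input_size xs" unfolding input_size_def by (rule member_le_sum_list) simp
      then have "(2::int) ^ bits (xs ! i) \<le> 2 ^ input_size xs" by simp
      with less_two_power_bits have "\<bar>xs ! i\<bar> < 2 ^ input_size xs" by (rule less_le_trans)
      then show ?thesis using True by (simp add: load_input_def)
    qed (simp add: load_input_def)
  qed
  ultimately obtain M1 t1 where 1: "run (compile algorithm) (load_input xs) M1 t1" "represents n s M1"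
    "bounded_by (input_size xs + poly (width_poly algorithm) n) M1"
    "t1 \<le> poly (time_poly algorithm) n * (input_size xs + poly (width_poly algorithm) n + 1)"
    using wf_prog_simulates[OF wf_algorithm, of n] unfolding simulates_def s_def by blast
  let ?B = "input_size xs + poly (width_poly algorithm) n"
  have v: "val (comp_aexp (Var OUT)) M1 = arr s OUT 0"
    using val_comp_aexp[OF 1(2), of "Var OUT"] by simp
  define M where "M = M1(0 := arr s OUT 0)"
  have "additive (comp_aexp (Var OUT))" by simp
  then obtain t2 where 2: "run final_store M1 M t2"
    "t2 \<le> store_cost (Const 0) (comp_aexp (Var OUT)) * (?B + 1)"
    using run_store_bounded[OF 1(3), of "Const 0" "comp_aexp (Var OUT)" 0 "arr s OUT 0"] v
    unfolding final_store_def M_def by auto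
  have "M v = raw s v" if "v < n" "0 < v" for v
  proof -
    have "n * 1 \<le> n * (832 * n)" using n by (intro mult_le_mono) auto
    moreover have "input_cells n = n * (832 * n)" by (simp add: input_cells_def)
    ultimately have "v < input_cells n" using that by linarith
    then show ?thesis using 1(2) that by (simp add: M_def represents_def)
  qed
  moreover have "run program (load_input xs) M (t1 + t2)"
    unfolding program_def by (rule run_Seq[OF 1(1) 2(1)])
  moreover have "t1 + t2 \<le> (poly (time_poly algorithm) n + store_cost (Const 0) (comp_aexp (Var OUT))) * (?B + 1)"
    using 1(4) 2(2) by (simp only: add_mult_distrib)
  ultimately show ?thesis by (intro exI[of _ M] exI[of _ "t1 + t2"]) (auto simp: M_def)
qed

section \<open>Layout of the encoded input\<close>

lemma concat_uniform:
  assumes "\<And>u. u < m \<Longrightarrow> length (g u) = l"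
  shows "length (concat (map g [0..<m])) = m * l"
    "u < m \<Longrightarrow> j < l \<Longrightarrow> concat (map g [0..<m]) ! (u * l + j) = g u ! j"
proof -
  show len: "length (concat (map g [0..<m])) = m * l" using assms
    by (induction m) auto
  show "u < m \<Longrightarrow> j < l \<Longrightarrow> concat (map g [0..<m]) ! (u * l + j) = g u ! j"
    using assms
  proof (induction m)
    case (Suc m)
    have "length (concat (map g [0..<m])) = m * l" using Suc.prems(3)
      by (induction m) auto
    moreover have "u * l + j < m * l" if "u < m"
    proof -
      have "u * l + j < Suc u * l" using Suc.prems(2) by simp
      also have "\<dots> \<le> m * l" using that by (intro mult_right_mono) auto
      finally show ?thesis .
    qed
    ultimately show ?case using Suc by (cases "u = m") (auto simp: nth_append)
  qed simp
qed

lemma enc_table_uniform: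
  assumes "\<And>u v. length (f u v) = k"
  shows "length (enc_table n f) = n * (n * k)"
    "u < n \<Longrightarrow> v < n \<Longrightarrow> r < k \<Longrightarrow> enc_table n f ! ((u * n + v) * k + r) = f u v ! r"
proof -
  have row: "length (concat (map (f u) [0..<n])) = n * k" for u
    by (rule concat_uniform(1)) (rule assms)
  show "length (enc_table n f) = n * (n * k)"
    unfolding enc_table_def by (rule concat_uniform(1)) (rule row)
  assume u: "u < n" and v: "v < n" and r: "r < k"
  have "v * k + r < Suc v * k" using r by simp
  also have "\<dots> \<le> n * k" using v by (intro mult_right_mono) auto
  finally have "enc_table n f ! (u * (n * k) + (v * k + r)) = concat (map (f u) [0..<n]) ! (v * k + r)"
    unfolding enc_table_def by (intro concat_uniform(2)[OF row u])
  also have "\<dots> = f u v ! r" by (rule concat_uniform(2)[OF assms v r])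
  finally show "enc_table n f ! ((u * n + v) * k + r) = f u v ! r" by (simp add: algebra_simps)
qed

lemma of_rat_quotient: "of_rat q = real_of_int (fst (quotient_of q)) / real_of_int (snd (quotient_of q))"
  by (metis Fract_of_int_quotient of_rat_rat prod.collapse quotient_of_denom_pos' quotient_of_div
      of_rat_divide of_rat_of_int_eq)

section \<open>Correctness on valid inputs\<close>

context
  fixes n :: nat and E :: "nat set set" and \<Delta> :: nat and \<delta> h lam :: rat
    and x y :: "nat set \<Rightarrow> rat"
  assumes valid: "valid_input (n, E, \<Delta>, \<delta>, h, lam, x, y)"
begin

interpretation S: sdp_solution "{..<n}" E \<Delta> "of_rat \<delta>" "of_rat h" "of_rat lam"
    "\<lambda>e. of_rat (x e)" "\<lambda>e. of_rat (y e)"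
  using valid by (simp add: sdp_solution_def)

lemma S_n: "S.n = n"
  by (simp add: S.n_def)

definition input :: "int list" where "input = enc_input (n, E, \<Delta>, \<delta>, h, lam, x, y)"

definition header :: "int list" where
  "header = [int n, int \<Delta>] @ enc_rat \<delta> @ enc_rat h @ enc_rat lam"

definition adj_part :: "int list" where
  "adj_part = enc_table n (\<lambda>u v. [if {u, v} \<in> E then 1 else 0])"

definition x_part :: "int list" where
  "x_part = enc_table n (\<lambda>u v. enc_rat (if {u, v} \<in> E then x {u, v} else 0))"

definition y_part :: "int list" where
  "y_part = enc_table n (\<lambda>u v. enc_rat (if u \<noteq> v then y {u, v} else 0))"

lemma input_parts: "input = header @ adj_part @ x_part @ y_part"
  by (simp add: input_def header_def adj_part_def x_part_def y_part_def)

lemma lengths: "length header = 8" "length adj_part = n * n" "length x_part = n * n * 2" "length y_part = n * n * 2"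
proof -
  show "length header = 8" by (simp add: header_def enc_rat_def)
  show "length adj_part = n * n" unfolding adj_part_def by (subst enc_table_uniform(1)[where k = 1]) auto
  show "length x_part = n * n * 2" unfolding x_part_def by (subst enc_table_uniform(1)[where k = 2]) (auto simp: enc_rat_def)
  show "length y_part = n * n * 2" unfolding y_part_def by (subst enc_table_uniform(1)[where k = 2]) (auto simp: enc_rat_def)
qed

lemma input_length: "length input = 8 + 5 * (n * n)"
  by (simp add: input_parts lengths)

lemma n_ge2: "n \<ge> 2"
  using S.n_ge2 by (simp add: S_n)

lemma input_length_le: "length input \<le> input_cells n"
proof -
  have "2 * 2 \<le> n * n" using n_ge2 by (intro mult_le_mono) auto
  moreover have "input_cells n = 832 * (n * n)" by (simp add: input_cells_def)
  ultimately show ?thesis using input_length by linarith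
qed

lemma load_header: "load_input input 0 = int n" "load_input input 2 = fst (quotient_of \<delta>)"
  "load_input input 3 = snd (quotient_of \<delta>)"
  by (simp_all add: load_input_def input_def enc_rat_def)

lemma load_adj:
  assumes "u < n" "v < n"
  shows "load_input input (8 + (u * n + v)) = (if {u, v} \<in> E then 1 else 0)"
proof -
  have m: "u * n + v < n * n" by (rule pair_less[OF assms])
  have "load_input input (8 + (u * n + v)) = adj_part ! (u * n + v)"
    using m unfolding load_input_def input_length by (simp add: input_parts nth_append lengths)
  also have "\<dots> = (if {u, v} \<in> E then 1 else 0)"
    using enc_table_uniform(2)[of "\<lambda>u v. [if {u, v} \<in> E then 1 else 0]" 1 u n v 0] assms
    by (simp add: adj_part_def)
  finally show ?thesis .
qed

lemma load_x:
  assumes "u < n" "v < n"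
  defines "q \<equiv> quotient_of (if {u, v} \<in> E then x {u, v} else 0)"
  shows "load_input input (8 + n * n + 2 * (u * n + v)) = fst q"
    "load_input input (9 + n * n + 2 * (u * n + v)) = snd q"
proof -
  have m: "u * n + v < n * n" by (rule pair_less[OF assms(1,2)])
  have l: "load_input input (8 + n * n + (2 * (u * n + v) + r)) = x_part ! ((u * n + v) * 2 + r)" if "r < 2" for r
    using m that unfolding load_input_def input_length by (simp add: input_parts nth_append lengths mult.commute add.assoc)
  have e: "x_part ! ((u * n + v) * 2 + r) = enc_rat (if {u, v} \<in> E then x {u, v} else 0) ! r" if "r < 2" for r
    unfolding x_part_def by (rule enc_table_uniform(2)[OF _ assms(1,2) that]) (simp add: enc_rat_def)
  show "load_input input (8 + n * n + 2 * (u * n + v)) = fst q"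
    using l[of 0] e[of 0] by (simp add: enc_rat_def q_def)
  have idx: "9 + n * n + 2 * (u * n + v) = 8 + n * n + (2 * (u * n + v) + 1)" by simp
  show "load_input input (9 + n * n + 2 * (u * n + v)) = snd q"
  proof -
    have "load_input input (8 + n * n + (2 * (u * n + v) + 1)) = x_part ! ((u * n + v) * 2 + 1)"
      by (rule l) simp
    also have "\<dots> = snd q" using e[of 1] by (simp add: enc_rat_def q_def)
    finally show ?thesis unfolding idx .
  qed
qed

definition s0 :: state where "s0 = \<lparr>raw = load_input input, ctr = \<lambda>_. 0, arr = \<lambda>_ _. 0\<rparr>"
definition s1 :: state where "s1 = sem n read_prog s0"
definition s2 :: state where "s2 = sem n max_prog s1"
definition s3 :: state where "s3 = sem n count_prog s2"

lemma s1_facts: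
  assumes "u < n" "v < n"
  shows "arr s1 ADJ (u * n + v) = (if {u, v} \<in> E then 1 else 0)"
    "arr s1 XD (u * n + v) > 0"
    "S.wt u v = real_of_int (arr s1 XN (u * n + v)) / real_of_int (arr s1 XD (u * n + v))"
proof -
  have n1: "n \<ge> 1" using n_ge2 by simp
  have raw: "raw s0 = load_input input" by (simp add: s0_def)
  note r = read_prog_sem(1)[OF n1 assms, of s0, folded s1_def, unfolded raw load_adj[OF assms] load_x[OF assms]]
  show "arr s1 ADJ (u * n + v) = (if {u, v} \<in> E then 1 else 0)" using r by simp
  show "arr s1 XD (u * n + v) > 0" using r quotient_of_denom_pos' by simp
  have "S.wt u v = of_rat (if {u, v} \<in> E then x {u, v} else 0)" by (simp add: S.wt_def)
  then show "S.wt u v = real_of_int (arr s1 XN (u * n + v)) / real_of_int (arr s1 XD (u * n + v))"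
    unfolding of_rat_quotient using r by simp
qed

lemma s2_max:
  assumes u: "u < n"
  shows "arr s2 MD u > 0" "S.X u = real_of_int (arr s2 MN u) / real_of_int (arr s2 MD u)"
proof -
  let ?q = "real_of_int (arr s2 MN u) / real_of_int (arr s2 MD u)"
  have "is_max s2 (S.wt u) n u"
    using max_prog_sem[of n s1 S.wt] s1_facts u unfolding s2_def by blast
  then have m: "arr s2 MD u > 0" "\<forall>v<n. S.wt u v \<le> ?q" "?q = 0 \<or> (\<exists>v<n. ?q = S.wt u v)"
    unfolding is_max_def by blast+
  show "arr s2 MD u > 0" by (rule m)
  have uV: "u \<in> {..<n}" using u by simp
  have "?q \<le> S.X u" using m(3) S.X_nonneg[OF uV] S.wt_le_X[OF uV] by auto
  moreover obtain v where "v < n" "{u, v} \<in> E" "S.X u = of_rat (x {u, v})"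
    using S.X_attained[OF uV] by auto
  then have "S.X u \<le> ?q" using m(2) by (auto simp: S.wt_def)
  ultimately show "S.X u = ?q" by simp
qed

lemma \<delta>_eq: "of_rat \<delta> = real_of_int (fst (quotient_of \<delta>)) / real_of_int (snd (quotient_of \<delta>))"
  by (rule of_rat_quotient)

lemma min_size_iff:
  "S.min_size \<le> real k \<longleftrightarrow> 3 * (fst (quotient_of \<delta>) * int n) \<le> 8 * (int k * snd (quotient_of \<delta>))"
proof -
  let ?a = "fst (quotient_of \<delta>)" and ?b = "snd (quotient_of \<delta>)"
  have b: "real_of_int ?b > 0" using quotient_of_denom_pos' by simp
  have ms: "S.min_size = 3 * (real_of_int ?a / real_of_int ?b) * n / 8"
    unfolding S.min_size_def S_n by (subst \<delta>_eq) (rule refl)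
  have "3 * (?a * int n) \<le> 8 * (int k * ?b) \<longleftrightarrow>
      real_of_int (3 * (?a * int n)) \<le> real_of_int (8 * (int k * ?b))" by (simp only: of_int_le_iff)
  also have "\<dots> \<longleftrightarrow> 3 * (real_of_int ?a * n) \<le> 8 * (k * real_of_int ?b)" by simp
  also have "\<dots> \<longleftrightarrow> S.min_size \<le> real k"
    unfolding ms using b by (simp add: field_simps)
  finally show ?thesis by simp
qed

text \<open>Here analysis and program meet: the targets are the good sets, and \<delta> is given by
  its reduced fraction.\<close>

interpretation T: rounding_target E n S.jstar "fst (quotient_of \<delta>)" "snd (quotient_of \<delta>)" S.good
proof
  show "2 \<le> card A \<and> 3 * (fst (quotient_of \<delta>) * int n) \<le> 8 * (int (card A) * snd (quotient_of \<delta>))"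
    if "S.good A" for A using S.good_large[OF that] min_size_iff by simp
  show "S.good A \<or> S.good (B - A)" if "S.good B" "sparse_cut E n S.jstar B A" for A B
    using S.jstar_sparse[OF that(1)] that(2) by (simp add: S_n)
  show "1 \<le> S.jstar" "S.jstar \<le> n\<^sup>2" using S.jstar by (simp_all add: S_n)
qed

lemma interval_eq:
  assumes "a < n" "b < n"
  shows "interval n s3 a b = {u\<in>{..<n}. S.X a \<le> S.X u \<and> S.X u \<le> S.X b}"
proof -
  have f: "arr s3 MN = arr s2 MN" "arr s3 MD = arr s2 MD" by (simp_all add: s3_def arr_frame)
  have le: "S.X u \<le> S.X v \<longleftrightarrow> arr s2 MN u * arr s2 MD v \<le> arr s2 MN v * arr s2 MD u"
    if "u < n" "v < n" for u v
  proof -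
    have p: "real_of_int (arr s2 MD u) > 0" "real_of_int (arr s2 MD v) > 0" using s2_max(1) that by auto
    have "arr s2 MN u * arr s2 MD v \<le> arr s2 MN v * arr s2 MD u \<longleftrightarrow>
      real_of_int (arr s2 MN u * arr s2 MD v) \<le> real_of_int (arr s2 MN v * arr s2 MD u)"
      by (simp only: of_int_le_iff)
    also have "\<dots> \<longleftrightarrow> S.X u \<le> S.X v"
      unfolding s2_max(2)[OF that(1)] s2_max(2)[OF that(2)] using p by (simp add: divide_le_eq le_divide_eq field_simps)
    finally show ?thesis by simp
  qed
  show ?thesis unfolding interval_def f using le assms by auto
qed

lemma final_state:
  defines "s \<equiv> sem n algorithm s0"
  shows "\<exists>A. expanding_set (1 / 204800) 8 {..<n} E \<Delta> (of_rat \<delta>) (of_rat h) (of_rat lam) A \<and>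
    A \<subseteq> {..<n} \<and> arr s OUT 0 = (if 0 \<in> A then 1 else 0) \<and>
    (\<forall>u<n. 0 < u \<longrightarrow> raw s u = (if u \<in> A then 1 else 0))"
proof -
  have n1: "n \<ge> 1" using n_ge2 by simp
  have raw: "raw s0 = load_input input" by (simp add: s0_def)
  have f: "arr s3 ADJ = arr s1 ADJ" "arr s3 DN = arr s1 DN" "arr s3 DD = arr s1 DD"
    by (simp_all add: s3_def s2_def arr_frame)
  have d: "arr s1 DN 0 = fst (quotient_of \<delta>)" "arr s1 DD 0 = snd (quotient_of \<delta>)"
    using read_prog_sem(2,3)[OF n1, of s0] by (simp_all add: s1_def raw load_header)
  have ready: "T.ready s3"
    using s1_facts(1) by (simp add: T.ready_def adj_table_def f d)
  have J: "arr s3 JJ 0 = int (n * n)" unfolding s3_def by (rule count_prog_sem)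
  obtain a b where ab: "a < n" "b < n" "S.good {u\<in>{..<n}. S.X a \<le> S.X u \<and> S.X u \<le> S.X b}"
    using S.good_interval by auto
  define s4 where "s4 = sem n main_loop s3"
  have "T.out_ok s4"
    unfolding s4_def by (rule T.main_loop_sem[OF ready J ab(1,2)]) (use ab interval_eq in simp)
  then obtain j A where A: "1 \<le> j" "j \<le> S.jstar" "A \<subseteq> {..<n}" "2 \<le> card A"
    "3 * (fst (quotient_of \<delta>) * int n) \<le> 8 * (int (card A) * snd (quotient_of \<delta>))"
    "sweep_free E n j A" "\<forall>u<n. arr s4 OUT u = (if u \<in> A then 1 else 0)"
    unfolding T.out_ok_def by blast
  have ex: "expanding_set (1 / 204800) 8 {..<n} E \<Delta> (of_rat \<delta>) (of_rat h) (of_rat lam) A"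
    by (rule S.output_expanding[OF A(3,4) _ A(1,2)]) (use A(5,6) min_size_iff in \<open>simp_all add: S_n\<close>)
  have s: "s = sem n out_prog s4"
    unfolding s_def algorithm_def sem.simps(5) s1_def[symmetric] s2_def[symmetric] s3_def[symmetric]
      s4_def[symmetric] ..
  have "arr s OUT 0 = (if 0 \<in> A then 1 else 0)"
    using A(7) n1 unfolding s out_prog_sem(2) by simp
  moreover have "\<forall>u<n. 0 < u \<longrightarrow> raw s u = (if u \<in> A then 1 else 0)"
    using A(7) out_prog_sem(1)[of n s4] unfolding s by simp
  ultimately show ?thesis using ex A(3) by blast
qed

text \<open>Each entry of the encoding has at least one bit. This turns bounds in n into bounds in
  the input size.\<close>

lemma size_bounds: "n \<le> input_size input"
proof -
  have "length xs \<le> sum_list (map bits xs)" for xs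
    by (induction xs) (auto simp: bits_def)
  then have "length input \<le> input_size input" by (simp add: input_size_def)
  moreover have "n * 1 \<le> n * n" using n_ge2 by (intro mult_left_mono) auto
  ultimately show ?thesis using input_length by linarith
qed

text \<open>The second factor is one plus the width of the memory: initially at most the input size,
  then widened by \<open>width_poly\<close>.\<close>

definition time_bound :: "nat poly" where
  "time_bound = (time_poly algorithm + [:store_cost (Const 0) (comp_aexp (Var OUT)):])
     * ([:1, 1:] + width_poly algorithm)"

lemma program_correct:
  "\<exists>M t. run program (load_input input) M t \<and> t \<le> poly time_bound (input_size input) \<and>
     correct_output (1 / 204800) 8 (n, E, \<Delta>, \<delta>, h, lam, x, y) M"
proof -
  have n1: "n \<ge> 1" using n_ge2 by simp
  have ne: "input \<noteq> []" "input ! 0 = int n" by (simp_all add: input_def)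
  obtain M t where M: "run program (load_input input) M t"
    "t \<le> (poly (time_poly algorithm) n + store_cost (Const 0) (comp_aexp (Var OUT)))
         * (input_size input + poly (width_poly algorithm) n + 1)"
    "M 0 = arr (sem n algorithm s0) OUT 0" "\<forall>v<n. 0 < v \<longrightarrow> M v = raw (sem n algorithm s0) v"
    using algorithm_run[OF n1 ne input_length_le] unfolding s0_def by blast
  obtain A where A: "expanding_set (1 / 204800) 8 {..<n} E \<Delta> (of_rat \<delta>) (of_rat h) (of_rat lam) A"
    "A \<subseteq> {..<n}" "arr (sem n algorithm s0) OUT 0 = (if 0 \<in> A then 1 else 0)"
    "\<forall>u<n. 0 < u \<longrightarrow> raw (sem n algorithm s0) u = (if u \<in> A then 1 else 0)"
    using final_state by blast
  have Mv: "M v = (if v \<in> A then 1 else 0)" if "v < n" for v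
    using M(3,4) A(3,4) that by (cases "v = 0") auto
  have "{v. v < n \<and> M v = 1} = A" using Mv A(2) by (auto split: if_splits)
  then have "correct_output (1 / 204800) 8 (n, E, \<Delta>, \<delta>, h, lam, x, y) M"
    using A(1) Mv by simp
  moreover have "t \<le> poly time_bound (input_size input)"
  proof -
    note mono = poly_nat_mono[OF size_bounds]
    have "t \<le> (poly (time_poly algorithm) (input_size input) + store_cost (Const 0) (comp_aexp (Var OUT)))
         * (input_size input + poly (width_poly algorithm) (input_size input) + 1)"
      by (rule order_trans[OF M(2)], rule mult_mono) (auto intro: add_mono mono)
    also have "\<dots> = poly time_bound (input_size input)"
      by (simp only: time_bound_def poly_mult poly_add poly_pCons poly_0 mult_zero_right add_0_right)
        (simp add: algebra_simps)
    finally show ?thesis .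
  qed
  ultimately show ?thesis using M(1) by blast
qed

end

theorem theorem1p6:
  shows "\<exists>c C :: real. c > 0 \<and> C > 0 \<and>
    (\<exists>P. poly_time_solves P enc_input valid_input (correct_output c C)) \<and>
    (\<forall>V E \<Delta> \<delta> h lam x y. admissible_input V E \<Delta> \<delta> h lam x y \<longrightarrow>
       (\<exists>S. expanding_set c C V E \<Delta> \<delta> h lam S))"
proof (rule exI[of _ "1 / 204800"], rule exI[of _ 8], intro conjI allI impI)
  have "poly_time_solves program enc_input valid_input (correct_output (1 / 204800) 8)"
    unfolding poly_time_solves_def
  proof (intro exI[of _ time_bound] allI impI)
    fix i assume i: "valid_input i"
    obtain n E \<Delta> \<delta> h lam xy where "i = (n, E, \<Delta>, \<delta>, h, lam, xy)" by (cases i rule: prod_cases7)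
    moreover obtain x y where "xy = (x, y)" by (cases xy)
    ultimately have e: "i = (n, E, \<Delta>, \<delta>, h, lam, x, y)" by simp
    show "\<exists>M t. run program (load_input (enc_input i)) M t \<and> t \<le> poly time_bound (input_size (enc_input i)) \<and>
        correct_output (1 / 204800) 8 i M"
      using program_correct[OF i[unfolded e]] unfolding e input_def[OF i[unfolded e]] .
  qed
  then show "\<exists>P. poly_time_solves P enc_input valid_input (correct_output (1 / 204800) 8)" ..
next
  fix V E \<Delta> \<delta> h lam x y
  assume "admissible_input V E \<Delta> \<delta> h lam x y"
  then interpret sdp_solution V E \<Delta> \<delta> h lam x y by (simp add: sdp_solution_def)
  show "\<exists>S. expanding_set (1 / 204800) 8 V E \<Delta> \<delta> h lam S" by (rule expanding_exists)
qed simp_all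

end
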